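(* Let $\lambda\in\Lambda_n$ be a dominant weight for $\mathfrak p(n)$. There is an isomorphism $$L(\lambda^\sharp)\simeq\Pi^mL(\lambda)^*,\qquad m=\tfrac{|\lambda^\sharp|+|\lambda|}{2}.$$
   Context: Everything is over $\mathbb C$. $\mathfrak g=\mathfrak p(n)\subset\mathfrak{gl}(n|n)$ is the Lie superalgebra of matrices $\begin{pmatrix}A&B\\C&-A^t\end{pmatrix}$ with $B^t=B$, $C^t=-C$ ($n\times n$ blocks), with $\mathbb Z$-grading $\mathfrak g=\mathfrak g_{-1}\oplus\mathfrak g_0\oplus\mathfrak g_1$: $\mathfrak g_0\cong\mathfrak{gl}(n)$ (block $A$), $\mathfrak g_1$ (block $B$), $\mathfrak g_{-1}$ (block $C$). Dominant weights: $\Lambda_n=\{\lambda=(\lambda_1\ge\dots\ge\lambda_n)\in\mathbb Z^n\}$, $|\lambda|=\sum_i\lambda_i$. $V(\lambda)$ is the simple $\mathfrak{gl}(n)$-module of highest weight $\lambda$, placed in even degree; $L(\lambda)$ is the unique simple quotient of $\mathrm{Ind}^{\mathfrak g}_{\mathfrak g_0\oplus\mathfrak g_{-1}}V(\lambda)$ ($\mathfrak g_{-1}$ acting by $0$), so it has highest weight $\lambda$ with respect to $\mathfrak b_0\oplus\mathfrak g_{-1}$, with even highest weight vector. $W^*$ is the dual $\mathfrak g$-supermodule and $\Pi$ is parity switch. Weight diagrams: $\bar\lambda_i=\lambda_i+n-i$; the diagram $d_\lambda$ has a black ball at each position in $c_\lambda=\{\bar\lambda_1,\dots,\bar\lambda_n\}\subset\mathbb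 Z$ and all other positions are empty; $\lambda\mapsto d_\lambda$ is a bijection onto diagrams with exactly $n$ black balls. Definition of $\lambda^\sharp$: number the black balls of a diagram $1,\dots,n$ from right to left, with positions $p_1>\dots>p_n$. For $1\le a<b\le n$ and a dominant weight $\nu$, let $m_{a,b}(\nu)$ be the weight whose diagram is obtained from $d_\nu$ by moving both the $a$-th and the $b$-th black ball one position to the right, provided both positions $p_a+1$ and $p_b+1$ are empty in $d_\nu$; otherwise $m_{a,b}(\nu)=\nu$. Starting with $\lambda$, apply successively $m_{a,b}$ for all pairs in the lexicographic order $(1,2),(1,3),\dots,(1,n),(2,3),\dots,(n-1,n)$ (each time to the result of the previous step). The result is $\lambda^\dagger$. Then $\lambda^\sharp$ is the weight whose diagram is the reflection of $d_{\lambda^\dagger}$ at the point $\frac{n-1}2$, i.e. $c_{\lambda^\sharp}=\{n-1-x: x\in c_{\lambda^\dagger}\}$. *)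

theory Defs
  imports
    "Jordan_Normal_Form.Matrix"
    "HOL-Algebra.Algebraic_Closure_Type"
    "HOL-Library.Poly_Mapping"
    "HOL-Library.Z2"
begin

section \<open>Lie superalgebras of block matrices\<close>

text \<open>
  Parities are elements of \<^typ>\<open>bit\<close>, the field with two elements. Every Lie superalgebra below is
  a graded subspace of \<open>gl(n|n)\<close>, that is, a set of complex \<open>2n \<times> 2n\<close> matrices which is closed under
  the supercommutator.
\<close>

definition koszul_sign :: "bit \<Rightarrow> bit \<Rightarrow> complex" where
  "koszul_sign p q = (if p = 1 \<and> q = 1 then - 1 else 1)"

definition hom_comp :: "nat \<Rightarrow> bit \<Rightarrow> complex mat \<Rightarrow> complex mat" where
  "hom_comp n p x =
    (case split_block x n n of (A, B, C, D) \<Rightarrow>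
      if p = 0 then four_block_mat A (0\<^sub>m n n) (0\<^sub>m n n) D
      else four_block_mat (0\<^sub>m n n) B C (0\<^sub>m n n))"

definition hom_part :: "nat \<Rightarrow> complex mat set \<Rightarrow> bit \<Rightarrow> complex mat set" where
  "hom_part n g p = {x \<in> g. hom_comp n p x = x}"

definition superbracket :: "bit \<Rightarrow> bit \<Rightarrow> complex mat \<Rightarrow> complex mat \<Rightarrow> complex mat" where
  "superbracket p q x y = x * y - koszul_sign p q \<cdot>\<^sub>m (y * x)"

definition periplectic :: "nat \<Rightarrow> complex mat set" where
  "periplectic n = {four_block_mat A B C (- transpose_mat A) | A B C.
     A \<in> carrier_mat n n \<and> B \<in> carrier_mat n n \<and> C \<in> carrier_mat n n \<and>
     transpose_mat B = B \<and> transpose_mat C = - C}"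

definition gl_embed :: "nat \<Rightarrow> complex mat \<Rightarrow> complex mat" where
  "gl_embed n A = four_block_mat A (0\<^sub>m n n) (0\<^sub>m n n) (- transpose_mat A)"

text \<open>The subalgebra \<open>g_0\<close>, identified with \<open>gl(n)\<close> through the upper left block.\<close>

definition periplectic_zero :: "nat \<Rightarrow> complex mat set" where
  "periplectic_zero n = gl_embed n ` carrier_mat n n"

text \<open>The subalgebra \<open>g_0 \<oplus> g_{-1}\<close>.\<close>

definition periplectic_nonpos :: "nat \<Rightarrow> complex mat set" where
  "periplectic_nonpos n = {four_block_mat A (0\<^sub>m n n) C (- transpose_mat A) | A C.
     A \<in> carrier_mat n n \<and> C \<in> carrier_mat n n \<and> transpose_mat C = - C}"


section \<open>Supermodules\<close>

abbreviation complex_ring :: "complex ring" where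
  "complex_ring \<equiv> ring_of_type_algebra"

text \<open>The fields \<^const>\<open>monoid.mult\<close> and \<^const>\<open>one\<close> inherited from the library record are not used.\<close>

record 'v smod = "(complex, 'v) module" +
  part :: "bit \<Rightarrow> 'v set"
  act :: "complex mat \<Rightarrow> 'v \<Rightarrow> 'v"

locale supermodule = Module.module complex_ring M
  for n :: nat and g :: "complex mat set" and M :: "('v, 'm) smod_scheme" (structure) +
  assumes part_submodule: "submodule (part M p) complex_ring M"
    and part_sum: "carrier M = part M 0 <+>\<^bsub>M\<^esub> part M 1"
    and part_inter: "part M 0 \<inter> part M 1 = {\<zero>}"
    and act_closed: "\<lbrakk>x \<in> g; v \<in> carrier M\<rbrakk> \<Longrightarrow> act M x v \<in> carrier M"
    and act_add: "\<lbrakk>x \<in> g; v \<in> carrier M; w \<in> carrier M\<rbrakk> \<Longrightarrow> act M x (v \<oplus> w) = act M x v \<oplus> act M x w"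
    and act_smult: "\<lbrakk>x \<in> g; v \<in> carrier M\<rbrakk> \<Longrightarrow> act M x (c \<odot> v) = c \<odot> act M x v"
    and add_act: "\<lbrakk>x \<in> g; y \<in> g; v \<in> carrier M\<rbrakk> \<Longrightarrow> act M (x + y) v = act M x v \<oplus> act M y v"
    and smult_act: "\<lbrakk>x \<in> g; v \<in> carrier M\<rbrakk> \<Longrightarrow> act M (c \<cdot>\<^sub>m x) v = c \<odot> act M x v"
    and act_part: "\<lbrakk>x \<in> hom_part n g p; v \<in> part M q\<rbrakk> \<Longrightarrow> act M x v \<in> part M (p + q)"
    and act_superbracket: "\<lbrakk>x \<in> hom_part n g p; y \<in> hom_part n g q; v \<in> carrier M\<rbrakk> \<Longrightarrow>
      act M (superbracket p q x y) v
        = act M x (act M y v) \<ominus> koszul_sign p q \<odot> act M y (act M x v)"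

definition graded_submodule :: "complex mat set \<Rightarrow> 'v smod \<Rightarrow> 'v set \<Rightarrow> bool" where
  "graded_submodule g M N \<longleftrightarrow>
     submodule N complex_ring M \<and> (\<forall>x\<in>g. \<forall>v\<in>N. act M x v \<in> N) \<and>
     N = (N \<inter> part M 0) <+>\<^bsub>M\<^esub> (N \<inter> part M 1)"

definition simple_supermodule :: "nat \<Rightarrow> complex mat set \<Rightarrow> 'v smod \<Rightarrow> bool" where
  "simple_supermodule n g M \<longleftrightarrow>
     supermodule n g M \<and> carrier M \<noteq> {\<zero>\<^bsub>M\<^esub>} \<and>
     (\<forall>N. graded_submodule g M N \<longrightarrow> N = {\<zero>\<^bsub>M\<^esub>} \<or> N = carrier M)"

definition smod_hom :: "complex mat set \<Rightarrow> 'v smod \<Rightarrow> 'w smod \<Rightarrow> ('v \<Rightarrow> 'w) set" where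
  "smod_hom g M N = {\<phi>. \<phi> \<in> carrier M \<rightarrow> carrier N \<and>
     (\<forall>v\<in>carrier M. \<forall>w\<in>carrier M. \<phi> (v \<oplus>\<^bsub>M\<^esub> w) = \<phi> v \<oplus>\<^bsub>N\<^esub> \<phi> w) \<and>
     (\<forall>c. \<forall>v\<in>carrier M. \<phi> (c \<odot>\<^bsub>M\<^esub> v) = c \<odot>\<^bsub>N\<^esub> \<phi> v) \<and>
     (\<forall>p. \<phi> ` part M p \<subseteq> part N p) \<and>
     (\<forall>x\<in>g. \<forall>v\<in>carrier M. \<phi> (act M x v) = act N x (\<phi> v))}"

definition smod_iso :: "complex mat set \<Rightarrow> 'v smod \<Rightarrow> 'w smod \<Rightarrow> bool" where
  "smod_iso g M N \<longleftrightarrow> (\<exists>\<phi>\<in>smod_hom g M N. bij_betw \<phi> (carrier M) (carrier N))"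

definition parity_switch :: "'v smod \<Rightarrow> 'v smod" where
  "parity_switch M = M\<lparr>part := (\<lambda>p. part M (p + 1))\<rparr>"

text \<open>As \<^const>\<open>parity_switch\<close> is an involution, its \<open>m\<close>-th power depends only on \<open>m\<close> modulo 2.\<close>

definition parity_switch_power :: "int \<Rightarrow> 'v smod \<Rightarrow> 'v smod" where
  "parity_switch_power m = parity_switch ^^ nat \<bar>m\<bar>"

definition proj :: "'v smod \<Rightarrow> bit \<Rightarrow> 'v \<Rightarrow> 'v" where
  "proj M p v = (THE u. u \<in> part M p \<and> (\<exists>w\<in>part M (p + 1). v = u \<oplus>\<^bsub>M\<^esub> w))"

text \<open>
  The dual supermodule: \<open>(x f) v = - (-1)\<^bsup>|x| |f|\<^esup> f (x v)\<close> for homogeneous \<open>x\<close> and \<open>f\<close>. The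
  component of parity \<open>q\<close> of a functional \<open>f\<close> is \<open>f \<circ> proj M q\<close>.
\<close>

definition dual :: "nat \<Rightarrow> 'v smod \<Rightarrow> ('v \<Rightarrow> complex) smod" where
  "dual n M = \<lparr>
     carrier = {f \<in> extensional (carrier M).
       (\<forall>v\<in>carrier M. \<forall>w\<in>carrier M. f (v \<oplus>\<^bsub>M\<^esub> w) = f v + f w) \<and>
       (\<forall>c. \<forall>v\<in>carrier M. f (c \<odot>\<^bsub>M\<^esub> v) = c * f v)},
     monoid.mult = undefined,
     one = undefined,
     ring.zero = (\<lambda>v\<in>carrier M. 0),
     add = (\<lambda>f h. \<lambda>v\<in>carrier M. f v + h v),
     module.smult = (\<lambda>c f. \<lambda>v\<in>carrier M. c * f v),
     part = (\<lambda>p. {f \<in> extensional (carrier M).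
       (\<forall>v\<in>carrier M. \<forall>w\<in>carrier M. f (v \<oplus>\<^bsub>M\<^esub> w) = f v + f w) \<and>
       (\<forall>c. \<forall>v\<in>carrier M. f (c \<odot>\<^bsub>M\<^esub> v) = c * f v) \<and>
       (\<forall>v\<in>part M (p + 1). f v = 0)}),
     act = (\<lambda>x f. \<lambda>v\<in>carrier M.
       - (\<Sum>p\<in>{0, 1}. \<Sum>q\<in>{0, 1}. koszul_sign p q * f (proj M q (act M (hom_comp n p x) v))))\<rparr>"


section \<open>Induced supermodules\<close>

text \<open>
  For \<open>h \<subseteq> g\<close> and an \<open>h\<close>-supermodule \<open>V\<close>, the induced module \<open>U(g) \<otimes>\<^bsub>U(h)\<^esub> V\<close> is the quotient of the
  free vector space on the symbols \<open>x\<^sub>1 \<dots> x\<^sub>k \<otimes> v\<close>, with all \<open>x\<^sub>i \<in> g\<close> and \<open>v \<in> V\<close>, by multilinearity, the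
  defining relations of the universal enveloping superalgebra, and the relations
  \<open>x\<^sub>1 \<dots> x\<^sub>k y \<otimes> v = x\<^sub>1 \<dots> x\<^sub>k \<otimes> y v\<close> for \<open>y \<in> h\<close>.
\<close>

type_synonym 'v symb = "complex mat list \<times> 'v"

definition symbols :: "complex mat set \<Rightarrow> 'v smod \<Rightarrow> 'v symb set" where
  "symbols g V = lists g \<times> carrier V"

definition pm_scale :: "complex \<Rightarrow> ('k \<Rightarrow>\<^sub>0 complex) \<Rightarrow> ('k \<Rightarrow>\<^sub>0 complex)" where
  "pm_scale c = Poly_Mapping.map ((*) c)"

definition free_vs :: "'k set \<Rightarrow> (complex, 'k \<Rightarrow>\<^sub>0 complex) module" where
  "free_vs S = \<lparr>carrier = {f. Poly_Mapping.keys f \<subseteq> S}, monoid.mult = undefined, one = undefined,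
     ring.zero = 0, add = (+), module.smult = pm_scale\<rparr>"

definition free_span :: "'k set \<Rightarrow> ('k \<Rightarrow>\<^sub>0 complex) set \<Rightarrow> ('k \<Rightarrow>\<^sub>0 complex) set" where
  "free_span S T = (\<lambda>N. submodule N complex_ring (free_vs S)) hull T"

abbreviation tens :: "complex mat list \<Rightarrow> 'v \<Rightarrow> ('v symb \<Rightarrow>\<^sub>0 complex)" where
  "tens u v \<equiv> Poly_Mapping.single (u, v) 1"

inductive_set ind_relators ::
    "nat \<Rightarrow> complex mat set \<Rightarrow> complex mat set \<Rightarrow> 'v smod \<Rightarrow> ('v symb \<Rightarrow>\<^sub>0 complex) set"
  for n g h and V :: "'v smod" where
  letter_add: "\<lbrakk>u \<in> lists g; w \<in> lists g; x \<in> g; y \<in> g; v \<in> carrier V\<rbrakk> \<Longrightarrow>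
    tens (u @ [x + y] @ w) v - tens (u @ [x] @ w) v - tens (u @ [y] @ w) v
      \<in> ind_relators n g h V"
| letter_smult: "\<lbrakk>u \<in> lists g; w \<in> lists g; x \<in> g; v \<in> carrier V\<rbrakk> \<Longrightarrow>
    tens (u @ [c \<cdot>\<^sub>m x] @ w) v - pm_scale c (tens (u @ [x] @ w) v) \<in> ind_relators n g h V"
| vector_add: "\<lbrakk>u \<in> lists g; v \<in> carrier V; v' \<in> carrier V\<rbrakk> \<Longrightarrow>
    tens u (v \<oplus>\<^bsub>V\<^esub> v') - tens u v - tens u v' \<in> ind_relators n g h V"
| vector_smult: "\<lbrakk>u \<in> lists g; v \<in> carrier V\<rbrakk> \<Longrightarrow>
    tens u (c \<odot>\<^bsub>V\<^esub> v) - pm_scale c (tens u v) \<in> ind_relators n g h V"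
| enveloping: "\<lbrakk>u \<in> lists g; w \<in> lists g; x \<in> hom_part n g p; y \<in> hom_part n g q; v \<in> carrier V\<rbrakk> \<Longrightarrow>
    tens (u @ [x, y] @ w) v - pm_scale (koszul_sign p q) (tens (u @ [y, x] @ w) v)
      - tens (u @ [superbracket p q x y] @ w) v \<in> ind_relators n g h V"
| balanced: "\<lbrakk>u \<in> lists g; x \<in> h; v \<in> carrier V\<rbrakk> \<Longrightarrow>
    tens (u @ [x]) v - tens u (act V x v) \<in> ind_relators n g h V"

text \<open>
  \<open>hom_tensors n g V p\<close>: the tensors of total parity \<open>p\<close> with all factors homogeneous.
\<close>

definition hom_tensors :: "nat \<Rightarrow> complex mat set \<Rightarrow> 'v smod \<Rightarrow> bit \<Rightarrow> ('v symb \<Rightarrow>\<^sub>0 complex) set" where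
  "hom_tensors n g V p = {tens u v | u v ps q.
     list_all2 (\<lambda>x r. x \<in> hom_part n g r) u ps \<and> v \<in> part V q \<and> sum_list ps + q = p}"

definition prepend :: "complex mat \<Rightarrow> ('v symb \<Rightarrow>\<^sub>0 complex) \<Rightarrow> ('v symb \<Rightarrow>\<^sub>0 complex)" where
  "prepend x f = (\<Sum>(u, v)\<in>Poly_Mapping.keys f. Poly_Mapping.single (x # u, v) (Poly_Mapping.lookup f (u, v)))"

text \<open>
  Elements of the quotient are cosets of the span \<open>R\<close> of the relators; the operations are those
  induced from representatives.
\<close>

definition Ind ::
    "nat \<Rightarrow> complex mat set \<Rightarrow> complex mat set \<Rightarrow> 'v smod \<Rightarrow> ('v symb \<Rightarrow>\<^sub>0 complex) set smod" where
  "Ind n g h V =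
    (let F = free_vs (symbols g V); R = free_span (symbols g V) (ind_relators n g h V) in
     \<lparr>carrier = a_rcosets\<^bsub>F\<^esub> R,
      monoid.mult = undefined,
      one = undefined,
      ring.zero = R,
      add = set_add F,
      module.smult = (\<lambda>c K. \<Union>f\<in>K. R +>\<^bsub>F\<^esub> pm_scale c f),
      part = (\<lambda>p. (\<lambda>f. R +>\<^bsub>F\<^esub> f) ` free_span (symbols g V) (hom_tensors n g V p)),
      act = (\<lambda>x K. \<Union>f\<in>K. R +>\<^bsub>F\<^esub> prepend x f)\<rparr>)"


section \<open>The simple modules \<open>V(\<lambda>)\<close> and \<open>L(\<lambda>)\<close>\<close>

definition dominant_weights :: "nat \<Rightarrow> int list set" where
  "dominant_weights n = {lam. length lam = n \<and> sorted_wrt (\<ge>) lam}"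

text \<open>
  A highest weight vector, with respect to the upper triangular Borel subalgebra of \<open>gl(n)\<close>: strictly
  upper triangular matrices act by zero and a diagonal matrix acts through the weight.
\<close>

definition highest_weight_vector :: "nat \<Rightarrow> int list \<Rightarrow> 'v smod \<Rightarrow> 'v \<Rightarrow> bool" where
  "highest_weight_vector n lam V v \<longleftrightarrow> v \<in> carrier V \<and> v \<noteq> \<zero>\<^bsub>V\<^esub> \<and>
     (\<forall>A\<in>carrier_mat n n. upper_triangular A \<longrightarrow>
        act V (gl_embed n A) v = (\<Sum>i<n. A $$ (i, i) * of_int (lam ! i)) \<odot>\<^bsub>V\<^esub> v)"

text \<open>
  \<open>V(\<lambda>)\<close> and \<open>L(\<lambda>)\<close> are defined up to isomorphism. \<open>is_V n lam V\<close> says that \<open>V\<close> is a model of \<open>V(\<lambda>)\<close>,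
  placed in even degree, for the weight \<open>lam\<close> (\<open>\<lambda>\<close> is reserved for abstraction), and \<open>is_L n V L\<close> that \<open>L\<close> is a model of the simple quotient of the module induced from \<open>V\<close>.
\<close>

definition is_V :: "nat \<Rightarrow> int list \<Rightarrow> 'v smod \<Rightarrow> bool" where
  "is_V n lam V \<longleftrightarrow> simple_supermodule n (periplectic_zero n) V \<and> part V 1 = {\<zero>\<^bsub>V\<^esub>} \<and>
     (\<exists>v. highest_weight_vector n lam V v)"

text \<open>The extension of \<open>V\<close> to \<open>g_0 \<oplus> g_{-1}\<close> on which \<open>g_{-1}\<close> acts by zero.\<close>

definition inflate :: "nat \<Rightarrow> 'v smod \<Rightarrow> 'v smod" where
  "inflate n V = V\<lparr>act := (\<lambda>x. act V (hom_comp n 0 x))\<rparr>"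

definition is_L :: "nat \<Rightarrow> 'v smod \<Rightarrow> 'w smod \<Rightarrow> bool" where
  "is_L n V L \<longleftrightarrow> simple_supermodule n (periplectic n) L \<and>
     (\<exists>\<phi>\<in>smod_hom (periplectic n) (Ind n (periplectic n) (periplectic_nonpos n) (inflate n V)) L.
        \<phi> ` carrier (Ind n (periplectic n) (periplectic_nonpos n) (inflate n V)) = carrier L)"


section \<open>Weight diagrams\<close>

text \<open>List indices start at \<open>0\<close>, so the shift is \<open>n - 1 - i\<close>.\<close>

definition diagram :: "int list \<Rightarrow> int set" where
  "diagram lam = {lam ! i + int (length lam) - 1 - int i | i. i < length lam}"

definition weight_of_diagram :: "nat \<Rightarrow> int set \<Rightarrow> int list" where
  "weight_of_diagram n S = (THE lam. lam \<in> dominant_weights n \<and> diagram lam = S)"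

text \<open>The position of the \<open>a\<close>-th black ball, counted from right to left and starting with \<open>1\<close>.\<close>

definition ball_pos :: "int set \<Rightarrow> nat \<Rightarrow> int" where
  "ball_pos S a = rev (sorted_list_of_set S) ! (a - 1)"

definition move :: "nat \<Rightarrow> nat \<Rightarrow> nat \<Rightarrow> int list \<Rightarrow> int list" where
  "move n a b \<nu> =
    (let S = diagram \<nu>; x = ball_pos S a; y = ball_pos S b in
     if x + 1 \<notin> S \<and> y + 1 \<notin> S
     then weight_of_diagram n ((S - {x, y}) \<union> {x + 1, y + 1}) else \<nu>)"

definition weight_dagger :: "nat \<Rightarrow> int list \<Rightarrow> int list" where
  "weight_dagger n lam =
    fold (\<lambda>(a, b). move n a b) [(a, b). a \<leftarrow> [1..<n + 1], b \<leftarrow> [a + 1..<n + 1]] lam"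

definition weight_sharp :: "nat \<Rightarrow> int list \<Rightarrow> int list" where
  "weight_sharp n lam = weight_of_diagram n ((\<lambda>x. int n - 1 - x) ` diagram (weight_dagger n lam))"

end

theory Submission
  imports Defs
begin

text \<open>
  A functional \<open>x\<close> on the Cartan subalgebra which vanishes on no root determines a Borel subalgebra \<open>b_x\<close>.
  A simple supermodule \<open>L\<close> is determined by the weight and the parity of a vector which is extremal
  for \<open>b_x\<close>. Passing from \<open>x\<close> to an adjacent chamber replaces the extremal vector \<open>v\<close> of weight \<open>\<nu>\<close>:
  for the root \<open>\<epsilon>_a + \<epsilon>_b\<close> with \<open>a < b\<close> it becomes \<open>B_{ab} v\<close> if \<open>\<nu>_a \<noteq> \<nu>_b\<close> and stays \<open>v\<close> otherwise; for \<open>2 \<epsilon>_a\<close>,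
  whose negative is not a root, it stays \<open>v\<close>; for \<open>\<epsilon>_b - \<epsilon>_a\<close> the entries \<open>\<nu>_a\<close> and \<open>\<nu>_b\<close> are exchanged.
  A lexicographic path of odd reflections leads from \<open>b_0 \<oplus> g_{-1}\<close> to \<open>b_0 \<oplus> g_1\<close> and turns \<open>\<lambda>\<close> into \<open>\<lambda>\<^sup>\<dagger>\<close>; even
  reflections then lead to the opposite of the Borel subalgebra \<open>b_0 \<oplus> g_{-1}\<close> and reverse \<open>\<lambda>\<^sup>\<dagger>\<close>.
  Having extremal vectors for two opposite Borel subalgebras, \<open>L\<close> is finite-dimensional, so that \<open>L\<^sup>*\<close> is simple,
  and the coefficient functional of the last extremal vector is extremal in \<open>L\<^sup>*\<close> for \<open>b_0 \<oplus> g_{-1}\<close>. Its weight is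
  \<open>\<lambda>\<^sup>\<sharp>\<close>, and its parity is the number of odd reflections which moved the extremal vector.
\<close>

text \<open>\<open>L\<close> is given only as a simple quotient of a model of the induced module, so
  neither finite dimension nor a weight decomposition is at hand; both are drawn from single
  extremal vectors. In place of weight spaces there is one operator, the torus element H given by x,
  and the subspaces of vectors killed by products of factors H - c with c < k. An extremal vector
  has the largest eigenvalue of H, and a vector meeting the extremal conditions at a smaller
  eigenvalue must be zero; this comparison decides where each reflection string ends. Finite
  dimension matters for duality, since the full dual of an infinite-dimensional module need not be
  simple; it holds because H is bounded above from one Borel subalgebra and below from the opposite
  one. Diagram moves and weight changes agree only as long as the weights on the path stay dominant,
  which a bound on the gap in front of the moving ball guarantees. Each odd reflection that moves
  the vector raises |\<nu>| by 2 and flips the parity, while the dual weight has the negated sum, so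
  m is minus the number of such reflections.\<close>

lemma bit_add_eq_0_iff: "p + q = 0 \<longleftrightarrow> p = (q::bit)"
  by (cases p; cases q) auto

lemma bit_add_self: "p + p = (0::bit)"
  by (simp add: bit_add_eq_0_iff)

lemma bit_add_one_twice: "q + 1 + 1 = (q::bit)"
  by (cases q) auto

lemma bit_exhaust: "p = 0 \<or> p = (1::bit)"
  by (metis bit_not_one_iff)

section \<open>Entries of block matrices and closure of p(n) under the superbracket\<close>

lemma sum_lessThan_add:
  fixes f :: "nat \<Rightarrow> 'a::comm_monoid_add"
  shows "(\<Sum>k<n + m. f k) = (\<Sum>k<n. f k) + (\<Sum>k<m. f (n + k))"
  by (induction m) (auto simp: add.assoc)

text \<open>Splitting the inner index at n matches the block structure, so that the symmetries of
  the blocks apply to each half separately.\<close>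

lemma mat_mult_entry:
  fixes x y :: "'a::semiring_0 mat"
  assumes "x \<in> carrier_mat (n + n) (n + n)" "y \<in> carrier_mat (n + n) (n + n)" "i < n + n" "j < n + n"
  shows "(x * y) $$ (i, j) = (\<Sum>k<n. x $$ (i, k) * y $$ (k, j)) + (\<Sum>k<n. x $$ (i, n + k) * y $$ (n + k, j))"
  using assms by (simp add: scalar_prod_def atLeast0LessThan sum_lessThan_add)

text \<open>Working with entries instead of the blocks A, B, C lets membership be checked by index
  symmetries alone.\<close>

lemma periplectic_iff:
  "x \<in> periplectic n \<longleftrightarrow> x \<in> carrier_mat (n + n) (n + n) \<and>
    (\<forall>i<n. \<forall>j<n. x $$ (n + i, n + j) = - x $$ (j, i) \<and> x $$ (i, n + j) = x $$ (j, n + i) \<and>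
      x $$ (n + i, j) = - x $$ (n + j, i))" (is "_ \<longleftrightarrow> ?R")
proof
  assume "x \<in> periplectic n"
  then obtain A B C where x: "x = four_block_mat A B C (- transpose_mat A)"
    and c: "A \<in> carrier_mat n n" "B \<in> carrier_mat n n" "C \<in> carrier_mat n n"
    and t: "transpose_mat B = B" "transpose_mat C = - C"
    unfolding periplectic_def by blast
  have "B $$ (i, j) = B $$ (j, i)" "C $$ (i, j) = - C $$ (j, i)" if "i < n" "j < n" for i j
  proof -
    have "transpose_mat B $$ (j, i) = B $$ (i, j)" "transpose_mat C $$ (j, i) = C $$ (i, j)"
      using that c by auto
    then show "B $$ (i, j) = B $$ (j, i)" "C $$ (i, j) = - C $$ (j, i)"
      unfolding t using that c by auto
  qed
  note sym = this
  have "x $$ (n + i, n + j) = - x $$ (j, i)" "x $$ (i, n + j) = B $$ (i, j)" "x $$ (n + i, j) = C $$ (i, j)"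
    if "i < n" "j < n" for i j
    using that c unfolding x by auto
  note e = this
  have "x \<in> carrier_mat (n + n) (n + n)"
    using x c by auto
  moreover have "x $$ (i, n + j) = x $$ (j, n + i)" "x $$ (n + i, j) = - x $$ (n + j, i)"
    if "i < n" "j < n" for i j
    unfolding e(2)[OF that] e(2)[OF that(2,1)] e(3)[OF that] e(3)[OF that(2,1)]
    by (rule sym[OF that])+
  ultimately show ?R using e(1) by blast
next
  assume R: ?R
  then have c: "x \<in> carrier_mat (n + n) (n + n)"
    and R1: "i < n \<Longrightarrow> j < n \<Longrightarrow> x $$ (n + i, n + j) = - x $$ (j, i)"
    and R2: "i < n \<Longrightarrow> j < n \<Longrightarrow> x $$ (i, n + j) = x $$ (j, n + i)"
    and R3: "i < n \<Longrightarrow> j < n \<Longrightarrow> x $$ (n + i, j) = - x $$ (n + j, i)" for i j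
    by blast+
  define A where "A = mat n n (\<lambda>(i, j). x $$ (i, j))"
  define B where "B = mat n n (\<lambda>(i, j). x $$ (i, n + j))"
  define C where "C = mat n n (\<lambda>(i, j). x $$ (n + i, j))"
  have "x = four_block_mat A B C (- transpose_mat A)"
  proof (rule eq_matI)
    fix i j assume ij: "i < dim_row (four_block_mat A B C (- transpose_mat A))"
      "j < dim_col (four_block_mat A B C (- transpose_mat A))"
    have "x $$ (i, j) = - x $$ (j - n, i - n)" if "\<not> i < n" "\<not> j < n"
      using that ij R1[of "i - n" "j - n"] by (simp add: A_def)
    with ij show "x $$ (i, j) = four_block_mat A B C (- transpose_mat A) $$ (i, j)"
      by (auto simp: A_def B_def C_def)
  qed (use c in \<open>simp_all add: A_def\<close>)
  moreover have "transpose_mat B = B"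
    by (rule eq_matI) (simp_all add: B_def R2)
  moreover have "transpose_mat C = - C"
    by (rule eq_matI) (simp_all add: C_def, rule R3)
  moreover have "A \<in> carrier_mat n n" "B \<in> carrier_mat n n" "C \<in> carrier_mat n n"
    by (simp_all add: A_def B_def C_def)
  ultimately show "x \<in> periplectic n"
    unfolding periplectic_def by blast
qed

lemma hom_comp_eq:
  assumes "x \<in> carrier_mat (n + n) (n + n)"
  shows "hom_comp n p x =
    mat (n + n) (n + n) (\<lambda>(i, j). if (p = 0) = ((i < n) = (j < n)) then x $$ (i, j) else 0)"
  using assms by (auto simp: hom_comp_def split_block_def Let_def intro!: eq_matI)

lemma hom_part_iff:
  assumes "g \<subseteq> carrier_mat (n + n) (n + n)"
  shows "x \<in> hom_part n g p \<longleftrightarrow>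
    x \<in> g \<and> (\<forall>i<n + n. \<forall>j<n + n. (p = 0) \<noteq> ((i < n) = (j < n)) \<longrightarrow> x $$ (i, j) = 0)"
proof (cases "x \<in> g")
  case True
  then have c: "x \<in> carrier_mat (n + n) (n + n)" using assms by auto
  show ?thesis
    unfolding hom_part_def mem_Collect_eq hom_comp_eq[OF c]
    using True c unfolding mat_eq_iff by (auto split: if_splits)
qed (auto simp: hom_part_def)

lemma periplectic_carrier: "periplectic n \<subseteq> carrier_mat (n + n) (n + n)"
  by (auto simp: periplectic_iff)

lemmas hom_part_periplectic_iff = hom_part_iff[OF periplectic_carrier]

lemma hom_part_periplecticD:
  assumes "x \<in> hom_part n (periplectic n) p" "i < n" "j < n"
  shows "x $$ (n + i, n + j) = - x $$ (j, i)" "x $$ (i, n + j) = x $$ (j, n + i)"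
    "x $$ (n + i, j) = - x $$ (n + j, i)"
    "p \<noteq> 0 \<Longrightarrow> x $$ (i, j) = 0" "p = 0 \<Longrightarrow> x $$ (i, n + j) = 0" "p = 0 \<Longrightarrow> x $$ (n + i, j) = 0"
proof -
  have x: "x \<in> periplectic n"
    and z: "\<And>i j. i < n + n \<Longrightarrow> j < n + n \<Longrightarrow> (p = 0) \<noteq> ((i < n) = (j < n)) \<Longrightarrow> x $$ (i, j) = 0"
    using assms(1) unfolding hom_part_periplectic_iff by blast+
  show "x $$ (n + i, n + j) = - x $$ (j, i)" "x $$ (i, n + j) = x $$ (j, n + i)"
    "x $$ (n + i, j) = - x $$ (n + j, i)"
    using x assms(2,3) unfolding periplectic_iff by blast+
  show "p \<noteq> 0 \<Longrightarrow> x $$ (i, j) = 0" "p = 0 \<Longrightarrow> x $$ (i, n + j) = 0" "p = 0 \<Longrightarrow> x $$ (n + i, j) = 0"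
    using assms(2,3) by (simp_all add: z)
qed

lemma hom_part_carrier: "x \<in> hom_part n (periplectic n) p \<Longrightarrow> x \<in> carrier_mat (n + n) (n + n)"
  by (auto simp: hom_part_periplectic_iff periplectic_iff)

text \<open>The lower right block of an odd matrix vanishes because it is minus the transpose of the
  upper left one.\<close>

lemma hom_partI:
  assumes "x \<in> carrier_mat (n + n) (n + n)"
    and "\<And>i j. i < n \<Longrightarrow> j < n \<Longrightarrow> x $$ (n + i, n + j) = - x $$ (j, i)"
    and "\<And>i j. i < n \<Longrightarrow> j < n \<Longrightarrow> x $$ (i, n + j) = x $$ (j, n + i)"
    and "\<And>i j. i < n \<Longrightarrow> j < n \<Longrightarrow> x $$ (n + i, j) = - x $$ (n + j, i)"
    and "\<And>i j. i < n \<Longrightarrow> j < n \<Longrightarrow> p \<noteq> 0 \<Longrightarrow> x $$ (i, j) = 0"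
    and "\<And>i j. i < n \<Longrightarrow> j < n \<Longrightarrow> p = 0 \<Longrightarrow> x $$ (i, n + j) = 0 \<and> x $$ (n + i, j) = 0"
  shows "x \<in> hom_part n (periplectic n) p"
  unfolding hom_part_periplectic_iff periplectic_iff
proof (intro conjI allI impI)
  fix i j assume ij: "i < n + n" "j < n + n" and p: "(p = 0) \<noteq> ((i < n) = (j < n))"
  show "x $$ (i, j) = 0"
  proof (cases "i < n")
    case True
    then show ?thesis using assms(5)[of i j] assms(6)[of i "j - n"] ij p by (cases "j < n") auto
  next
    case False
    then show ?thesis using assms(2)[of "i - n" "j - n"] assms(5)[of "j - n" "i - n"] assms(6)[of "i - n" j] ij p
      by (cases "j < n") auto
  qed
qed (use assms(1) in blast, (rule assms; assumption)+)

lemma superbracket_carrier: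
  assumes "x \<in> carrier_mat (n + n) (n + n)" "y \<in> carrier_mat (n + n) (n + n)"
  shows "superbracket p q x y \<in> carrier_mat (n + n) (n + n)"
  using assms by (auto simp: superbracket_def)

lemma superbracket_entry:
  assumes "x \<in> carrier_mat (n + n) (n + n)" "y \<in> carrier_mat (n + n) (n + n)" "i < n + n" "j < n + n"
  shows "superbracket p q x y $$ (i, j) =
    (\<Sum>k<n. x $$ (i, k) * y $$ (k, j)) + (\<Sum>k<n. x $$ (i, n + k) * y $$ (n + k, j))
    - koszul_sign p q * ((\<Sum>k<n. y $$ (i, k) * x $$ (k, j)) + (\<Sum>k<n. y $$ (i, n + k) * x $$ (n + k, j)))"
proof -
  have "superbracket p q x y $$ (i, j) = (x * y) $$ (i, j) - koszul_sign p q * (y * x) $$ (i, j)"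
    using assms by (auto simp: superbracket_def)
  then show ?thesis
    by (simp only: mat_mult_entry[OF assms] mat_mult_entry[OF assms(2,1,3,4)])
qed

text \<open>Transposing a product of blocks reverses it, and the signs in B^t = B and C^t = -C turn
  the reversed product into the second term of the supercommutator. The parities decide which blocks
  survive, hence four cases for each block identity.\<close>

lemma superbracket_hom_part:
  assumes x: "x \<in> hom_part n (periplectic n) p" and y: "y \<in> hom_part n (periplectic n) q"
  shows "superbracket p q x y \<in> hom_part n (periplectic n) (p + q)"
proof -
  note c = hom_part_carrier[OF x] hom_part_carrier[OF y]
  note X = hom_part_periplecticD[OF x] and Y = hom_part_periplecticD[OF y]
  show ?thesis
  proof (rule hom_partI)
    show "superbracket p q x y \<in> carrier_mat (n + n) (n + n)"
      by (rule superbracket_carrier[OF c])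
  next
    fix i j assume ij: "i < n" "j < n"
    have e: "superbracket p' q' x y $$ (i', j') =
    (\<Sum>k<n. x $$ (i', k) * y $$ (k, j')) + (\<Sum>k<n. x $$ (i', n + k) * y $$ (n + k, j'))
    - koszul_sign p' q' * ((\<Sum>k<n. y $$ (i', k) * x $$ (k, j')) + (\<Sum>k<n. y $$ (i', n + k) * x $$ (n + k, j')))"
      if "i' \<in> {i, j, n + i, n + j}" "j' \<in> {i, j, n + i, n + j}" for i' j' p' q'
      using superbracket_entry[OF c] that ij by auto
    have X1: "x $$ (n + k, n + l) = - x $$ (l, k)" "y $$ (n + k, n + l) = - y $$ (l, k)" if "k < n" "l < n" for k l
      using X(1) Y(1) that by auto
    have X4: "x $$ (k, l) = 0" if "k < n" "l < n" "p = 1" for k l using X(4) that by auto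
    have Y4: "y $$ (k, l) = 0" if "k < n" "l < n" "q = 1" for k l using Y(4) that by auto
    have X5: "x $$ (k, n + l) = 0" "x $$ (n + k, l) = 0" if "k < n" "l < n" "p = 0" for k l
      using X(5,6) that by auto
    have Y5: "y $$ (k, n + l) = 0" "y $$ (n + k, l) = 0" if "k < n" "l < n" "q = 0" for k l
      using Y(5,6) that by auto
    consider "p = 0" "q = 0" | "p = 0" "q = 1" | "p = 1" "q = 0" | "p = 1" "q = 1"
      using bit_exhaust by blast
    note cs = this
    show "superbracket p q x y $$ (n + i, n + j) = - superbracket p q x y $$ (j, i)"
      using cs
    proof cases
      case 4
      \<comment> \<open>In block terms: the transpose of C B' is -B' C, since B' is symmetric and C
        is skew.\<close>
      have "(\<Sum>k<n. x $$ (n + i, k) * y $$ (k, n + j)) = - (\<Sum>k<n. y $$ (j, n + k) * x $$ (n + k, i))"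
        "(\<Sum>k<n. y $$ (n + i, k) * x $$ (k, n + j)) = - (\<Sum>k<n. x $$ (j, n + k) * y $$ (n + k, i))"
        unfolding sum_negf[symmetric] using ij X(2)[of j] X(3)[of i] Y(2)[of j] Y(3)[of i]
        by (auto intro!: sum.cong simp: mult.commute)
      then show ?thesis using 4 ij by (simp add: e X1 X4 Y4 koszul_sign_def)
    qed (use ij in \<open>simp_all add: e X1 X4 Y4 X5 Y5 koszul_sign_def sum_negf mult.commute\<close>)
    show "superbracket p q x y $$ (i, n + j) = superbracket p q x y $$ (j, n + i)"
      using cs
    proof cases
      case 2
      have "(\<Sum>k<n. y $$ (l, n + k) * x $$ (n + k, n + m)) = - (\<Sum>k<n. x $$ (m, k) * y $$ (k, n + l))"
        if "l < n" "m < n" for l m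
        unfolding sum_negf[symmetric] using that X(1) Y(2) by (auto intro!: sum.cong simp: mult.commute)
      with 2 show ?thesis using ij by (simp add: e X4 Y4 X5 Y5 koszul_sign_def)
    next
      case 3
      have "(\<Sum>k<n. x $$ (l, n + k) * y $$ (n + k, n + m)) = - (\<Sum>k<n. y $$ (m, k) * x $$ (k, n + l))"
        if "l < n" "m < n" for l m
        unfolding sum_negf[symmetric] using that Y(1) X(2) by (auto intro!: sum.cong simp: mult.commute)
      with 3 show ?thesis using ij by (simp add: e X4 Y4 X5 Y5 koszul_sign_def)
    qed (use ij in \<open>simp_all add: e X1 X4 Y4 X5 Y5 koszul_sign_def\<close>)
    show "superbracket p q x y $$ (n + i, j) = - superbracket p q x y $$ (n + j, i)"
      using cs
    proof cases
      case 2
      have "(\<Sum>k<n. x $$ (n + l, n + k) * y $$ (n + k, m)) = (\<Sum>k<n. y $$ (n + m, k) * x $$ (k, l))"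
        if "l < n" "m < n" for l m
        using that X(1) Y(3)[of m] by (auto intro!: sum.cong simp: mult.commute)
      with 2 show ?thesis using ij by (simp add: e X4 Y4 X5 Y5 koszul_sign_def)
    next
      case 3
      have "(\<Sum>k<n. y $$ (n + l, n + k) * x $$ (n + k, m)) = (\<Sum>k<n. x $$ (n + m, k) * y $$ (k, l))"
        if "l < n" "m < n" for l m
        using that Y(1) X(3)[of m] by (auto intro!: sum.cong simp: mult.commute)
      with 3 show ?thesis using ij by (simp add: e X4 Y4 X5 Y5 koszul_sign_def)
    qed (use ij in \<open>simp_all add: e X1 X4 Y4 X5 Y5 koszul_sign_def\<close>)
    show "superbracket p q x y $$ (i, j) = 0" if "p + q \<noteq> 0"
      using cs ij that[unfolded bit_add_eq_0_iff] by cases (simp_all add: e X1 X4 Y4 X5 Y5)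
    show "superbracket p q x y $$ (i, n + j) = 0 \<and> superbracket p q x y $$ (n + i, j) = 0" if "p + q = 0"
      using cs ij that[unfolded bit_add_eq_0_iff] by cases (simp_all add: e X1 X4 Y4 X5 Y5)
  qed
qed


lemma periplecticD:
  assumes "x \<in> periplectic n" "i < n" "j < n"
  shows "x $$ (n + i, n + j) = - x $$ (j, i)" "x $$ (i, n + j) = x $$ (j, n + i)"
    "x $$ (n + i, j) = - x $$ (n + j, i)"
  using assms unfolding periplectic_iff by blast+

lemma periplectic_add:
  assumes "x \<in> periplectic n" "y \<in> periplectic n"
  shows "x + y \<in> periplectic n"
proof -
  have c: "x \<in> carrier_mat (n + n) (n + n)" "y \<in> carrier_mat (n + n) (n + n)"
    using assms periplectic_carrier by blast+
  have e: "(x + y) $$ (r, s) = x $$ (r, s) + y $$ (r, s)" if "r < n + n" "s < n + n" for r s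
    using that c by simp
  note D = periplecticD[OF assms(1)] periplecticD[OF assms(2)]
  have "(x + y) $$ (n + i, n + j) = - (x + y) $$ (j, i)" "(x + y) $$ (i, n + j) = (x + y) $$ (j, n + i)"
    "(x + y) $$ (n + i, j) = - (x + y) $$ (n + j, i)" if "i < n" "j < n" for i j
    using that D[of i j] by (simp_all add: e)
  moreover have "x + y \<in> carrier_mat (n + n) (n + n)" using c by simp
  ultimately show ?thesis
    unfolding periplectic_iff by blast
qed

lemma periplectic_smult:
  assumes "x \<in> periplectic n"
  shows "c \<cdot>\<^sub>m x \<in> periplectic n"
proof -
  have d: "x \<in> carrier_mat (n + n) (n + n)"
    using assms periplectic_carrier by blast
  have e: "(c \<cdot>\<^sub>m x) $$ (r, s) = c * x $$ (r, s)" if "r < n + n" "s < n + n" for r s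
    using that d by simp
  have "(c \<cdot>\<^sub>m x) $$ (n + i, n + j) = - (c \<cdot>\<^sub>m x) $$ (j, i)"
    "(c \<cdot>\<^sub>m x) $$ (i, n + j) = (c \<cdot>\<^sub>m x) $$ (j, n + i)"
    "(c \<cdot>\<^sub>m x) $$ (n + i, j) = - (c \<cdot>\<^sub>m x) $$ (n + j, i)" if "i < n" "j < n" for i j
  proof -
    have ij: "i < n + n" "j < n + n" "n + i < n + n" "n + j < n + n" using that by auto
    show "(c \<cdot>\<^sub>m x) $$ (n + i, n + j) = - (c \<cdot>\<^sub>m x) $$ (j, i)"
      unfolding e[OF ij(3,4)] e[OF ij(2,1)] periplecticD(1)[OF assms that] by (rule mult_minus_right)
    show "(c \<cdot>\<^sub>m x) $$ (i, n + j) = (c \<cdot>\<^sub>m x) $$ (j, n + i)"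
      unfolding e[OF ij(1,4)] e[OF ij(2,3)] by (subst periplecticD(2)[OF assms that]) (rule refl)
    show "(c \<cdot>\<^sub>m x) $$ (n + i, j) = - (c \<cdot>\<^sub>m x) $$ (n + j, i)"
      unfolding e[OF ij(3,2)] e[OF ij(4,1)] by (subst periplecticD(3)[OF assms that]) (rule mult_minus_right)
  qed
  moreover have "c \<cdot>\<^sub>m x \<in> carrier_mat (n + n) (n + n)" using d by simp
  ultimately show ?thesis
    unfolding periplectic_iff by blast
qed

lemma hom_part_subset: "x \<in> hom_part n g p \<Longrightarrow> x \<in> g"
  by (simp add: hom_part_def)

lemma hom_part_smult:
  assumes "x \<in> hom_part n (periplectic n) p"
  shows "c \<cdot>\<^sub>m x \<in> hom_part n (periplectic n) p"
  using assms periplectic_smult[of x n c] hom_part_carrier[OF assms]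
  unfolding hom_part_periplectic_iff by auto

section \<open>Weight vectors and root vectors\<close>

text \<open>The weight of basis vector r of the natural module: \<epsilon>_r in the first half,
  -\<epsilon>_(r-n) in the second. An entry (r, s) of a matrix then has the weight of r minus that
  of s.\<close>

definition row_weight :: "nat \<Rightarrow> nat \<Rightarrow> nat \<Rightarrow> int" where
  "row_weight n r k = (if r < n then of_bool (k = r) else - of_bool (k = r - n))"

text \<open>Weights are read off from the nonzero entries instead of from eigenvalue equations. The
  zero matrix thereby has every weight and either parity, which explains the side conditions
  \<open>z \<noteq> 0\<^sub>m (n + n) (n + n)\<close> below.\<close>

definition weight_vector :: "nat \<Rightarrow> bit \<Rightarrow> (nat \<Rightarrow> int) \<Rightarrow> complex mat \<Rightarrow> bool" where
  "weight_vector n p w x \<longleftrightarrow> x \<in> hom_part n (periplectic n) p \<and>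
     (\<forall>r<n + n. \<forall>s<n + n. x $$ (r, s) \<noteq> 0 \<longrightarrow> (\<forall>k. w k = row_weight n r k - row_weight n s k))"

definition E_mat :: "nat \<Rightarrow> nat \<Rightarrow> nat \<Rightarrow> complex mat" where
  "E_mat n i j = mat (n + n) (n + n) (\<lambda>(r, s). of_bool (r = i \<and> s = j) - of_bool (r = n + j \<and> s = n + i))"

text \<open>For i = j the two terms coincide and the entry is 2; in \<open>C_mat\<close> they
  cancel, in accordance with -2 \<epsilon>_i not being a root.\<close>

definition B_mat :: "nat \<Rightarrow> nat \<Rightarrow> nat \<Rightarrow> complex mat" where
  "B_mat n i j = mat (n + n) (n + n) (\<lambda>(r, s). of_bool (r = i \<and> s = n + j) + of_bool (r = j \<and> s = n + i))"

definition C_mat :: "nat \<Rightarrow> nat \<Rightarrow> nat \<Rightarrow> complex mat" where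
  "C_mat n i j = mat (n + n) (n + n) (\<lambda>(r, s). of_bool (r = n + i \<and> s = j) - of_bool (r = n + j \<and> s = i))"

definition torus_mat :: "nat \<Rightarrow> (nat \<Rightarrow> complex) \<Rightarrow> complex mat" where
  "torus_mat n d = mat (n + n) (n + n) (\<lambda>(r, s). if r = s then (if r < n then d r else - d (r - n)) else 0)"

lemma weight_vector_hom_part: "weight_vector n p w x \<Longrightarrow> x \<in> hom_part n (periplectic n) p"
  by (simp add: weight_vector_def)

lemma weight_vector_periplectic: "weight_vector n p w x \<Longrightarrow> x \<in> periplectic n"
  by (simp add: weight_vector_def hom_part_def)

lemma weight_vector_carrier: "weight_vector n p w x \<Longrightarrow> x \<in> carrier_mat (n + n) (n + n)"
  using weight_vector_hom_part hom_part_carrier by blast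

lemma weight_vector_smult: "weight_vector n p w x \<Longrightarrow> weight_vector n p w (c \<cdot>\<^sub>m x)"
  using weight_vector_carrier[of n p w x] hom_part_smult[of x n p c]
  unfolding weight_vector_def by auto

text \<open>A nonzero entry (r, s) of a product needs an index l with nonzero factors at (r, l) and
  (l, s), and the differences of row weights telescope.\<close>

lemma weight_vector_superbracket:
  assumes x: "weight_vector n p w x" and y: "weight_vector n q w' y"
  shows "weight_vector n (p + q) (\<lambda>k. w k + w' k) (superbracket p q x y)"
  unfolding weight_vector_def
proof (intro conjI allI impI)
  show "superbracket p q x y \<in> hom_part n (periplectic n) (p + q)"
    using superbracket_hom_part x y weight_vector_hom_part by blast
  note c = weight_vector_carrier[OF x] weight_vector_carrier[OF y]
  fix r s k assume rs: "r < n + n" "s < n + n" and nz: "superbracket p q x y $$ (r, s) \<noteq> 0"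
  have prod: "(a * b) $$ (r, s) = (\<Sum>l<n + n. a $$ (r, l) * b $$ (l, s))"
    if "a \<in> carrier_mat (n + n) (n + n)" "b \<in> carrier_mat (n + n) (n + n)" for a b :: "complex mat"
    using that rs by (simp add: scalar_prod_def atLeast0LessThan)
  have "superbracket p q x y $$ (r, s) = (x * y) $$ (r, s) - koszul_sign p q * (y * x) $$ (r, s)"
    using c rs by (auto simp: superbracket_def)
  with nz have "(x * y) $$ (r, s) \<noteq> 0 \<or> (y * x) $$ (r, s) \<noteq> 0"
    by auto
  then obtain l where l: "l < n + n" "x $$ (r, l) * y $$ (l, s) \<noteq> 0 \<or> y $$ (r, l) * x $$ (l, s) \<noteq> 0"
    unfolding prod[OF c] prod[OF c(2,1)] by (metis (no_types, lifting) lessThan_iff sum.neutral)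
  have X: "w k = row_weight n r' k - row_weight n s' k" if "x $$ (r', s') \<noteq> 0" "r' < n + n" "s' < n + n" for r' s'
    using x that unfolding weight_vector_def by blast
  have Y: "w' k = row_weight n r' k - row_weight n s' k" if "y $$ (r', s') \<noteq> 0" "r' < n + n" "s' < n + n" for r' s'
    using y that unfolding weight_vector_def by blast
  show "w k + w' k = row_weight n r k - row_weight n s k"
    using l X[of r l] X[of l s] Y[of r l] Y[of l s] rs by auto
qed

lemma weight_vector_E_mat:
  assumes "i < n" "j < n"
  shows "weight_vector n 0 (\<lambda>k. of_bool (k = i) - of_bool (k = j)) (E_mat n i j)"
  unfolding weight_vector_def
proof (intro conjI allI impI)
  show "E_mat n i j \<in> hom_part n (periplectic n) 0"
    by (rule hom_partI) (use assms in \<open>auto simp: E_mat_def\<close>)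
next
  fix r s k assume "r < n + n" "s < n + n" "E_mat n i j $$ (r, s) \<noteq> 0"
  then have "r = i \<and> s = j \<or> r = n + j \<and> s = n + i"
    by (auto simp: E_mat_def)
  then show "of_bool (k = i) - of_bool (k = j) = row_weight n r k - row_weight n s k"
    using assms by (elim disjE conjE) (simp_all add: row_weight_def)
qed

lemma weight_vector_B_mat:
  assumes "i < n" "j < n"
  shows "weight_vector n 1 (\<lambda>k. of_bool (k = i) + of_bool (k = j)) (B_mat n i j)"
  unfolding weight_vector_def
proof (intro conjI allI impI)
  show "B_mat n i j \<in> hom_part n (periplectic n) 1"
    by (rule hom_partI) (use assms in \<open>simp_all add: B_mat_def conj_commute add.commute\<close>)
next
  fix r s k assume "r < n + n" "s < n + n" "B_mat n i j $$ (r, s) \<noteq> 0"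
  then have "r = i \<and> s = n + j \<or> r = j \<and> s = n + i"
    by (auto simp: B_mat_def)
  then show "of_bool (k = i) + of_bool (k = j) = row_weight n r k - row_weight n s k"
    using assms by (elim disjE conjE) (simp_all add: row_weight_def)
qed

lemma weight_vector_C_mat:
  assumes "i < n" "j < n"
  shows "weight_vector n 1 (\<lambda>k. - of_bool (k = i) - of_bool (k = j)) (C_mat n i j)"
  unfolding weight_vector_def
proof (intro conjI allI impI)
  show "C_mat n i j \<in> hom_part n (periplectic n) 1"
    by (rule hom_partI) (use assms in \<open>simp_all add: C_mat_def conj_commute add.commute\<close>)
next
  fix r s k assume "r < n + n" "s < n + n" "C_mat n i j $$ (r, s) \<noteq> 0"
  then have "r = n + i \<and> s = j \<or> r = n + j \<and> s = i"
    by (auto simp: C_mat_def)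
  then show "- of_bool (k = i) - of_bool (k = j) = row_weight n r k - row_weight n s k"
    using assms by (elim disjE conjE) (simp_all add: row_weight_def)
qed

lemma weight_vector_torus_mat: "weight_vector n 0 (\<lambda>_. 0) (torus_mat n d)"
proof -
  have "torus_mat n d \<in> hom_part n (periplectic n) 0"
    by (rule hom_partI) (auto simp: torus_mat_def)
  then show ?thesis
    by (auto simp: weight_vector_def torus_mat_def)
qed

section \<open>The roots of p(n) and their root spaces\<close>

lemma row_weight_upper: "r < n \<Longrightarrow> row_weight n r k = of_bool (k = r)"
  and row_weight_lower: "row_weight n (n + r) k = - of_bool (k = r)"
  by (simp_all add: row_weight_def)

lemma row_cases:
  fixes r n :: nat
  assumes "r < n + n"
  obtains "r < n" | r' where "r' < n" "r = n + r'"
proof (cases "r < n")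
  case False
  then show ?thesis using assms that(2)[of "r - n"] by simp
qed (rule that(1))

text \<open>The 2n rows have pairwise different weights, so a matrix of weight zero is
  diagonal.\<close>

lemma row_weight_inject:
  assumes "r < n + n" "s < n + n" "\<forall>k. row_weight n r k = row_weight n s k"
  shows "r = s"
  using assms(1)
proof (cases rule: row_cases)
  case 1
  then show ?thesis
    by (cases rule: row_cases[OF assms(2)]) (use assms(3)[rule_format, of r] in \<open>simp_all add: row_weight_upper row_weight_lower of_bool_def split: if_splits\<close>)
next
  case (2 r')
  then show ?thesis
    by (cases rule: row_cases[OF assms(2)]) (use assms(3)[rule_format, of r'] in \<open>simp_all add: row_weight_upper row_weight_lower of_bool_def split: if_splits\<close>)
qed

text \<open>Evaluation at k = i and k = j already fixes both rows. The two solutions are the entries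
  tied together by the periplectic symmetry, so the root space is a line.\<close>

lemma row_weight_eq_E:
  assumes "i \<noteq> j" "i < n" "j < n" "r < n + n" "s < n + n"
    "\<forall>k. of_bool (k = i) - of_bool (k = j) = row_weight n r k - row_weight n s k"
  shows "r = i \<and> s = j \<or> r = n + j \<and> s = n + i"
proof -
  note k = assms(6)[rule_format, of i] assms(6)[rule_format, of j]
  show ?thesis
    using assms(4) assms(5)
    by (cases rule: row_cases; cases rule: row_cases[OF assms(5)])
      (use k assms(1-3) in \<open>simp_all add: row_weight_upper row_weight_lower of_bool_def split: if_splits\<close>)
qed

lemma row_weight_eq_B:
  assumes "i < n" "j < n" "r < n + n" "s < n + n"
    "\<forall>k. of_bool (k = i) + of_bool (k = j) = row_weight n r k - row_weight n s k"
  shows "r = i \<and> s = n + j \<or> r = j \<and> s = n + i"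
proof -
  note k = assms(5)[rule_format, of i] assms(5)[rule_format, of j]
  show ?thesis
    using assms(3) assms(4)
    by (cases rule: row_cases; cases rule: row_cases[OF assms(4)])
      (use k assms(1,2) in \<open>simp_all add: row_weight_upper row_weight_lower of_bool_def split: if_splits\<close>)
qed

lemma row_weight_eq_C:
  assumes "i < n" "j < n" "r < n + n" "s < n + n"
    "\<forall>k. - of_bool (k = i) - of_bool (k = j) = row_weight n r k - row_weight n s k"
  shows "r = n + i \<and> s = j \<or> r = n + j \<and> s = i"
proof -
  note k = assms(5)[rule_format, of i] assms(5)[rule_format, of j]
  show ?thesis
    using assms(3) assms(4)
    by (cases rule: row_cases; cases rule: row_cases[OF assms(4)])
      (use k assms(1,2) in \<open>simp_all add: row_weight_upper row_weight_lower of_bool_def split: if_splits\<close>)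
qed

lemma weight_vector_zero_offdiag:
  assumes "weight_vector n p (\<lambda>_. 0) z" "r < n + n" "s < n + n" "r \<noteq> s"
  shows "z $$ (r, s) = 0"
  using assms row_weight_inject[of r n s] unfolding weight_vector_def by fastforce

lemma weight_vector_E_eq:
  assumes "i \<noteq> j" "i < n" "j < n" "weight_vector n p (\<lambda>k. of_bool (k = i) - of_bool (k = j)) z"
  shows "z = z $$ (i, j) \<cdot>\<^sub>m E_mat n i j"
proof (rule eq_matI)
  fix r s assume rs: "r < dim_row (z $$ (i, j) \<cdot>\<^sub>m E_mat n i j)" "s < dim_col (z $$ (i, j) \<cdot>\<^sub>m E_mat n i j)"
  then have rs': "r < n + n" "s < n + n" by (auto simp: E_mat_def)
  have "z $$ (r, s) = 0" if "\<not> (r = i \<and> s = j \<or> r = n + j \<and> s = n + i)"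
    using row_weight_eq_E[OF assms(1-3) rs'] assms(4) that rs' unfolding weight_vector_def by blast
  moreover have "z $$ (n + j, n + i) = - z $$ (i, j)"
    using hom_part_periplecticD(1)[OF weight_vector_hom_part[OF assms(4)] assms(3,2)] .
  ultimately show "z $$ (r, s) = (z $$ (i, j) \<cdot>\<^sub>m E_mat n i j) $$ (r, s)"
    using rs' assms(1-3) by (auto simp: E_mat_def)
qed (use weight_vector_carrier[OF assms(4)] in \<open>auto simp: E_mat_def\<close>)

lemma weight_vector_B_eq:
  assumes "i < n" "j < n" "weight_vector n p (\<lambda>k. of_bool (k = i) + of_bool (k = j)) z"
  shows "\<exists>c. z = c \<cdot>\<^sub>m B_mat n i j"
proof -
  \<comment> \<open>For i = j the matrix \<open>B_mat n i i\<close> has entry 2 and the coefficient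
    must be halved.\<close>
  define c where "c = (if i = j then z $$ (i, n + j) / 2 else z $$ (i, n + j))"
  have "z = c \<cdot>\<^sub>m B_mat n i j"
  proof (rule eq_matI)
    fix r s assume rs: "r < dim_row (c \<cdot>\<^sub>m B_mat n i j)" "s < dim_col (c \<cdot>\<^sub>m B_mat n i j)"
    then have rs': "r < n + n" "s < n + n" by (auto simp: B_mat_def)
    have "z $$ (r, s) = 0" if "\<not> (r = i \<and> s = n + j \<or> r = j \<and> s = n + i)"
      using row_weight_eq_B[OF assms(1,2) rs'] assms(3) that rs' unfolding weight_vector_def by blast
    moreover have "z $$ (j, n + i) = z $$ (i, n + j)"
      using hom_part_periplecticD(2)[OF weight_vector_hom_part[OF assms(3)] assms(2,1)] .
    ultimately show "z $$ (r, s) = (c \<cdot>\<^sub>m B_mat n i j) $$ (r, s)"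
      using rs' assms(1,2) by (auto simp: B_mat_def c_def)
  qed (use weight_vector_carrier[OF assms(3)] in \<open>auto simp: B_mat_def\<close>)
  then show ?thesis by blast
qed

lemma weight_vector_C_eq:
  assumes "i < n" "j < n" "weight_vector n p (\<lambda>k. - of_bool (k = i) - of_bool (k = j)) z"
  shows "z = z $$ (n + i, j) \<cdot>\<^sub>m C_mat n i j"
proof (rule eq_matI)
  fix r s assume rs: "r < dim_row (z $$ (n + i, j) \<cdot>\<^sub>m C_mat n i j)" "s < dim_col (z $$ (n + i, j) \<cdot>\<^sub>m C_mat n i j)"
  then have rs': "r < n + n" "s < n + n" by (auto simp: C_mat_def)
  have "z $$ (r, s) = 0" if "\<not> (r = n + i \<and> s = j \<or> r = n + j \<and> s = i)"
    using row_weight_eq_C[OF assms(1,2) rs'] assms(3) that rs' unfolding weight_vector_def by blast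
  moreover have "z $$ (n + j, i) = - z $$ (n + i, j)"
    using hom_part_periplecticD(3)[OF weight_vector_hom_part[OF assms(3)] assms(2,1)] .
  ultimately show "z $$ (r, s) = (z $$ (n + i, j) \<cdot>\<^sub>m C_mat n i j) $$ (r, s)"
    using rs' assms(1,2) by (cases "i = j") (auto simp: C_mat_def of_bool_def split: if_splits)
qed (use weight_vector_carrier[OF assms(3)] in \<open>auto simp: C_mat_def\<close>)

lemma weight_vector_nonzero_entry:
  assumes "weight_vector n p w z" "z \<noteq> 0\<^sub>m (n + n) (n + n)"
  obtains r s where "r < n + n" "s < n + n" "z $$ (r, s) \<noteq> 0"
    "w = (\<lambda>k. row_weight n r k - row_weight n s k)"
proof -
  have "\<exists>r<n + n. \<exists>s<n + n. z $$ (r, s) \<noteq> 0"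
  proof (rule ccontr)
    assume "\<not> ?thesis"
    then have "z = 0\<^sub>m (n + n) (n + n)"
      using weight_vector_carrier[OF assms(1)] by (intro eq_matI) auto
    with assms(2) show False ..
  qed
  then obtain r s where rs: "r < n + n" "s < n + n" "z $$ (r, s) \<noteq> 0" by blast
  with assms(1) have "\<forall>k. w k = row_weight n r k - row_weight n s k"
    unfolding weight_vector_def by blast
  with rs that show thesis by blast
qed

text \<open>The block position of a nonzero entry decides the type of the root; for the two odd
  types the indices are then ordered by the symmetry of the root vector. The last case excludes i =
  j because a skew block has zero diagonal.\<close>

lemma weight_vector_cases:
  assumes "weight_vector n p w z" "z \<noteq> 0\<^sub>m (n + n) (n + n)" "w \<noteq> (\<lambda>_. 0)"
  obtains (E) i j c where "i < n" "j < n" "i \<noteq> j" "p = 0" "z = c \<cdot>\<^sub>m E_mat n i j"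
      "w = (\<lambda>k. of_bool (k = i) - of_bool (k = j))"
    | (B) i j c where "i \<le> j" "j < n" "p = 1" "z = c \<cdot>\<^sub>m B_mat n i j"
      "w = (\<lambda>k. of_bool (k = i) + of_bool (k = j))"
    | (C) i j c where "i < j" "j < n" "p = 1" "z = c \<cdot>\<^sub>m C_mat n i j"
      "w = (\<lambda>k. - of_bool (k = i) - of_bool (k = j))"
proof -
  note h = weight_vector_hom_part[OF assms(1)]
  obtain r s where rs: "r < n + n" "s < n + n" "z $$ (r, s) \<noteq> 0"
    and w: "w = (\<lambda>k. row_weight n r k - row_weight n s k)"
    using weight_vector_nonzero_entry[OF assms(1,2)] .
  from rs have par: "(p = 0) = ((r < n) = (s < n))"
    using h unfolding hom_part_periplectic_iff by blast
  have rsne: "r \<noteq> s" using w assms(3) by auto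
  consider "r < n" "s < n" | s' where "r < n" "s' < n" "s = n + s'" | r' where "r' < n" "r = n + r'" "s < n"
    | r' s' where "r' < n" "r = n + r'" "s' < n" "s = n + s'"
    using rs(1,2) by (metis row_cases)
  then show thesis
  proof cases
    case 1
    with w have w1: "w = (\<lambda>k. of_bool (k = r) - of_bool (k = s))" by (simp add: row_weight_upper)
    show ?thesis
      using E[OF 1 rsne _ weight_vector_E_eq[OF rsne 1 assms(1)[unfolded w1]] w1] par 1 by auto
  next
    case 2
    have w1: "w = (\<lambda>k. of_bool (k = r) + of_bool (k = s'))" "w = (\<lambda>k. of_bool (k = s') + of_bool (k = r))"
      using w 2 by (auto simp: row_weight_upper row_weight_lower)
    have p: "p = 1" using par 2 by auto
    obtain c where c: "z = c \<cdot>\<^sub>m B_mat n r s'"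
      using weight_vector_B_eq[OF 2(1,2) assms(1)[unfolded w1(1)]] by blast
    obtain c' where c': "z = c' \<cdot>\<^sub>m B_mat n s' r"
      using weight_vector_B_eq[OF 2(2,1) assms(1)[unfolded w1(2)]] by blast
    show ?thesis
      using B[OF _ 2(2) p c w1(1)] B[OF _ 2(1) p c' w1(2)] by linarith
  next
    case 3
    have w1: "w = (\<lambda>k. - of_bool (k = r') - of_bool (k = s))" "w = (\<lambda>k. - of_bool (k = s) - of_bool (k = r'))"
      using w 3 by (auto simp: row_weight_upper row_weight_lower)
    have p: "p = 1" using par 3 by auto
    have "z $$ (n + r', r') = 0"
      using hom_part_periplecticD(3)[OF h 3(1,1)] by simp
    then have ne: "r' \<noteq> s" using rs(3) 3 by auto
    show ?thesis
      using C[OF _ 3(3) p weight_vector_C_eq[OF 3(1,3) assms(1)[unfolded w1(1)]] w1(1)]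
        C[OF _ 3(1) p weight_vector_C_eq[OF 3(3,1) assms(1)[unfolded w1(2)]] w1(2)] ne by linarith
  next
    case 4
    have w1: "w = (\<lambda>k. of_bool (k = s') - of_bool (k = r'))" using 4 w by (auto simp: row_weight_lower)
    have ne: "s' \<noteq> r'" using rsne 4 by auto
    show ?thesis
      using E[OF 4(3,1) ne _ weight_vector_E_eq[OF ne 4(3,1) assms(1)[unfolded w1]] w1] par 4 by auto
  qed
qed

text \<open>Weight zero forces a diagonal matrix, whereas an odd matrix has zero diagonal.\<close>

lemma weight_vector_odd_zero:
  assumes "weight_vector n 1 (\<lambda>_. 0) z"
  shows "z = 0\<^sub>m (n + n) (n + n)"
proof (rule eq_matI)
  fix r s assume "r < dim_row (0\<^sub>m (n + n) (n + n) :: complex mat)" "s < dim_col (0\<^sub>m (n + n) (n + n) :: complex mat)"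
  then have rs: "r < n + n" "s < n + n" by auto
  have "z $$ (r, r) = 0"
    using weight_vector_hom_part[OF assms] rs(1) unfolding hom_part_periplectic_iff by simp
  then have "z $$ (r, s) = 0"
    using weight_vector_zero_offdiag[OF assms rs] by (cases "r = s") auto
  then show "z $$ (r, s) = 0\<^sub>m (n + n) (n + n) $$ (r, s)" using rs by simp
qed (use weight_vector_carrier[OF assms] in auto)

text \<open>An even entry joins two rows of the same half, so its weight has coordinates among -1,
  0, 1, while twice \<epsilon>_i + \<epsilon>_j has a coordinate of at least 2. Hence
  \<open>B_mat n i j\<close> has zero bracket with itself.\<close>

lemma weight_vector_double_B:
  assumes "i < n" "j < n"
    "weight_vector n 0 (\<lambda>k. (of_bool (k = i) + of_bool (k = j)) + (of_bool (k = i) + of_bool (k = j))) z"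
  shows "z = 0\<^sub>m (n + n) (n + n)"
proof (rule ccontr)
  assume nz: "z \<noteq> 0\<^sub>m (n + n) (n + n)"
  obtain r s where rs: "r < n + n" "s < n + n" "z $$ (r, s) \<noteq> 0"
    and w: "(\<lambda>k. (of_bool (k = i) + of_bool (k = j)) + (of_bool (k = i) + of_bool (k = j))) =
      (\<lambda>k. row_weight n r k - row_weight n s k)"
    using weight_vector_nonzero_entry[OF assms(3) nz] .
  from rs have par: "((r < n) = (s < n))"
    using weight_vector_hom_part[OF assms(3)] unfolding hom_part_periplectic_iff by blast
  show False
    using fun_cong[OF w, of i] par by (auto simp: row_weight_def of_bool_def split: if_splits)
qed

text \<open>No root has a coordinate -2. This asymmetry of the root system makes the reflection in 2
  \<epsilon>_i leave the extremal vector alone.\<close>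

lemma no_weight_vector_neg_double:
  assumes "i < n" "weight_vector n p (\<lambda>k. - (of_bool (k = i) + of_bool (k = i))) z"
  shows "z = 0\<^sub>m (n + n) (n + n)"
proof (rule ccontr)
  assume nz: "z \<noteq> 0\<^sub>m (n + n) (n + n)"
  have w: "(\<lambda>k. - (of_bool (k = i) + of_bool (k = i))) \<noteq> (\<lambda>_. 0::int)"
    by (auto simp: fun_eq_iff)
  show False
    using assms(2) nz w
  proof (cases rule: weight_vector_cases)
    case (E a b c)
    from fun_cong[OF E(6), of i] show ?thesis by (auto simp: of_bool_def split: if_splits)
  next
    case (B a b c)
    from fun_cong[OF B(5), of i] show ?thesis by (auto simp: of_bool_def split: if_splits)
  next
    case (C a b c)
    from fun_cong[OF C(5), of i] C(1) show ?thesis by (auto simp: of_bool_def split: if_splits)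
  qed
qed

section \<open>Brackets with the torus and between opposite root vectors\<close>

text \<open>Bracketing with a diagonal matrix multiplies the entry (r, s) by z_rr - z_ss, which is
  the value of z on the difference of the row weights.\<close>

lemma superbracket_torus:
  assumes z: "weight_vector n 0 (\<lambda>_. 0) z" and x: "weight_vector n p w x"
  shows "superbracket 0 p z x = (\<Sum>i<n. z $$ (i, i) * of_int (w i)) \<cdot>\<^sub>m x"
proof (rule eq_matI)
  note c = weight_vector_carrier[OF z] weight_vector_carrier[OF x]
  fix r s assume "r < dim_row ((\<Sum>i<n. z $$ (i, i) * of_int (w i)) \<cdot>\<^sub>m x)"
    "s < dim_col ((\<Sum>i<n. z $$ (i, i) * of_int (w i)) \<cdot>\<^sub>m x)"
  then have rs: "r < n + n" "s < n + n" using c by auto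
  have prod: "(a * b) $$ (r, s) = (\<Sum>l<n + n. a $$ (r, l) * b $$ (l, s))"
    if "a \<in> carrier_mat (n + n) (n + n)" "b \<in> carrier_mat (n + n) (n + n)" for a b :: "complex mat"
    using that rs by (simp add: scalar_prod_def atLeast0LessThan)
  have "(z * x) $$ (r, s) = (\<Sum>l<n + n. if l = r then z $$ (r, r) * x $$ (r, s) else 0)"
    unfolding prod[OF c] using weight_vector_zero_offdiag[OF z rs(1)] by (intro sum.cong) auto
  then have zx: "(z * x) $$ (r, s) = z $$ (r, r) * x $$ (r, s)"
    using rs by simp
  have "(x * z) $$ (r, s) = (\<Sum>l<n + n. if l = s then x $$ (r, s) * z $$ (s, s) else 0)"
    unfolding prod[OF c(2,1)] using weight_vector_zero_offdiag[OF z _ rs(2)] by (intro sum.cong) auto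
  then have xz: "(x * z) $$ (r, s) = x $$ (r, s) * z $$ (s, s)"
    using rs by simp
  \<comment> \<open>The lower half of the diagonal is the negated upper half, which is the sign in
    \<open>row_weight\<close>.\<close>
  have diag: "z $$ (t, t) = (\<Sum>i<n. z $$ (i, i) * of_int (row_weight n t i))" if "t < n + n" for t
    using that
  proof (cases rule: row_cases)
    case 1
    have "(\<Sum>i<n. z $$ (i, i) * of_int (row_weight n t i)) = (\<Sum>i<n. if i = t then z $$ (t, t) else 0)"
      using 1 by (intro sum.cong) (auto simp: row_weight_upper)
    then show ?thesis using 1 by simp
  next
    case (2 t')
    have "(\<Sum>i<n. z $$ (i, i) * of_int (row_weight n t i)) = (\<Sum>i<n. if i = t' then - z $$ (t', t') else 0)"
      unfolding 2(2) by (intro sum.cong) (auto simp: row_weight_lower)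
    then show ?thesis using 2 hom_part_periplecticD(1)[OF weight_vector_hom_part[OF z], of t' t'] by simp
  qed
  have "z $$ (r, r) * x $$ (r, s) - x $$ (r, s) * z $$ (s, s) = (\<Sum>i<n. z $$ (i, i) * of_int (w i)) * x $$ (r, s)"
  proof (cases "x $$ (r, s) = 0")
    case False
    then have w: "w k = row_weight n r k - row_weight n s k" for k
      using x rs unfolding weight_vector_def by blast
    show ?thesis
      unfolding w diag[OF rs(1)] diag[OF rs(2)] by (simp add: algebra_simps sum_subtractf)
  qed simp
  then show "superbracket 0 p z x $$ (r, s) = ((\<Sum>i<n. z $$ (i, i) * of_int (w i)) \<cdot>\<^sub>m x) $$ (r, s)"
    using zx xz rs c by (simp add: superbracket_def koszul_sign_def)
qed (use weight_vector_carrier[OF z] weight_vector_carrier[OF x] in \<open>auto simp: superbracket_def\<close>)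

lemma superbracket_E_E_diag:
  assumes "a < n" "b < n" "a \<noteq> b" "i < n"
  shows "superbracket 0 0 (E_mat n a b) (E_mat n b a) $$ (i, i) = of_bool (i = a) - of_bool (i = b)"
proof -
  have c: "E_mat n a b \<in> carrier_mat (n + n) (n + n)" "E_mat n b a \<in> carrier_mat (n + n) (n + n)"
    by (auto simp: E_mat_def)
  have u: "(\<Sum>k<n. E_mat n a b $$ (i, k) * E_mat n b a $$ (k, i)) = (\<Sum>k<n. if k = b then of_bool (i = a) else 0)"
      "(\<Sum>k<n. E_mat n b a $$ (i, k) * E_mat n a b $$ (k, i)) = (\<Sum>k<n. if k = a then of_bool (i = b) else 0)"
      "(\<Sum>k<n. E_mat n a b $$ (i, n + k) * E_mat n b a $$ (n + k, i)) = (\<Sum>k<n. 0)"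
      "(\<Sum>k<n. E_mat n b a $$ (i, n + k) * E_mat n a b $$ (n + k, i)) = (\<Sum>k<n. 0)"
    using assms by (auto intro!: sum.cong simp: E_mat_def)
  show ?thesis
    using assms by (subst superbracket_entry[OF c]) (simp_all add: u koszul_sign_def)
qed

text \<open>The value of this bracket on a weight \<nu> is \<nu>_b - \<nu>_a, the number which
  decides whether the reflection in \<epsilon>_a + \<epsilon>_b moves the extremal vector. The upper
  left block comes from the product B C alone.\<close>

lemma superbracket_C_B_diag:
  assumes "a < n" "b < n" "a \<noteq> b" "i < n"
  shows "superbracket 1 1 (C_mat n a b) (B_mat n a b) $$ (i, i) = of_bool (i = b) - of_bool (i = a)"
proof -
  have c: "C_mat n a b \<in> carrier_mat (n + n) (n + n)" "B_mat n a b \<in> carrier_mat (n + n) (n + n)"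
    by (auto simp: C_mat_def B_mat_def)
  have d: "(\<Sum>k<n. (if k = b then x else 0) + (if k = a then y else 0)) = x + y" for x y :: complex
    using assms by (simp add: sum.distrib)
  have u: "(\<Sum>k<n. C_mat n a b $$ (i, k) * B_mat n a b $$ (k, i)) = (\<Sum>k<n. 0)"
      "(\<Sum>k<n. B_mat n a b $$ (i, k) * C_mat n a b $$ (k, i)) = (\<Sum>k<n. 0)"
      "(\<Sum>k<n. C_mat n a b $$ (i, n + k) * B_mat n a b $$ (n + k, i)) = (\<Sum>k<n. 0)"
      "(\<Sum>k<n. B_mat n a b $$ (i, n + k) * C_mat n a b $$ (n + k, i)) =
        (\<Sum>k<n. (if k = b then - of_bool (i = a) else 0) + (if k = a then of_bool (i = b) else 0))"
    by (intro sum.cong refl; use assms in \<open>auto simp: C_mat_def B_mat_def\<close>)+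
  show ?thesis
    using assms by (subst superbracket_entry[OF c]) (simp_all only: u d koszul_sign_def sum.neutral_const, simp)
qed

section \<open>Generation of p(n) by weight vectors\<close>

text \<open>The matrix type contains all sizes and so has no common zero; a finite sum is
  represented by a witness known through its entries, and \<open>P\<close> is carried along.\<close>

lemma mat_sum_induct:
  assumes "finite A" "\<And>a. a \<in> A \<Longrightarrow> P (f a)" "\<And>a. a \<in> A \<Longrightarrow> f a \<in> carrier_mat m m"
    and "P (0\<^sub>m m m)" "\<And>x y. P x \<Longrightarrow> P y \<Longrightarrow> P (x + y)"
  shows "\<exists>y. P y \<and> y \<in> carrier_mat m m \<and> (\<forall>r<m. \<forall>s<m. y $$ (r, s) = (\<Sum>a\<in>A. f a $$ (r, s)))"
  using assms(1-3)
proof (induction A)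
  case empty
  then show ?case using assms(4) by (intro exI[of _ "0\<^sub>m m m"]) auto
next
  case (insert a A)
  then obtain y where y: "P y" "y \<in> carrier_mat m m" "\<forall>r<m. \<forall>s<m. y $$ (r, s) = (\<Sum>a\<in>A. f a $$ (r, s))"
    by auto
  moreover have "P (f a)" "f a \<in> carrier_mat m m" using insert by auto
  ultimately show ?case using insert(1,2) assms(5)
    by (intro exI[of _ "f a + y"]) auto
qed

lemma sum_pair_delta:
  fixes f :: "nat \<Rightarrow> nat \<Rightarrow> complex"
  assumes "a < n" "b < n"
  shows "(\<Sum>(i, j)\<in>{..<n} \<times> {..<n}. f i j * of_bool (a = i \<and> b = j)) = f a b"
proof -
  have "(\<Sum>(i, j)\<in>{..<n} \<times> {..<n}. f i j * of_bool (a = i \<and> b = j)) =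
    (\<Sum>q\<in>{..<n} \<times> {..<n}. if q = (a, b) then f a b else 0)"
    by (intro sum.cong) (auto split: prod.splits)
  also have "\<dots> = f a b" using assms by (subst sum.delta) auto
  finally show ?thesis .
qed

text \<open>Each entry of \<open>x\<close> outside the upper left block is met by two of the root vectors, hence the factors \<open>1 / 2\<close>.\<close>

lemma periplectic_induct:
  assumes x: "x \<in> periplectic n"
    and add: "\<And>x y. x \<in> periplectic n \<Longrightarrow> y \<in> periplectic n \<Longrightarrow> P x \<Longrightarrow> P y \<Longrightarrow> P (x + y)"
    and wv: "\<And>p w x. weight_vector n p w x \<Longrightarrow> P x"
  shows "P x"
proof -
  let ?I = "{..<n} \<times> {..<n}"
  let ?Q = "\<lambda>x. x \<in> periplectic n \<and> P x"
  have Q0: "?Q (0\<^sub>m (n + n) (n + n))"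
  proof -
    have "weight_vector n 0 (\<lambda>_. 0) (0\<^sub>m (n + n) (n + n))"
      unfolding weight_vector_def by (auto intro!: hom_partI)
    then show ?thesis using wv weight_vector_periplectic by blast
  qed
  have Qadd: "?Q (x + y)" if "?Q x" "?Q y" for x y
    using that add periplectic_add by blast
  have Q1: "?Q (c \<cdot>\<^sub>m x)" if "weight_vector n p w x" for p w x c
    using weight_vector_smult[OF that] wv weight_vector_periplectic by blast
  have "\<exists>y. ?Q y \<and> y \<in> carrier_mat (n + n) (n + n) \<and> (\<forall>r<n + n. \<forall>s<n + n. y $$ (r, s) =
      (\<Sum>q\<in>?I. (case q of (i, j) \<Rightarrow> f i j \<cdot>\<^sub>m Y n i j) $$ (r, s)))"
    if Y: "\<forall>i<n. \<forall>j<n. weight_vector n p (w i j) (Y n i j)" for f w p and Y :: "nat \<Rightarrow> nat \<Rightarrow> nat \<Rightarrow> complex mat"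
  proof (rule mat_sum_induct)
    show "?Q (case q of (i, j) \<Rightarrow> f i j \<cdot>\<^sub>m Y n i j)" if "q \<in> ?I" for q
      using Y that Q1 by (cases q) (simp, blast)
    show "(case q of (i, j) \<Rightarrow> f i j \<cdot>\<^sub>m Y n i j) \<in> carrier_mat (n + n) (n + n)" if qI: "q \<in> ?I" for q
    proof -
      obtain i j where q: "q = (i, j)" "i < n" "j < n" using qI by auto
      then have "weight_vector n p (w i j) (Y n i j)" using Y by blast
      then show ?thesis using weight_vector_carrier q by simp
    qed
  qed (use Q0 Qadd in auto)
  note ex = this
  obtain e where e: "?Q e" "e \<in> carrier_mat (n + n) (n + n)" "\<forall>r<n + n. \<forall>s<n + n. e $$ (r, s) =
      (\<Sum>q\<in>?I. (case q of (i, j) \<Rightarrow> x $$ (i, j) \<cdot>\<^sub>m E_mat n i j) $$ (r, s))"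
    using ex[of 0 "\<lambda>i j k. of_bool (k = i) - of_bool (k = j)" E_mat "\<lambda>i j. x $$ (i, j)"] weight_vector_E_mat by blast
  obtain b where b: "?Q b" "b \<in> carrier_mat (n + n) (n + n)" "\<forall>r<n + n. \<forall>s<n + n. b $$ (r, s) =
      (\<Sum>q\<in>?I. (case q of (i, j) \<Rightarrow> (x $$ (i, n + j) / 2) \<cdot>\<^sub>m B_mat n i j) $$ (r, s))"
    using ex[of 1 "\<lambda>i j k. of_bool (k = i) + of_bool (k = j)" B_mat "\<lambda>i j. x $$ (i, n + j) / 2"] weight_vector_B_mat by blast
  obtain c where c: "?Q c" "c \<in> carrier_mat (n + n) (n + n)" "\<forall>r<n + n. \<forall>s<n + n. c $$ (r, s) =
      (\<Sum>q\<in>?I. (case q of (i, j) \<Rightarrow> (x $$ (n + i, j) / 2) \<cdot>\<^sub>m C_mat n i j) $$ (r, s))"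
    using ex[of 1 "\<lambda>i j k. - of_bool (k = i) - of_bool (k = j)" C_mat "\<lambda>i j. x $$ (n + i, j) / 2"] weight_vector_C_mat by blast
  note D = periplecticD[OF x]
  have "x = e + (b + c)"
  proof (rule eq_matI)
    fix r s assume "r < dim_row (e + (b + c))" "s < dim_col (e + (b + c))"
    then have rs: "r < n + n" "s < n + n" using c by auto
    have E: "e $$ (r, s) = (\<Sum>(i, j)\<in>?I. x $$ (i, j) * (of_bool (r = i \<and> s = j) - of_bool (r = n + j \<and> s = n + i)))"
      using e(3) rs by (auto simp: E_mat_def intro!: sum.cong)
    have B: "b $$ (r, s) = (\<Sum>(i, j)\<in>?I. x $$ (i, n + j) / 2 * (of_bool (r = i \<and> s = n + j) + of_bool (r = j \<and> s = n + i)))"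
      using b(3) rs by (auto simp: B_mat_def intro!: sum.cong)
    have C: "c $$ (r, s) = (\<Sum>(i, j)\<in>?I. x $$ (n + i, j) / 2 * (of_bool (r = n + i \<and> s = j) - of_bool (r = n + j \<and> s = i)))"
      using c(3) rs by (auto simp: C_mat_def intro!: sum.cong)
    have swap: "(\<Sum>(i, j)\<in>?I. f i j * of_bool (a = j \<and> b = i)) = (f b a :: complex)" if "a < n" "b < n" for f a b
      using sum_pair_delta[OF that(2,1), of f] by (simp add: conj_commute)
    have z: "(\<Sum>(i, j)\<in>?I. 0) = (0::complex)" by simp
    have sumeq: "(\<Sum>(i, j)\<in>?I. f i j) = (\<Sum>(i, j)\<in>?I. g i j)" if "\<And>i j. i < n \<Longrightarrow> j < n \<Longrightarrow> f i j = g i j"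
      for f g :: "nat \<Rightarrow> nat \<Rightarrow> complex"
      using that by (intro sum.cong) auto
    have pair: "(\<Sum>(i, j)\<in>?I. f i j + g i j) = (\<Sum>(i, j)\<in>?I. f i j) + (\<Sum>(i, j)\<in>?I. g i j)"
      for f g :: "nat \<Rightarrow> nat \<Rightarrow> complex"
      by (simp add: sum.distrib split_def)
    have "x $$ (r, s) = e $$ (r, s) + (b $$ (r, s) + c $$ (r, s))"
      using rs(1)
    proof (cases rule: row_cases)
      case r: 1
      show ?thesis
        using rs(2)
      proof (cases rule: row_cases)
        case 1
        have "e $$ (r, s) = (\<Sum>(i, j)\<in>?I. x $$ (i, j) * of_bool (r = i \<and> s = j))"
          unfolding E using r 1 by (intro sumeq) auto
        moreover have "b $$ (r, s) = 0" "c $$ (r, s) = 0"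
          unfolding B C using r 1 by (auto intro!: sum.neutral)
        ultimately show ?thesis by (simp add: sum_pair_delta[OF r 1])
      next
        case (2 s')
        have "b $$ (r, s) = (\<Sum>(i, j)\<in>?I. x $$ (i, n + j) / 2 * of_bool (r = i \<and> s' = j) + x $$ (i, n + j) / 2 * of_bool (r = j \<and> s' = i))"
          unfolding B using r 2 by (intro sumeq) (auto simp: distrib_left)
        moreover have "e $$ (r, s) = 0" "c $$ (r, s) = 0"
          unfolding E C using r 2 by (auto intro!: sum.neutral)
        ultimately show ?thesis
          using D(2)[OF r 2(1)] by (simp only: pair sum_pair_delta[OF r 2(1)] swap[OF r 2(1)] 2(2)) simp
      qed
    next
      case r: (2 r')
      show ?thesis
        using rs(2)
      proof (cases rule: row_cases)
        case 1
        have "c $$ (r, s) = (\<Sum>(i, j)\<in>?I. x $$ (n + i, j) / 2 * of_bool (r' = i \<and> s = j) + (- x $$ (n + i, j) / 2) * of_bool (r' = j \<and> s = i))"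
          unfolding C using r 1 by (intro sumeq) (auto simp: algebra_simps)
        moreover have "e $$ (r, s) = 0" "b $$ (r, s) = 0"
          unfolding E B using r 1 by (auto intro!: sum.neutral)
        ultimately show ?thesis
          using D(3)[OF r(1) 1] by (simp only: pair sum_pair_delta[OF r(1) 1] swap[OF r(1) 1] r(2)) simp
      next
        case (2 s')
        have "e $$ (r, s) = (\<Sum>(i, j)\<in>?I. (- x $$ (i, j)) * of_bool (r' = j \<and> s' = i))"
          unfolding E using r 2 by (intro sumeq) auto
        moreover have "b $$ (r, s) = 0" "c $$ (r, s) = 0"
          unfolding B C using r 2 by (auto intro!: sum.neutral)
        ultimately show ?thesis
          using D(1)[OF r(1) 2(1)] by (simp only: swap[OF r(1) 2(1)] r(2) 2(2)) simp
      qed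
    qed
    then show "x $$ (r, s) = (e + (b + c)) $$ (r, s)"
      using rs e(2) b(2) c(2) by auto
  qed (use x[unfolded periplectic_iff] e(2) b(2) c(2) in auto)
  then show ?thesis
    using Qadd[OF e(1) Qadd[OF b(1) c(1)]] by blast
qed

section \<open>Modules over the complex numbers\<close>

lemma complex_ring_simps [simp]:
  "carrier complex_ring = UNIV" "\<zero>\<^bsub>complex_ring\<^esub> = 0" "\<one>\<^bsub>complex_ring\<^esub> = 1"
  "a \<oplus>\<^bsub>complex_ring\<^esub> b = a + b" "a \<otimes>\<^bsub>complex_ring\<^esub> b = a * b"
  by (simp_all add: ring_of_type_algebra_def)

lemma cring_complex_ring: "cring complex_ring"
  by (rule cring_from_type_algebra)

lemma complex_ring_uminus: "\<ominus>\<^bsub>complex_ring\<^esub> (a::complex) = - a"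
proof -
  interpret R: cring "complex_ring :: complex ring" by (rule cring_complex_ring)
  show ?thesis by (rule R.minus_equality) auto
qed

text \<open>Linear algebra over the complex numbers is kept apart from the super structure, since it
  is also applied to duals, direct sums and the free space on symbols.\<close>

locale cspace = Module.module complex_ring M for M (structure)
begin

lemma scale_closed [simp, intro]: "v \<in> carrier M \<Longrightarrow> c \<odot> v \<in> carrier M"
  using smult_closed by simp

lemma scale_add_left: "v \<in> carrier M \<Longrightarrow> (a + b) \<odot> v = a \<odot> v \<oplus> b \<odot> v"
  using smult_l_distr[of a b v] by simp

lemma scale_add_right: "v \<in> carrier M \<Longrightarrow> w \<in> carrier M \<Longrightarrow> a \<odot> (v \<oplus> w) = a \<odot> v \<oplus> a \<odot> w"
  using smult_r_distr[of a v w] by simp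

lemma scale_scale: "v \<in> carrier M \<Longrightarrow> a \<odot> (b \<odot> v) = (a * b) \<odot> v"
  using smult_assoc1[of a b v] by simp

lemma scale_one [simp]: "v \<in> carrier M \<Longrightarrow> 1 \<odot> v = v"
  using smult_one[of v] by simp

lemma scale_zero_left [simp]: "v \<in> carrier M \<Longrightarrow> 0 \<odot> v = \<zero>"
  using smult_l_null[of v] by simp

lemma scale_zero_right [simp]: "a \<odot> \<zero> = \<zero>"
  using smult_r_null[of a] by simp

lemma neg_eq_scale: "v \<in> carrier M \<Longrightarrow> \<ominus> v = (- 1) \<odot> v"
  using smult_l_minus[of 1 v] by (simp add: complex_ring_uminus)

lemma minus_eq_scale: "v \<in> carrier M \<Longrightarrow> w \<in> carrier M \<Longrightarrow> v \<ominus> w = v \<oplus> (- 1) \<odot> w"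
  by (simp add: a_minus_def neg_eq_scale)

lemma scale_eq_zero_iff:
  assumes "v \<in> carrier M"
  shows "c \<odot> v = \<zero> \<longleftrightarrow> c = 0 \<or> v = \<zero>"
proof
  assume *: "c \<odot> v = \<zero>"
  show "c = 0 \<or> v = \<zero>"
  proof (cases "c = 0")
    case False
    have "v = inverse c \<odot> (c \<odot> v)" using False assms by (simp add: scale_scale)
    then show ?thesis using * by simp
  qed simp
qed (use assms in auto)

definition lin_subspace where
  "lin_subspace S \<longleftrightarrow> S \<subseteq> carrier M \<and> \<zero> \<in> S \<and> (\<forall>v\<in>S. \<forall>w\<in>S. v \<oplus> w \<in> S) \<and> (\<forall>c. \<forall>v\<in>S. c \<odot> v \<in> S)"

lemma lin_subspaceI:
  assumes "S \<subseteq> carrier M" "\<zero> \<in> S" "\<And>v w. v \<in> S \<Longrightarrow> w \<in> S \<Longrightarrow> v \<oplus> w \<in> S" "\<And>c v. v \<in> S \<Longrightarrow> c \<odot> v \<in> S"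
  shows "lin_subspace S"
  using assms unfolding lin_subspace_def by blast

lemma lin_subspaceD:
  assumes "lin_subspace S"
  shows "S \<subseteq> carrier M" "\<zero> \<in> S" "v \<in> S \<Longrightarrow> w \<in> S \<Longrightarrow> v \<oplus> w \<in> S" "v \<in> S \<Longrightarrow> c \<odot> v \<in> S"
  using assms unfolding lin_subspace_def by blast+

lemma submodule_iff_lin_subspace: "submodule S complex_ring M \<longleftrightarrow> lin_subspace S"
proof
  assume s: "submodule S complex_ring M"
  note E = submoduleE[OF s]
  have "\<zero> \<in> S"
    using subgroup.one_closed[OF submodule.axioms(1)[OF s]] by simp
  then show "lin_subspace S"
    using E by (intro lin_subspaceI) auto
next
  assume s: "lin_subspace S"
  note D = lin_subspaceD[OF s]
  show "submodule S complex_ring M"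
  proof (rule submoduleI)
    show "\<ominus> a \<in> S" if "a \<in> S" for a
      using D(4)[OF that, of "- 1"] D(1) that by (subst neg_eq_scale) auto
  qed (use D in auto)
qed

lemma lin_subspace_minus: "lin_subspace S \<Longrightarrow> v \<in> S \<Longrightarrow> w \<in> S \<Longrightarrow> v \<ominus> w \<in> S"
  using lin_subspaceD[of S] by (subst minus_eq_scale) auto

lemma add_shuffle:
  assumes "a \<in> carrier M" "b \<in> carrier M" "c \<in> carrier M" "d \<in> carrier M"
  shows "(a \<oplus> b) \<oplus> (c \<oplus> d) = (a \<oplus> c) \<oplus> (b \<oplus> d)"
  using assms by (simp add: a_ac)

end

sublocale supermodule \<subseteq> cspace M ..

context supermodule
begin

lemma part_subspace: "lin_subspace (part M p)"
  using part_submodule submodule_iff_lin_subspace by blast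

lemma part_closed: "v \<in> part M p \<Longrightarrow> v \<in> carrier M"
  using lin_subspaceD(1)[OF part_subspace] by blast

lemma part_decompose:
  assumes "v \<in> carrier M"
  obtains v0 v1 where "v0 \<in> part M 0" "v1 \<in> part M 1" "v = v0 \<oplus> v1"
  using assms part_sum unfolding set_add_def' by auto

lemma part_disjoint: "p \<noteq> q \<Longrightarrow> v \<in> part M p \<Longrightarrow> v \<in> part M q \<Longrightarrow> v = \<zero>"
  using part_inter bit_exhaust[of p] bit_exhaust[of q] by blast

text \<open>The difference of the two expressions lies in both parts and therefore vanishes. Naming
  the parities p and q makes the lemma independent of their order.\<close>

lemma part_decompose_unique:
  assumes "a \<in> part M p" "b \<in> part M q" "a' \<in> part M p" "b' \<in> part M q" "p \<noteq> q" "a \<oplus> b = a' \<oplus> b'"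
  shows "a = a'" "b = b'"
proof -
  note c = part_closed[OF assms(1)] part_closed[OF assms(2)] part_closed[OF assms(3)] part_closed[OF assms(4)]
  have "(a \<oplus> b) \<oplus> (\<ominus> a' \<oplus> \<ominus> b) = (a' \<oplus> b') \<oplus> (\<ominus> a' \<oplus> \<ominus> b)"
    using assms(6) by simp
  also have "(a \<oplus> b) \<oplus> (\<ominus> a' \<oplus> \<ominus> b) = (a \<ominus> a') \<oplus> (b \<oplus> \<ominus> b)"
    unfolding a_minus_def using c by (intro add_shuffle) auto
  also have "\<dots> = a \<ominus> a'"
    using c by (simp add: r_neg)
  also have "(a' \<oplus> b') \<oplus> (\<ominus> a' \<oplus> \<ominus> b) = (a' \<oplus> \<ominus> a') \<oplus> (b' \<ominus> b)"
    unfolding a_minus_def using c by (intro add_shuffle) auto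
  also have "\<dots> = b' \<ominus> b"
    using c by (simp add: r_neg)
  finally have "a \<ominus> a' = b' \<ominus> b" .
  moreover have "a \<ominus> a' \<in> part M p" "b' \<ominus> b \<in> part M q"
    using lin_subspace_minus[OF part_subspace] assms by auto
  ultimately have "a \<ominus> a' = \<zero>"
    using part_disjoint[OF assms(5)] by metis
  then show a: "a = a'" using c by (simp add: add.inv_solve_right' a_minus_def)
  show "b = b'" using assms(6) c unfolding a by simp
qed

lemma act_zero: "x \<in> g \<Longrightarrow> act M x \<zero> = \<zero>"
  using act_smult[of x "\<zero>" 0] act_closed[of x "\<zero>"] by simp

lemma act_comm:
  assumes "x \<in> hom_part n g p" "y \<in> hom_part n g q" "v \<in> carrier M"
  shows "act M x (act M y v) = act M (superbracket p q x y) v \<oplus> koszul_sign p q \<odot> act M y (act M x v)"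
proof -
  have c: "act M x (act M y v) \<in> carrier M" "act M y (act M x v) \<in> carrier M"
    using assms act_closed hom_part_subset by metis+
  have "act M (superbracket p q x y) v \<oplus> koszul_sign p q \<odot> act M y (act M x v)
     = act M x (act M y v) \<oplus> ((- 1) \<odot> (koszul_sign p q \<odot> act M y (act M x v)) \<oplus> 1 \<odot> (koszul_sign p q \<odot> act M y (act M x v)))"
    using c unfolding act_superbracket[OF assms] by (simp add: minus_eq_scale a_assoc)
  also have "\<dots> = act M x (act M y v)"
    using c by (subst scale_add_left[symmetric]) auto
  finally show ?thesis by simp
qed

end

section \<open>Extremal vectors\<close>

definition pairing :: "nat \<Rightarrow> (nat \<Rightarrow> int) \<Rightarrow> (nat \<Rightarrow> int) \<Rightarrow> int" where
  "pairing n x w = (\<Sum>i<n. x i * w i)"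

lemma pairing_add: "pairing n x (\<lambda>k. w k + w' k) = pairing n x w + pairing n x w'"
  by (simp add: pairing_def distrib_left sum.distrib)

lemma pairing_zero [simp]: "pairing n x (\<lambda>_. 0) = 0"
  by (simp add: pairing_def)

lemma pairing_neg_left: "pairing n (\<lambda>k. - x k) w = - pairing n x w"
  by (simp add: pairing_def sum_negf)

lemma pairing_delta: "i < n \<Longrightarrow> pairing n x (\<lambda>k. of_bool (k = i)) = x i"
  by (simp add: pairing_def of_bool_def if_distrib cong: if_cong)

lemma pairing_roots:
  assumes "i < n" "j < n"
  shows "pairing n x (\<lambda>k. of_bool (k = i) - of_bool (k = j)) = x i - x j"
    "pairing n x (\<lambda>k. of_bool (k = i) + of_bool (k = j)) = x i + x j"
    "pairing n x (\<lambda>k. - of_bool (k = i) - of_bool (k = j)) = - x i - x j"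
  using pairing_delta[OF assms(1), of x] pairing_delta[OF assms(2), of x]
  by (simp_all add: pairing_def algebra_simps sum.distrib sum_subtractf sum_negf)

text \<open>
  A functional \<open>x\<close> which does not vanish on any root determines a Borel subalgebra, spanned by the torus
  and the weight vectors on whose weights \<open>x\<close> is positive.
\<close>

definition regular :: "nat \<Rightarrow> (nat \<Rightarrow> int) \<Rightarrow> bool" where
  "regular n x \<longleftrightarrow> (\<forall>p w z. weight_vector n p w z \<and> z \<noteq> 0\<^sub>m (n + n) (n + n) \<and> pairing n x w = 0 \<longrightarrow> w = (\<lambda>_. 0))"

lemma regularI:
  assumes "\<And>i j. i < n \<Longrightarrow> j < n \<Longrightarrow> i \<noteq> j \<Longrightarrow> x i \<noteq> x j" "\<And>i j. i \<le> j \<Longrightarrow> j < n \<Longrightarrow> x i + x j \<noteq> 0"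
  shows "regular n x"
  unfolding regular_def
proof (intro allI impI, elim conjE, rule ccontr)
  fix p w z assume "weight_vector n p w z" "z \<noteq> 0\<^sub>m (n + n) (n + n)" and *: "pairing n x w = 0" "w \<noteq> (\<lambda>_. 0)"
  from this(1,2,4) show False
  proof (cases rule: weight_vector_cases)
    case (E i j c)
    then show ?thesis using * assms(1)[of i j] by (simp add: pairing_roots)
  next
    case (B i j c)
    then show ?thesis using * assms(2)[of i j] by (simp add: pairing_roots)
  next
    case (C i j c)
    then show ?thesis using * assms(2)[of i j] by (simp add: pairing_roots)
  qed
qed

definition torus_weight :: "nat \<Rightarrow> complex mat \<Rightarrow> (nat \<Rightarrow> int) \<Rightarrow> complex" where
  "torus_weight n z nu = (\<Sum>i<n. z $$ (i, i) * of_int (nu i))"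

lemma torus_weight_add: "torus_weight n z (\<lambda>k. w k + w' k) = torus_weight n z w + torus_weight n z w'"
  by (simp add: torus_weight_def distrib_left sum.distrib)

text \<open>The parity \<open>q\<close> is part of the data because it decides the power of the
  parity switch. The torus enters as the even matrices of weight zero, which are the diagonal
  elements.\<close>

definition extremal :: "nat \<Rightarrow> 'v smod \<Rightarrow> (nat \<Rightarrow> int) \<Rightarrow> (nat \<Rightarrow> int) \<Rightarrow> bit \<Rightarrow> 'v \<Rightarrow> bool" where
  "extremal n M x nu q v \<longleftrightarrow> v \<in> part M q \<and> v \<noteq> \<zero>\<^bsub>M\<^esub> \<and>
     (\<forall>p w z. weight_vector n p w z \<and> pairing n x w > 0 \<longrightarrow> act M z v = \<zero>\<^bsub>M\<^esub>) \<and>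
     (\<forall>z. weight_vector n 0 (\<lambda>_. 0) z \<longrightarrow> act M z v = torus_weight n z nu \<odot>\<^bsub>M\<^esub> v)"

text \<open>Only root vectors on which x is negative are applied, so that degrees can only fall.
  Stability under the whole algebra is proved afterwards by commutation, which takes the place of a
  PBW theorem.\<close>

inductive_set lower_span :: "nat \<Rightarrow> 'v smod \<Rightarrow> (nat \<Rightarrow> int) \<Rightarrow> 'v \<Rightarrow> 'v set" for n M x v where
  base: "v \<in> lower_span n M x v"
| zero: "\<zero>\<^bsub>M\<^esub> \<in> lower_span n M x v"
| add: "y \<in> lower_span n M x v \<Longrightarrow> y' \<in> lower_span n M x v \<Longrightarrow> y \<oplus>\<^bsub>M\<^esub> y' \<in> lower_span n M x v"
| scale: "y \<in> lower_span n M x v \<Longrightarrow> c \<odot>\<^bsub>M\<^esub> y \<in> lower_span n M x v"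
| act: "weight_vector n p w z \<Longrightarrow> pairing n x w < 0 \<Longrightarrow> y \<in> lower_span n M x v \<Longrightarrow> act M z y \<in> lower_span n M x v"

text \<open>The functional x as an element of the torus: on a vector of weight w it acts by
  \<open>pairing n x w\<close>, so heights become eigenvalues of one operator.\<close>

definition grading_elt :: "nat \<Rightarrow> (nat \<Rightarrow> int) \<Rightarrow> complex mat" where
  "grading_elt n x = torus_mat n (\<lambda>i. of_int (x i))"

definition shift :: "nat \<Rightarrow> 'v smod \<Rightarrow> (nat \<Rightarrow> int) \<Rightarrow> int \<Rightarrow> 'v \<Rightarrow> 'v" where
  "shift n M x c y = act M (grading_elt n x) y \<oplus>\<^bsub>M\<^esub> (- of_int c) \<odot>\<^bsub>M\<^esub> y"

text \<open>The sum of the generalized eigenspaces of the grading element for eigenvalues below \<open>k\<close>.\<close>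

definition low :: "nat \<Rightarrow> 'v smod \<Rightarrow> (nat \<Rightarrow> int) \<Rightarrow> int \<Rightarrow> 'v set" where
  "low n M x k = {y \<in> carrier M. \<exists>cs. (\<forall>c\<in>set cs. c < k) \<and> foldr (shift n M x) cs y = \<zero>\<^bsub>M\<^esub>}"

lemma grading_elt_weight: "weight_vector n 0 (\<lambda>_. 0) (grading_elt n x)"
  unfolding grading_elt_def by (rule weight_vector_torus_mat)

lemma grading_elt_torus_weight: "torus_weight n (grading_elt n x) w = of_int (pairing n x w)"
  by (simp add: torus_weight_def grading_elt_def torus_mat_def pairing_def)

locale psupermodule = supermodule n "periplectic n" M for n :: nat and M :: "'v smod" (structure)
begin

lemma wv_act_closed: "weight_vector n p w z \<Longrightarrow> y \<in> carrier M \<Longrightarrow> act M z y \<in> carrier M"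
  using act_closed weight_vector_periplectic by blast

lemma wv_act_add: "weight_vector n p w z \<Longrightarrow> y \<in> carrier M \<Longrightarrow> y' \<in> carrier M \<Longrightarrow> act M z (y \<oplus> y') = act M z y \<oplus> act M z y'"
  using act_add weight_vector_periplectic by blast

lemma wv_act_scale: "weight_vector n p w z \<Longrightarrow> y \<in> carrier M \<Longrightarrow> act M z (c \<odot> y) = c \<odot> act M z y"
  using act_smult weight_vector_periplectic by blast

lemma wv_act_zero: "weight_vector n p w z \<Longrightarrow> act M z \<zero> = \<zero>"
  using act_zero weight_vector_periplectic by blast

lemma wv_act_part: "weight_vector n p w z \<Longrightarrow> y \<in> part M q \<Longrightarrow> act M z y \<in> part M (p + q)"
  using act_part weight_vector_hom_part by blast

lemma wv_act_comm:
  assumes "weight_vector n p w z" "weight_vector n q w' z'" "v \<in> carrier M"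
  shows "act M z (act M z' v) = act M (superbracket p q z z') v \<oplus> koszul_sign p q \<odot> act M z' (act M z v)"
  using act_comm[OF weight_vector_hom_part[OF assms(1)] weight_vector_hom_part[OF assms(2)] assms(3)] .

lemma act_zero_mat: "v \<in> carrier M \<Longrightarrow> act M (0\<^sub>m (n + n) (n + n)) v = \<zero>"
proof -
  assume v: "v \<in> carrier M"
  have g: "torus_mat n (\<lambda>_. 0) \<in> periplectic n"
    using weight_vector_torus_mat weight_vector_periplectic by blast
  have "0 \<cdot>\<^sub>m torus_mat n (\<lambda>_. 0) = 0\<^sub>m (n + n) (n + n)"
    by (auto simp: torus_mat_def intro!: eq_matI)
  with smult_act[OF g v, of 0] act_closed[OF g v] v show ?thesis by simp
qed

lemma act_torus_comm:
  assumes "weight_vector n 0 (\<lambda>_. 0) z" "weight_vector n p w e" "y \<in> carrier M"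
  shows "act M z (act M e y) = act M e (act M z y) \<oplus> torus_weight n z w \<odot> act M e y"
proof -
  have "act M z (act M e y) = act M (torus_weight n z w \<cdot>\<^sub>m e) y \<oplus> 1 \<odot> act M e (act M z y)"
    using wv_act_comm[OF assms] superbracket_torus[OF assms(1,2)]
    by (simp add: torus_weight_def koszul_sign_def)
  then show ?thesis
    using assms smult_act[of e y] wv_act_closed weight_vector_periplectic[OF assms(2)]
    by (simp add: a_comm[of "torus_weight n z w \<odot> act M e y"])
qed

section \<open>Generalized eigenspaces of the grading element\<close>

lemma shift_closed: "y \<in> carrier M \<Longrightarrow> shift n M x c y \<in> carrier M"
  unfolding shift_def using wv_act_closed[OF grading_elt_weight] by blast

lemma shift_add: "y \<in> carrier M \<Longrightarrow> y' \<in> carrier M \<Longrightarrow> shift n M x c (y \<oplus> y') = shift n M x c y \<oplus> shift n M x c y'"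
  unfolding shift_def using wv_act_closed[OF grading_elt_weight]
  by (simp add: wv_act_add[OF grading_elt_weight] scale_add_right add_shuffle)

lemma shift_scale: "y \<in> carrier M \<Longrightarrow> shift n M x c (a \<odot> y) = a \<odot> shift n M x c y"
  unfolding shift_def using wv_act_closed[OF grading_elt_weight]
  by (simp add: wv_act_scale[OF grading_elt_weight] scale_add_right scale_scale mult.commute)

lemma shift_zero: "shift n M x c \<zero> = \<zero>"
  unfolding shift_def by (simp add: wv_act_zero[OF grading_elt_weight])

text \<open>A root vector of weight w raises the eigenvalue of the grading element by
  \<open>pairing n x w\<close>, so it intertwines the two shifted operators.\<close>

lemma shift_act:
  assumes z: "weight_vector n p w z" and y: "y \<in> carrier M"
  shows "shift n M x (c + pairing n x w) (act M z y) = act M z (shift n M x c y)"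
proof -
  let ?H = "grading_elt n x" and ?k = "complex_of_int (pairing n x w)"
  note H = grading_elt_weight[of n x]
  have c: "act M z y \<in> carrier M" "act M ?H y \<in> carrier M" "act M z (act M ?H y) \<in> carrier M"
    using wv_act_closed[OF z] wv_act_closed[OF H] y by auto
  have "act M ?H (act M z y) \<oplus> (- of_int c - ?k) \<odot> act M z y =
    act M z (act M ?H y) \<oplus> (?k \<odot> act M z y \<oplus> (- of_int c - ?k) \<odot> act M z y)"
    using c by (simp add: act_torus_comm[OF H z y] grading_elt_torus_weight a_assoc)
  also have "\<dots> = act M z (act M ?H y) \<oplus> (- of_int c) \<odot> act M z y"
    using c by (simp add: scale_add_left[symmetric])
  finally have "act M ?H (act M z y) \<oplus> (- of_int c - ?k) \<odot> act M z y = act M z (act M ?H y \<oplus> (- of_int c) \<odot> y)"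
    using c y by (simp add: wv_act_add[OF z] wv_act_scale[OF z])
  then show ?thesis
    unfolding shift_def by (simp only: of_int_add minus_add_distrib diff_conv_add_uminus)
qed

lemma shift_commute:
  assumes "y \<in> carrier M"
  shows "shift n M x c (shift n M x d y) = shift n M x d (shift n M x c y)"
proof -
  have "shift n M x c (act M (grading_elt n x) y) = act M (grading_elt n x) (shift n M x c y)"
    using shift_act[OF grading_elt_weight assms, of x c x] by simp
  then show ?thesis
    unfolding shift_def[of n M x d] using assms shift_closed wv_act_closed[OF grading_elt_weight]
    by (simp add: shift_add shift_scale)
qed

abbreviation shifts :: "(nat \<Rightarrow> int) \<Rightarrow> int list \<Rightarrow> 'v \<Rightarrow> 'v" where
  "shifts x cs \<equiv> foldr (shift n M x) cs"

lemma shifts_closed: "y \<in> carrier M \<Longrightarrow> shifts x cs y \<in> carrier M"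
  by (induction cs) (auto simp: shift_closed)

lemma shifts_zero: "shifts x cs \<zero> = \<zero>"
  by (induction cs) (auto simp: shift_zero)

lemma shifts_add: "y \<in> carrier M \<Longrightarrow> y' \<in> carrier M \<Longrightarrow> shifts x cs (y \<oplus> y') = shifts x cs y \<oplus> shifts x cs y'"
  by (induction cs) (auto simp: shift_add shifts_closed)

lemma shifts_scale: "y \<in> carrier M \<Longrightarrow> shifts x cs (a \<odot> y) = a \<odot> shifts x cs y"
  by (induction cs) (auto simp: shift_scale shifts_closed)

lemma shifts_shift: "y \<in> carrier M \<Longrightarrow> shifts x cs (shift n M x d y) = shift n M x d (shifts x cs y)"
  by (induction cs) (auto simp: shift_commute shifts_closed)

lemma shifts_commute: "y \<in> carrier M \<Longrightarrow> shifts x cs (shifts x ds y) = shifts x ds (shifts x cs y)"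
  by (induction ds) (auto simp: shifts_shift shifts_closed)

lemma shifts_act:
  assumes "weight_vector n p w z" "y \<in> carrier M"
  shows "shifts x (map (\<lambda>c. c + pairing n x w) cs) (act M z y) = act M z (shifts x cs y)"
  by (induction cs) (simp_all add: shift_act[OF assms(1)] shifts_closed assms(2))

lemma shifts_eigen:
  assumes "y \<in> carrier M" "act M (grading_elt n x) y = of_int d \<odot> y"
  shows "shifts x cs y = of_int (\<Prod>c\<leftarrow>cs. d - c) \<odot> y"
proof (induction cs)
  case (Cons c cs)
  have "shift n M x c y = of_int (d - c) \<odot> y"
    unfolding shift_def assms(2) using assms(1) by (simp add: scale_add_left[symmetric])
  with Cons show ?case
    using assms(1) by (simp add: shift_scale scale_scale mult.commute)
qed (use assms in simp)

text \<open>The shifts commute, so a sum is killed by the concatenation of the two lists that kill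
  its terms.\<close>

lemma low_subspace: "lin_subspace (low n M x k)"
proof (rule lin_subspaceI)
  show "\<zero> \<in> low n M x k"
    unfolding low_def by (auto intro: exI[of _ "[]"])
  fix v w assume v: "v \<in> low n M x k" and w: "w \<in> low n M x k"
  then obtain cs ds where c: "v \<in> carrier M" "\<forall>c\<in>set cs. c < k" "shifts x cs v = \<zero>"
    and d: "w \<in> carrier M" "\<forall>c\<in>set ds. c < k" "shifts x ds w = \<zero>"
    unfolding low_def by auto
  have "shifts x (cs @ ds) (v \<oplus> w) = \<zero>"
    using c d shifts_commute[of v x cs ds] by (simp add: shifts_add shifts_closed shifts_zero)
  with c d show "v \<oplus> w \<in> low n M x k"
    unfolding low_def by (auto intro!: exI[of _ "cs @ ds"])
next
  fix c v assume "v \<in> low n M x k"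
  then show "c \<odot> v \<in> low n M x k"
    unfolding low_def by (auto simp: shifts_scale)
qed (auto simp: low_def)

lemma low_carrier: "y \<in> low n M x k \<Longrightarrow> y \<in> carrier M"
  by (simp add: low_def)

lemma low_mono: "k \<le> k' \<Longrightarrow> low n M x k \<subseteq> low n M x k'"
  unfolding low_def using order_less_le_trans by blast

lemma low_act:
  assumes "weight_vector n p w z" "y \<in> low n M x k"
  shows "act M z y \<in> low n M x (k + pairing n x w)"
proof -
  obtain cs where c: "y \<in> carrier M" "\<forall>c\<in>set cs. c < k" "shifts x cs y = \<zero>"
    using assms(2) unfolding low_def by auto
  have "shifts x (map (\<lambda>c. c + pairing n x w) cs) (act M z y) = \<zero>"
    using shifts_act[OF assms(1) c(1)] c(3) wv_act_zero[OF assms(1)] by simp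
  with c show ?thesis
    unfolding low_def using wv_act_closed[OF assms(1) c(1)] by (force intro!: exI[of _ "map (\<lambda>c. c + pairing n x w) cs"])
qed

lemma low_eigen:
  assumes "y \<in> carrier M" "act M (grading_elt n x) y = of_int d \<odot> y" "d < k"
  shows "y \<in> low n M x k"
  unfolding low_def using assms shifts_eigen[OF assms(1,2), of "[d]"] by (auto intro!: exI[of _ "[d]"])

text \<open>On an eigenvector for d the factors act by d - c, nonzero because c < k \<le> d. This
  stands in for the independence of eigenspaces.\<close>

lemma low_eigen_zero:
  assumes "y \<in> low n M x k" "act M (grading_elt n x) y = of_int d \<odot> y" "k \<le> d"
  shows "y = \<zero>"
proof -
  obtain cs where c: "y \<in> carrier M" "\<forall>c\<in>set cs. c < k" "shifts x cs y = \<zero>"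
    using assms(1) unfolding low_def by auto
  have "(\<Prod>c\<leftarrow>cs. d - c) \<noteq> 0"
    using c(2) assms(3) by (induction cs) auto
  then show ?thesis
    using shifts_eigen[OF c(1) assms(2), of cs] c(3) scale_eq_zero_iff[OF c(1)] by (metis of_int_eq_0_iff)
qed

lemma extremalD:
  assumes "extremal n M x nu q v"
  shows "v \<in> part M q" "v \<in> carrier M" "v \<noteq> \<zero>"
    "weight_vector n p w z \<Longrightarrow> pairing n x w > 0 \<Longrightarrow> act M z v = \<zero>"
    "weight_vector n 0 (\<lambda>_. 0) z \<Longrightarrow> act M z v = torus_weight n z nu \<odot> v"
    "act M (grading_elt n x) v = of_int (pairing n x nu) \<odot> v"
  using assms part_closed grading_elt_weight[of n x] grading_elt_torus_weight[of n x nu] unfolding extremal_def by auto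

section \<open>The submodule generated by an extremal vector\<close>

context
  fixes x nu q v
  assumes reg: "regular n x" and ext: "extremal n M x nu q v"
begin

lemma lower_span_carrier: "y \<in> lower_span n M x v \<Longrightarrow> y \<in> carrier M"
  by (induction rule: lower_span.induct) (auto simp: extremalD[OF ext] wv_act_closed)

lemma lower_span_subspace: "lin_subspace (lower_span n M x v)"
  by (rule lin_subspaceI) (auto intro: lower_span_carrier lower_span.intros)

text \<open>Induction with \<open>z\<close> arbitrary: moving \<open>z\<close> past the outermost
  negative root vector leaves a bracket, which is again a weight vector and acts on an element built
  in fewer steps.\<close>

lemma lower_span_wv:
  assumes "y \<in> lower_span n M x v" "weight_vector n p w z"
  shows "act M z y \<in> lower_span n M x v"
  using assms
proof (induction arbitrary: p w z rule: lower_span.induct)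
  case base
  consider "pairing n x w > 0" | "pairing n x w < 0" | "z = 0\<^sub>m (n + n) (n + n)"
    | "pairing n x w = 0" "z \<noteq> 0\<^sub>m (n + n) (n + n)" by linarith
  then show ?case
  proof cases
    case 1
    then show ?thesis using extremalD(4)[OF ext base] lower_span.zero by metis
  next
    case 2
    show ?thesis by (rule lower_span.act[OF base 2 lower_span.base])
  next
    case 3
    then show ?thesis using act_zero_mat extremalD(2)[OF ext] lower_span.zero by metis
  next
    case 4
    \<comment> \<open>Regularity leaves weight zero only, and an odd matrix of weight zero is the
      zero matrix.\<close>
    then have w: "w = (\<lambda>_. 0)" using reg base unfolding regular_def by blast
    have p: "p = 0"
      using weight_vector_odd_zero base 4(2) bit_exhaust[of p] unfolding w by blast
    show ?thesis
      using extremalD(5)[OF ext] base lower_span.intros(1,4) unfolding w p by metis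
  qed
next
  case zero
  then show ?case using wv_act_zero lower_span.zero by metis
next
  case (add y y')
  then show ?case using wv_act_add[OF add(5)] lower_span_carrier lower_span.add by metis
next
  case (scale y c)
  then show ?case using wv_act_scale[OF scale(3)] lower_span_carrier lower_span.scale by metis
next
  case (act p' w' z' y)
  have c: "y \<in> carrier M" using act lower_span_carrier by blast
  have "act M z (act M z' y) = act M (superbracket p p' z z') y \<oplus> koszul_sign p p' \<odot> act M z' (act M z y)"
    by (rule wv_act_comm[OF act(5,1) c])
  moreover have "act M (superbracket p p' z z') y \<in> lower_span n M x v"
    using act(4)[OF weight_vector_superbracket[OF act(5,1)]] .
  moreover have "act M z' (act M z y) \<in> lower_span n M x v"
    using lower_span.act[OF act(1,2) act(4)[OF act(5)]] .
  ultimately show ?case by (metis lower_span.add lower_span.scale)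
qed

lemma lower_span_act:
  assumes "z \<in> periplectic n" "y \<in> lower_span n M x v"
  shows "act M z y \<in> lower_span n M x v"
proof (rule periplectic_induct[OF assms(1)])
  fix z z' assume "z \<in> periplectic n" "z' \<in> periplectic n" "act M z y \<in> lower_span n M x v" "act M z' y \<in> lower_span n M x v"
  then show "act M (z + z') y \<in> lower_span n M x v"
    using add_act lower_span_carrier[OF assms(2)] lower_span.add by metis
qed (rule lower_span_wv[OF assms(2)])

text \<open>The parity r is arbitrary because an odd root vector exchanges the two
  components.\<close>

lemma lower_span_homogeneous:
  assumes "y \<in> lower_span n M x v"
  shows "\<exists>a\<in>lower_span n M x v \<inter> part M r. \<exists>b\<in>lower_span n M x v \<inter> part M (r + 1). y = a \<oplus> b"
  using assms
proof (induction arbitrary: r rule: lower_span.induct)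
  case base
  have z: "\<zero> \<in> lower_span n M x v \<inter> part M s" for s
    using lower_span.zero[of M n x v] lin_subspaceD(2)[OF part_subspace] by blast
  have v: "v \<in> lower_span n M x v \<inter> part M q"
    using lower_span.base[of v n M x] extremalD(1)[OF ext] by blast
  have "r = q \<or> r + 1 = q" using bit_exhaust[of r] bit_exhaust[of q] by auto
  then show ?case
  proof
    assume "r = q"
    with v z[of "r + 1"] extremalD(2)[OF ext] show ?thesis by (intro bexI[of _ v] bexI[of _ \<zero>]) auto
  next
    assume "r + 1 = q"
    with v z[of r] extremalD(2)[OF ext] show ?thesis by (intro bexI[of _ \<zero>] bexI[of _ v]) auto
  qed
next
  case zero
  have z: "\<zero> \<in> lower_span n M x v \<inter> part M s" for s
    using lower_span.zero[of M n x v] lin_subspaceD(2)[OF part_subspace] by blast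
  show ?case using z[of r] z[of "r + 1"] by (intro bexI[of _ \<zero>]) auto
next
  case (add y y')
  obtain a b where ab: "a \<in> lower_span n M x v \<inter> part M r" "b \<in> lower_span n M x v \<inter> part M (r + 1)" "y = a \<oplus> b"
    using add.IH(1) by blast
  obtain a' b' where ab': "a' \<in> lower_span n M x v \<inter> part M r" "b' \<in> lower_span n M x v \<inter> part M (r + 1)" "y' = a' \<oplus> b'"
    using add.IH(2) by blast
  have "a \<oplus> a' \<in> lower_span n M x v \<inter> part M r" "b \<oplus> b' \<in> lower_span n M x v \<inter> part M (r + 1)"
    using ab ab' lower_span.add lin_subspaceD(3)[OF part_subspace] by auto
  moreover have "y \<oplus> y' = (a \<oplus> a') \<oplus> (b \<oplus> b')"
    unfolding ab ab' by (rule add_shuffle) (use ab ab' part_closed in blast)+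
  ultimately show ?case by blast
next
  case (scale y c)
  obtain a b where ab: "a \<in> lower_span n M x v \<inter> part M r" "b \<in> lower_span n M x v \<inter> part M (r + 1)" "y = a \<oplus> b"
    using scale.IH by blast
  then have "c \<odot> a \<in> lower_span n M x v \<inter> part M r" "c \<odot> b \<in> lower_span n M x v \<inter> part M (r + 1)"
    using lower_span.scale lin_subspaceD(4)[OF part_subspace] by auto
  moreover have "c \<odot> y = c \<odot> a \<oplus> c \<odot> b" using ab part_closed by (auto simp: scale_add_right)
  ultimately show ?case by blast
next
  case (act p w z y)
  obtain a b where ab: "a \<in> lower_span n M x v \<inter> part M (p + r)" "b \<in> lower_span n M x v \<inter> part M (p + r + 1)" "y = a \<oplus> b"
    using act.IH[of "p + r"] by blast
  \<comment> \<open>Adding p twice gives back the parity, hence the induction hypothesis at p +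
    r.\<close>
  have e: "p + (p + r) = r" "p + (p + r + 1) = r + 1"
    using bit_exhaust[of p] by (auto simp: add.assoc[symmetric] bit_add_self)
  have "act M z a \<in> part M r" "act M z b \<in> part M (r + 1)"
    using wv_act_part[OF act(1), of a "p + r"] wv_act_part[OF act(1), of b "p + r + 1"] ab unfolding e by auto
  moreover have "act M z a \<in> lower_span n M x v" "act M z b \<in> lower_span n M x v"
    using lower_span.act[OF act(1,2)] ab by auto
  moreover have "act M z y = act M z a \<oplus> act M z b"
    using wv_act_add[OF act(1)] ab part_closed by auto
  ultimately show ?case by blast
qed

text \<open>Pairings are integers, so a negative root vector lowers degrees by at least one: apart
  from the multiple of v itself everything falls below the degree of v.\<close>

lemma lower_span_low:
  assumes "y \<in> lower_span n M x v"
  shows "\<exists>c. \<exists>l\<in>low n M x (pairing n x nu). y = c \<odot> v \<oplus> l"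
  using assms
proof (induction rule: lower_span.induct)
  case base
  then show ?case
    using extremalD(2)[OF ext] lin_subspaceD(2)[OF low_subspace, of x "pairing n x nu"]
    by (intro exI[of _ 1] bexI[of _ \<zero>]) auto
next
  case zero
  then show ?case
    using extremalD(2)[OF ext] lin_subspaceD(2)[OF low_subspace, of x "pairing n x nu"]
    by (intro exI[of _ 0] bexI[of _ \<zero>]) auto
next
  case (add y y')
  then obtain c l c' l' where *: "l \<in> low n M x (pairing n x nu)" "y = c \<odot> v \<oplus> l"
    "l' \<in> low n M x (pairing n x nu)" "y' = c' \<odot> v \<oplus> l'" by blast
  then have "y \<oplus> y' = (c + c') \<odot> v \<oplus> (l \<oplus> l')"
    using extremalD(2)[OF ext] low_carrier by (simp add: scale_add_left add_shuffle)
  then show ?case using * lin_subspaceD(3)[OF low_subspace] by blast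
next
  case (scale y a)
  then obtain c l where *: "l \<in> low n M x (pairing n x nu)" "y = c \<odot> v \<oplus> l" by blast
  then have "a \<odot> y = (a * c) \<odot> v \<oplus> a \<odot> l"
    using extremalD(2)[OF ext] low_carrier by (simp add: scale_add_right scale_scale)
  then show ?case using * lin_subspaceD(4)[OF low_subspace] by blast
next
  case (act p w z y)
  then obtain c l where *: "l \<in> low n M x (pairing n x nu)" "y = c \<odot> v \<oplus> l" by blast
  have vl: "v \<in> low n M x (pairing n x nu + 1)"
    by (rule low_eigen[OF extremalD(2,6)[OF ext]]) auto
  have "y \<in> low n M x (pairing n x nu + 1)"
    unfolding *(2) using vl * low_mono[of "pairing n x nu" "pairing n x nu + 1" x]
    by (intro lin_subspaceD(3,4)[OF low_subspace]) auto
  then have "act M z y \<in> low n M x (pairing n x nu)"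
    using low_act[OF act(1), of y x "pairing n x nu + 1"] act(2)
      low_mono[of "pairing n x nu + 1 + pairing n x w" "pairing n x nu" x] by auto
  then show ?case
    using extremalD(2)[OF ext] low_carrier by (intro exI[of _ 0] bexI[of _ "act M z y"]) auto
qed

lemma lower_span_graded: "graded_submodule (periplectic n) M (lower_span n M x v)"
proof -
  have "lower_span n M x v = (lower_span n M x v \<inter> part M 0) <+> (lower_span n M x v \<inter> part M 1)"
  proof
    show "lower_span n M x v \<subseteq> (lower_span n M x v \<inter> part M 0) <+> (lower_span n M x v \<inter> part M 1)"
      using lower_span_homogeneous[of _ 0] unfolding set_add_def' by fastforce
  qed (auto simp: set_add_def' intro: lower_span.add)
  then show ?thesis
    unfolding graded_submodule_def submodule_iff_lin_subspace using lower_span_subspace lower_span_act by blast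
qed

end

end

section \<open>Simple supermodules and reflections\<close>

locale simple_psupermodule = psupermodule +
  assumes nontrivial: "carrier M \<noteq> {\<zero>}"
    and simple: "graded_submodule (periplectic n) M N \<Longrightarrow> N = {\<zero>} \<or> N = carrier M"

lemma simple_psupermodule_iff: "simple_supermodule n (periplectic n) M \<longleftrightarrow> simple_psupermodule n M"
  unfolding simple_supermodule_def simple_psupermodule_def simple_psupermodule_axioms_def psupermodule_def by blast

text \<open>
  The Borel subalgebras of \<open>x\<close> and \<open>x'\<close> are related by the reflection in \<open>\<alpha>\<close>, where \<open>- \<alpha>\<close> need not
  be a root.
\<close>

definition adjacent :: "nat \<Rightarrow> (nat \<Rightarrow> int) \<Rightarrow> (nat \<Rightarrow> int) \<Rightarrow> (nat \<Rightarrow> int) \<Rightarrow> bool" where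
  "adjacent n x x' \<alpha> \<longleftrightarrow> pairing n x \<alpha> < 0 \<and> pairing n x' \<alpha> > 0 \<and>
     (\<forall>p w z. weight_vector n p w z \<and> z \<noteq> 0\<^sub>m (n + n) (n + n) \<longrightarrow>
       (pairing n x' w > 0 \<longrightarrow> w = \<alpha> \<or> pairing n x w > 0) \<and>
       (pairing n x w > 0 \<longrightarrow> w = (\<lambda>k. - \<alpha> k) \<or> pairing n x' w > 0))"

lemma pairing_add_multiple: "pairing n x (\<lambda>i. nu i + int k * w i) = pairing n x nu + int k * pairing n x w"
  by (simp add: pairing_def distrib_left sum.distrib sum_distrib_left mult.left_commute)

lemma torus_weight_diff:
  assumes "a < n" "b < n" "\<And>i. i < n \<Longrightarrow> z $$ (i, i) = of_bool (i = a) - of_bool (i = b)"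
  shows "torus_weight n z nu = of_int (nu a - nu b)"
proof -
  have "torus_weight n z nu = (\<Sum>i<n. (if i = a then of_int (nu a) else 0) - (if i = b then of_int (nu b) else 0))"
    unfolding torus_weight_def by (intro sum.cong refl) (auto simp: assms(3))
  also have "\<dots> = of_int (nu a - nu b)"
    using assms(1,2) by (simp add: sum_subtractf)
  finally show ?thesis .
qed

context simple_psupermodule
begin

lemma lower_span_eq_carrier:
  assumes "regular n x" "extremal n M x nu q v"
  shows "lower_span n M x v = carrier M"
  using simple[OF lower_span_graded[OF assms]] lower_span.base[of v n M x] extremalD(3)[OF assms(2)] by blast

lemma extremal_decompose:
  assumes "regular n x" "extremal n M x nu q v" "y \<in> carrier M"
  obtains c l where "l \<in> low n M x (pairing n x nu)" "y = c \<odot> v \<oplus> l"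
  using lower_span_low[OF assms(1,2)] assms(3) lower_span_eq_carrier[OF assms(1,2)] by blast

text \<open>The vector v' generates the simple module, so all degrees, also that of v, are at most
  that of v'. Used in the contrapositive: a vector that meets the extremal conditions in a smaller
  degree is zero.\<close>

lemma extremal_pairing_le:
  assumes "regular n x" "extremal n M x nu q v" "extremal n M x nu' q' v'"
  shows "pairing n x nu \<le> pairing n x nu'"
proof (rule ccontr)
  assume "\<not> ?thesis"
  then have lt: "pairing n x nu' < pairing n x nu" by simp
  obtain c l where l: "l \<in> low n M x (pairing n x nu')" "v = c \<odot> v' \<oplus> l"
    using extremal_decompose[OF assms(1,3) extremalD(2)[OF assms(2)]] .
  have "v' \<in> low n M x (pairing n x nu)"
    using low_eigen[OF extremalD(2,6)[OF assms(3)] lt] .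
  moreover have "l \<in> low n M x (pairing n x nu)"
    using l(1) low_mono[of "pairing n x nu'" "pairing n x nu" x] lt by auto
  ultimately have "v \<in> low n M x (pairing n x nu)"
    unfolding l(2) by (intro lin_subspaceD(3,4)[OF low_subspace])
  then have "v = \<zero>"
    using low_eigen_zero[OF _ extremalD(6)[OF assms(2)]] by blast
  then show False using extremalD(3)[OF assms(2)] by blast
qed

section \<open>The root string through an extremal vector\<close>

context
  fixes x x' \<alpha> nu :: "nat \<Rightarrow> int" and q v p e
  assumes reg: "regular n x" and adj: "adjacent n x x' \<alpha>" and ext: "extremal n M x nu q v"
    and e: "weight_vector n p \<alpha> e"
begin

text \<open>The string through v in the direction \<alpha> that changes sign. Exponents 0 and 1
  serve the odd reflections, arbitrary ones the even reflection.\<close>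

abbreviation ladder :: "nat \<Rightarrow> 'a" where
  "ladder k \<equiv> (act M e ^^ k) v"

lemma ladder_closed: "ladder k \<in> carrier M"
  by (induction k) (auto simp: extremalD[OF ext] wv_act_closed[OF e])

lemma ladder_torus:
  assumes z: "weight_vector n 0 (\<lambda>_. 0) z"
  shows "act M z (ladder k) = torus_weight n z (\<lambda>i. nu i + int k * \<alpha> i) \<odot> ladder k"
proof (induction k)
  case 0
  then show ?case using extremalD(5)[OF ext z] by simp
next
  case (Suc k)
  have "act M z (act M e (ladder k)) = act M e (act M z (ladder k)) \<oplus> torus_weight n z \<alpha> \<odot> act M e (ladder k)"
    by (rule act_torus_comm[OF z e ladder_closed])
  also have "\<dots> = (torus_weight n z (\<lambda>i. nu i + int k * \<alpha> i) + torus_weight n z \<alpha>) \<odot> act M e (ladder k)"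
    unfolding Suc using ladder_closed wv_act_closed[OF e] by (simp add: wv_act_scale[OF e] scale_add_left)
  also have "torus_weight n z (\<lambda>i. nu i + int k * \<alpha> i) + torus_weight n z \<alpha> = torus_weight n z (\<lambda>i. nu i + int (Suc k) * \<alpha> i)"
    unfolding torus_weight_add[symmetric] by (simp add: algebra_simps)
  finally show ?case by simp
qed

text \<open>At v itself adjacency makes w positive for x. Moving \<open>z\<close> past
  \<open>e\<close> produces the weight w + \<alpha>, again positive for x' and different from
  \<alpha> because w is nonzero.\<close>

lemma ladder_killed:
  assumes "weight_vector n r w z" "pairing n x' w > 0" "w \<noteq> \<alpha>"
  shows "act M z (ladder k) = \<zero>"
  using assms
proof (induction k arbitrary: r w z)
  case 0
  show ?case
  proof (cases "z = 0\<^sub>m (n + n) (n + n)")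
    case True
    then show ?thesis using act_zero_mat extremalD(2)[OF ext] by simp
  next
    case False
    then have "pairing n x w > 0" using adj 0 unfolding adjacent_def by blast
    then show ?thesis using extremalD(4)[OF ext 0(1)] by simp
  qed
next
  case (Suc k)
  have p: "pairing n x' \<alpha> > 0" using adj unfolding adjacent_def by blast
  have "(\<lambda>i. w i + \<alpha> i) \<noteq> \<alpha>"
  proof
    assume "(\<lambda>i. w i + \<alpha> i) = \<alpha>"
    then have "w = (\<lambda>_. 0)" by (auto simp: fun_eq_iff)
    then show False using Suc(3) by simp
  qed
  then have "act M (superbracket r p z e) (ladder k) = \<zero>"
    using Suc(1)[OF weight_vector_superbracket[OF Suc(2) e]] p Suc(3) by (simp add: pairing_add)
  then show ?case
    using wv_act_comm[OF Suc(2) e ladder_closed, of k] Suc(1)[OF Suc(2-4)] wv_act_zero[OF e] by simp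
qed

text \<open>A root positive for x is -\<alpha> or also positive for x'. If the matrices of weight
  -\<alpha> kill the string element as well, a nonzero one would be extremal for x in a degree below
  that of v.\<close>

lemma ladder_vanishes:
  assumes "k \<ge> 1" "ladder k \<in> part M r"
    and kill: "\<And>r f. weight_vector n r (\<lambda>i. - \<alpha> i) f \<Longrightarrow> act M f (ladder k) = \<zero>"
  shows "ladder k = \<zero>"
proof (rule ccontr)
  assume nz: "ladder k \<noteq> \<zero>"
  have neg: "pairing n x \<alpha> < 0" using adj unfolding adjacent_def by blast
  have "extremal n M x (\<lambda>i. nu i + int k * \<alpha> i) r (ladder k)"
    unfolding extremal_def
  proof (intro conjI allI impI, goal_cases)
    case (3 s w z)
    then have w: "weight_vector n s w z" "pairing n x w > 0" by auto
    show ?case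
    proof (cases "z = 0\<^sub>m (n + n) (n + n)")
      case True
      then show ?thesis using act_zero_mat ladder_closed by simp
    next
      case False
      then have "w = (\<lambda>k. - \<alpha> k) \<or> pairing n x' w > 0"
        using adj w unfolding adjacent_def by blast
      then show ?thesis
      proof
        assume "w = (\<lambda>k. - \<alpha> k)"
        then show ?thesis using kill w(1) by blast
      next
        assume "pairing n x' w > 0"
        moreover have "w \<noteq> \<alpha>" using w(2) neg by auto
        ultimately show ?thesis using ladder_killed[OF w(1)] by blast
      qed
    qed
  qed (use nz assms(2) ladder_torus in auto)
  from extremal_pairing_le[OF reg ext this] show False
    using neg assms(1) by (simp add: pairing_add_multiple mult_less_0_iff not_less[symmetric])
qed

text \<open>Apart from \<alpha>, every root positive for x' is covered by
  \<open>ladder_killed\<close>, so the end of the string is extremal on the other side.\<close>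

lemma ladder_extremal:
  assumes "ladder k \<noteq> \<zero>" "ladder k \<in> part M r"
    and kill: "\<And>r f. weight_vector n r \<alpha> f \<Longrightarrow> act M f (ladder k) = \<zero>"
  shows "extremal n M x' (\<lambda>i. nu i + int k * \<alpha> i) r (ladder k)"
  unfolding extremal_def
proof (intro conjI allI impI, goal_cases)
  case (3 s w z)
  then show ?case using kill ladder_killed[of s w z k] by blast
qed (use assms ladder_torus in auto)

end

section \<open>Odd and even reflections\<close>

text \<open>Only the zero matrix has weight -2 \<epsilon>_a, so the killing condition on f v holds
  trivially and f v vanishes for every f of weight 2 \<epsilon>_a: the string consists of v
  alone.\<close>

lemma reflect_double:
  assumes reg: "regular n x" and ext: "extremal n M x nu q v" and a: "a < n"
    and adj: "adjacent n x x' (\<lambda>k. of_bool (k = a) + of_bool (k = a))"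
  shows "extremal n M x' nu q v"
proof -
  let ?\<alpha> = "\<lambda>k. of_bool (k = a) + of_bool (k = a) :: int"
  have "act M f v = \<zero>" if f: "weight_vector n r ?\<alpha> f" for r f
  proof -
    have "(act M f ^^ 1) v = \<zero>"
    proof (rule ladder_vanishes[OF reg adj ext f])
      show "(act M f ^^ 1) v \<in> part M (r + q)"
        using wv_act_part[OF f extremalD(1)[OF ext]] by simp
      show "act M g ((act M f ^^ 1) v) = \<zero>" if "weight_vector n s (\<lambda>k. - ?\<alpha> k) g" for s g
        using no_weight_vector_neg_double[OF a that] act_zero_mat wv_act_closed[OF f extremalD(2)[OF ext]] by simp
    qed simp
    then show ?thesis by simp
  qed
  then have "extremal n M x' (\<lambda>i. nu i + int 0 * ?\<alpha> i) q ((act M (B_mat n a a) ^^ 0) v)"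
    by (intro ladder_extremal[OF reg adj ext weight_vector_B_mat[OF a a]]) (use extremalD[OF ext] in auto)
  then show ?thesis by simp
qed

lemma act_smult_mat: "weight_vector n p w z \<Longrightarrow> y \<in> carrier M \<Longrightarrow> act M (c \<cdot>\<^sub>m z) y = c \<odot> act M z y"
  using smult_act weight_vector_periplectic by blast

context
  fixes x x' nu :: "nat \<Rightarrow> int" and q v a b
  assumes reg: "regular n x" and ext: "extremal n M x nu q v" and ab: "a < b" "b < n"
    and adj: "adjacent n x x' (\<lambda>k. of_bool (k = a) + of_bool (k = b))"
begin

lemma index_bounds: "a < n" "a \<noteq> b"
  using ab by auto

text \<open>The weight of \<open>C_mat n a b\<close> is -\<alpha>, positive for x, so it kills v and
  only the bracket survives.\<close>

lemma act_C_B: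
  "act M (C_mat n a b) (act M (B_mat n a b) v) = of_int (nu b - nu a) \<odot> v"
proof -
  note B = weight_vector_B_mat[OF index_bounds(1) ab(2)] and C = weight_vector_C_mat[OF index_bounds(1) ab(2)]
  have pos: "pairing n x (\<lambda>k. - of_bool (k = a) - of_bool (k = b)) > 0"
    using adj index_bounds ab unfolding adjacent_def by (simp add: pairing_roots)
  have "weight_vector n (1 + 1) (\<lambda>_. 0) (superbracket 1 1 (C_mat n a b) (B_mat n a b))"
    using weight_vector_superbracket[OF C B] by simp
  then have Z: "weight_vector n 0 (\<lambda>_. 0) (superbracket 1 1 (C_mat n a b) (B_mat n a b))"
    unfolding bit_add_self .
  have "act M (C_mat n a b) (act M (B_mat n a b) v) = act M (superbracket 1 1 (C_mat n a b) (B_mat n a b)) v"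
    using wv_act_comm[OF C B extremalD(2)[OF ext]] extremalD(4)[OF ext C pos] wv_act_zero[OF B]
      wv_act_closed[OF Z extremalD(2)[OF ext]] by simp
  also have "\<dots> = of_int (nu b - nu a) \<odot> v"
    using extremalD(5)[OF ext Z] torus_weight_diff[OF ab(2) index_bounds(1) superbracket_C_B_diag[OF index_bounds(1) ab(2) index_bounds(2)]] by simp
  finally show ?thesis .
qed

text \<open>By \<open>act_C_B\<close> the vector B v is killed by C, and every matrix of weight
  -\<alpha> is a multiple of C; hence B v = 0 and the string ends at v.\<close>

lemma reflect_odd_trivial:
  assumes eq: "nu a = nu b"
  shows "extremal n M x' nu q v"
proof -
  let ?\<alpha> = "\<lambda>k. of_bool (k = a) + of_bool (k = b) :: int"
  note B = weight_vector_B_mat[OF index_bounds(1) ab(2)] and C = weight_vector_C_mat[OF index_bounds(1) ab(2)]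
  have BC: "act M (B_mat n a b) v \<in> carrier M" "act M (C_mat n a b) (act M (B_mat n a b) v) \<in> carrier M"
    using wv_act_closed[OF B] wv_act_closed[OF C] extremalD(2)[OF ext] by auto
  have "act M f v = \<zero>" if f: "weight_vector n r ?\<alpha> f" for r f
  proof -
    have "(act M f ^^ 1) v = \<zero>"
    proof (rule ladder_vanishes[OF reg adj ext f])
      show "(act M f ^^ 1) v \<in> part M (r + q)"
        using wv_act_part[OF f extremalD(1)[OF ext]] by simp
      show "act M g ((act M f ^^ 1) v) = \<zero>" if "weight_vector n s (\<lambda>k. - ?\<alpha> k) g" for s g
      proof -
        have g: "weight_vector n s (\<lambda>k. - of_bool (k = a) - of_bool (k = b)) g"
          using that by (simp add: minus_add_distrib)
        obtain c where c: "f = c \<cdot>\<^sub>m B_mat n a b" using weight_vector_B_eq[OF index_bounds(1) ab(2) f] by blast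
        obtain d where d: "g = d \<cdot>\<^sub>m C_mat n a b" using weight_vector_C_eq[OF index_bounds(1) ab(2) g] by blast
        have "act M g (act M f v) = d \<odot> (c \<odot> act M (C_mat n a b) (act M (B_mat n a b) v))"
          unfolding c d using extremalD(2)[OF ext] BC
          by (simp add: act_smult_mat[OF B] act_smult_mat[OF C] wv_act_scale[OF C])
        also have "\<dots> = \<zero>"
          using act_C_B eq extremalD(2)[OF ext] by simp
        finally show ?thesis by simp
      qed
    qed simp
    then show ?thesis by simp
  qed
  then have "extremal n M x' (\<lambda>i. nu i + int 0 * ?\<alpha> i) q ((act M (B_mat n a b) ^^ 0) v)"
    by (intro ladder_extremal[OF reg adj ext B]) (use extremalD[OF ext] in auto)
  then show ?thesis by simp
qed

text \<open>C B v is a nonzero multiple of v, so B v is nonzero; and B B v = 0 because the odd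
  element B has zero bracket with itself. The string ends after one step.\<close>

lemma reflect_odd:
  assumes neq: "nu a \<noteq> nu b"
  shows "extremal n M x' (\<lambda>k. nu k + of_bool (k = a) + of_bool (k = b)) (q + 1) (act M (B_mat n a b) v)"
proof -
  let ?\<alpha> = "\<lambda>k. of_bool (k = a) + of_bool (k = b) :: int"
  note B = weight_vector_B_mat[OF index_bounds(1) ab(2)] and C = weight_vector_C_mat[OF index_bounds(1) ab(2)]
  have Bv: "act M (B_mat n a b) v \<in> carrier M" "act M (B_mat n a b) (act M (B_mat n a b) v) \<in> carrier M"
    using wv_act_closed[OF B] extremalD(2)[OF ext] by auto
  have "act M (B_mat n a b) v \<noteq> \<zero>"
  proof
    assume "act M (B_mat n a b) v = \<zero>"
    then have "of_int (nu b - nu a) \<odot> v = \<zero>" using act_C_B wv_act_zero[OF C] by simp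
    then show False using extremalD(2,3)[OF ext] neq by (simp add: scale_eq_zero_iff)
  qed
  moreover have "act M (B_mat n a b) v \<in> part M (q + 1)"
    using wv_act_part[OF B extremalD(1)[OF ext]] by (simp only: add.commute)
  moreover have "act M f (act M (B_mat n a b) v) = \<zero>" if f: "weight_vector n r ?\<alpha> f" for r f
  proof -
    obtain c where c: "f = c \<cdot>\<^sub>m B_mat n a b" using weight_vector_B_eq[OF index_bounds(1) ab(2) f] by blast
    have "weight_vector n (1 + 1) (\<lambda>k. ?\<alpha> k + ?\<alpha> k) (superbracket 1 1 (B_mat n a b) (B_mat n a b))"
      by (rule weight_vector_superbracket[OF B B])
    then have "superbracket 1 1 (B_mat n a b) (B_mat n a b) = 0\<^sub>m (n + n) (n + n)"
      unfolding bit_add_self by (rule weight_vector_double_B[OF index_bounds(1) ab(2)])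
    \<comment> \<open>The commutation relation reads B B v = - B B v here, so twice the vector is
      zero.\<close>
    then have "act M (B_mat n a b) (act M (B_mat n a b) v) = (- 1) \<odot> act M (B_mat n a b) (act M (B_mat n a b) v)"
      using wv_act_comm[OF B B extremalD(2)[OF ext]] act_zero_mat[OF extremalD(2)[OF ext]] Bv
      by (simp add: koszul_sign_def)
    then have "(1 + 1) \<odot> act M (B_mat n a b) (act M (B_mat n a b) v) = (- 1 + 1) \<odot> act M (B_mat n a b) (act M (B_mat n a b) v)"
      using Bv by (simp only: scale_add_left scale_one)
    then have "act M (B_mat n a b) (act M (B_mat n a b) v) = \<zero>"
      using Bv scale_eq_zero_iff[OF Bv(2), of 2] by simp
    then show ?thesis unfolding c using Bv by (simp add: act_smult_mat[OF B])
  qed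
  ultimately have "extremal n M x' (\<lambda>i. nu i + int 1 * ?\<alpha> i) (q + 1) ((act M (B_mat n a b) ^^ 1) v)"
    by (intro ladder_extremal[OF reg adj ext B]) auto
  then show ?thesis by (simp add: add.assoc)
qed

end

text \<open>Representation theory of sl(2) with m = \<nu>_a - \<nu>_b: F E^(k+1) v = (k + 1) (m - k)
  E^k v. The factor is nonzero for k < m and zero for k = m, so the string ends exactly at E^m v,
  where the two entries are exchanged.\<close>

lemma reflect_even:
  assumes reg: "regular n x" and ext: "extremal n M x nu q v" and ab: "a < n" "b < n" "a \<noteq> b"
    and adj: "adjacent n x x' (\<lambda>k. of_bool (k = b) - of_bool (k = a))" and ge: "nu a \<ge> nu b"
  shows "\<exists>v'. extremal n M x' (nu(a := nu b, b := nu a)) q v'"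
proof -
  let ?\<alpha> = "\<lambda>k. of_bool (k = b) - of_bool (k = a) :: int"
  let ?E = "E_mat n b a" and ?F = "E_mat n a b"
  note E = weight_vector_E_mat[OF ab(2,1)] and F = weight_vector_E_mat[OF ab(1,2)]
  let ?y = "\<lambda>k. (act M ?E ^^ k) v"
  define m where "m = nat (nu a - nu b)"
  have m: "int m = nu a - nu b" using ge by (simp add: m_def)
  note yc = ladder_closed[OF reg adj ext E]
  have ypart: "?y k \<in> part M q" for k
    using extremalD(1)[OF ext] wv_act_part[OF E, of _ q] by (induction k) (simp_all only: add_0_left funpow.simps o_apply id_apply)
  have pos: "pairing n x (\<lambda>k. of_bool (k = a) - of_bool (k = b)) > 0"
    using adj ab unfolding adjacent_def by (simp add: pairing_roots)
  have "weight_vector n (0 + 0) (\<lambda>_. 0) (superbracket 0 0 ?F ?E)"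
    using weight_vector_superbracket[OF F E] by simp
  then have Z: "weight_vector n 0 (\<lambda>_. 0) (superbracket 0 0 ?F ?E)" by simp
  \<comment> \<open>The bracket of F and E acts on the k-th string element by m - 2 k.\<close>
  have comm: "act M ?F (?y (Suc k)) = of_int (int m - 2 * int k) \<odot> ?y k \<oplus> act M ?E (act M ?F (?y k))" for k
  proof -
    have "act M (superbracket 0 0 ?F ?E) (?y k) = of_int (int m - 2 * int k) \<odot> ?y k"
    proof -
      have "torus_weight n (superbracket 0 0 ?F ?E) (\<lambda>i. nu i + int k * ?\<alpha> i) = of_int (int m - 2 * int k)"
        using torus_weight_diff[OF ab(1,2), of "superbracket 0 0 ?F ?E" "\<lambda>i. nu i + int k * ?\<alpha> i"]
          superbracket_E_E_diag[OF ab] ab(3) m by simp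
      then show ?thesis unfolding ladder_torus[OF reg adj ext E Z] by simp
    qed
    then show ?thesis
      using wv_act_comm[OF F E yc, of k] wv_act_closed[OF E wv_act_closed[OF F yc]] by (simp add: koszul_sign_def)
  qed
  have down: "act M ?F (?y (Suc k)) = of_int ((int k + 1) * (int m - int k)) \<odot> ?y k" for k
  proof (induction k)
    case 0
    have "act M ?F v = \<zero>" using extremalD(4)[OF ext F pos] .
    then show ?case using comm[of 0] extremalD(2)[OF ext] wv_act_zero[OF E] by simp
  next
    case (Suc k)
    have "act M ?F (?y (Suc (Suc k))) = of_int (int m - 2 * int (Suc k)) \<odot> ?y (Suc k)
        \<oplus> of_int ((int k + 1) * (int m - int k)) \<odot> act M ?E (?y k)"
      using comm[of "Suc k"] unfolding Suc wv_act_scale[OF E yc] .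
    also have "\<dots> = (of_int (int m - 2 * int (Suc k)) + of_int ((int k + 1) * (int m - int k))) \<odot> ?y (Suc k)"
      using yc[of "Suc k"] by (simp add: scale_add_left)
    also have "of_int (int m - 2 * int (Suc k)) + of_int ((int k + 1) * (int m - int k)) =
        (of_int ((int (Suc k) + 1) * (int m - int (Suc k))) :: complex)"
      by (simp add: algebra_simps)
    finally show ?case .
  qed
  have nz: "k \<le> m \<Longrightarrow> ?y k \<noteq> \<zero>" for k
  proof (induction k)
    case (Suc k)
    show ?case
    proof
      assume "?y (Suc k) = \<zero>"
      then have "of_int ((int k + 1) * (int m - int k)) \<odot> ?y k = \<zero>"
        using down[of k] wv_act_zero[OF F] by simp
      then have "(of_int ((int k + 1) * (int m - int k)) :: complex) = 0"
        using scale_eq_zero_iff[OF yc] Suc by auto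
      then have "(int k + 1) * (int m - int k) = 0" unfolding of_int_eq_0_iff .
      then show False using Suc(2) by auto
    qed
  qed (use extremalD(3)[OF ext] in auto)
  \<comment> \<open>The factor m - k vanishes at k = m, so F kills the next element and
    \<open>ladder_vanishes\<close> applies.\<close>
  have top: "?y (Suc m) = \<zero>"
  proof (rule ladder_vanishes[OF reg adj ext E _ ypart])
    fix r f assume "weight_vector n r (\<lambda>i. - ?\<alpha> i) f"
    then have f: "weight_vector n r (\<lambda>k. of_bool (k = a) - of_bool (k = b)) f" by (simp add: minus_diff_eq)
    obtain c where c: "f = c \<cdot>\<^sub>m ?F" using weight_vector_E_eq[OF ab(3,1,2) f] by blast
    show "act M f (?y (Suc m)) = \<zero>"
      unfolding c using yc[of "Suc m"] down[of m] yc[of m] by (simp add: act_smult_mat[OF F])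
  qed simp
  have "extremal n M x' (\<lambda>i. nu i + int m * ?\<alpha> i) q (?y m)"
  proof (rule ladder_extremal[OF reg adj ext E nz[OF order_refl] ypart])
    fix r f assume f: "weight_vector n r ?\<alpha> f"
    obtain c where c: "f = c \<cdot>\<^sub>m ?E" using weight_vector_E_eq[OF ab(3)[symmetric] ab(2,1) f] by blast
    show "act M f (?y m) = \<zero>"
      unfolding c using yc[of m] top by (simp add: act_smult_mat[OF E])
  qed
  moreover have "(\<lambda>i. nu i + int m * ?\<alpha> i) = nu(a := nu b, b := nu a)"
    using m ab(3) by (auto simp: fun_eq_iff)
  ultimately show ?thesis by auto
qed

end

section \<open>A path of Borel subalgebras\<close>

text \<open>Lexicographic order of pairs: those before (a, t) are the pairs whose root has already
  changed sign on the path.\<close>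

definition preceding :: "nat \<Rightarrow> nat \<Rightarrow> nat \<Rightarrow> nat \<Rightarrow> bool" where
  "preceding a t i j \<longleftrightarrow> i < a \<or> i = a \<and> j < t"

text \<open>Chambers are described by inequalities because many functionals give the same Borel
  subalgebra. Pairs with i = j are included since the roots 2 \<epsilon>_i are crossed too.\<close>

definition odd_chamber :: "nat \<Rightarrow> nat \<Rightarrow> nat \<Rightarrow> (nat \<Rightarrow> int) \<Rightarrow> bool" where
  "odd_chamber n a t x \<longleftrightarrow> (\<forall>i j. i < j \<and> j < n \<longrightarrow> x i > x j) \<and>
     (\<forall>i j. i \<le> j \<and> j < n \<longrightarrow> (if preceding a t i j then x i + x j > 0 else x i + x j < 0))"

definition even_chamber :: "nat \<Rightarrow> nat \<Rightarrow> nat \<Rightarrow> (nat \<Rightarrow> int) \<Rightarrow> bool" where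
  "even_chamber n a t x \<longleftrightarrow> (\<forall>i<n. x i > 0) \<and>
     (\<forall>i j. i < j \<and> j < n \<longrightarrow> (if preceding a t i j then x i < x j else x i > x j))"

lemma odd_chamberD:
  assumes "odd_chamber n a t x" "j < n"
  shows "i < j \<Longrightarrow> x i > x j" "i \<le> j \<Longrightarrow> preceding a t i j \<Longrightarrow> x i + x j > 0"
    "i \<le> j \<Longrightarrow> \<not> preceding a t i j \<Longrightarrow> x i + x j < 0"
  using assms unfolding odd_chamber_def by simp_all

lemma even_chamberD:
  assumes "even_chamber n a t x" "j < n"
  shows "x j > 0" "i < j \<Longrightarrow> preceding a t i j \<Longrightarrow> x i < x j"
    "i < j \<Longrightarrow> \<not> preceding a t i j \<Longrightarrow> x i > x j"
  using assms unfolding even_chamber_def by simp_all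

lemma odd_chamber_regular:
  assumes "odd_chamber n a t x"
  shows "regular n x"
proof (rule regularI)
  fix i j assume "i < n" "j < n" "i \<noteq> j"
  then show "x i \<noteq> x j"
    using odd_chamberD(1)[OF assms, of i j] odd_chamberD(1)[OF assms, of j i] by (cases "i < j") auto
next
  fix i j assume "i \<le> j" "j < n"
  then show "x i + x j \<noteq> 0"
    using odd_chamberD(2,3)[OF assms, of j i] by (cases "preceding a t i j") auto
qed

lemma even_chamber_regular:
  assumes "even_chamber n a t x"
  shows "regular n x"
proof (rule regularI)
  have "x i \<noteq> x j" if "i < j" "j < n" for i j
    using even_chamberD(2,3)[OF assms that(2) that(1)] by (cases "preceding a t i j") auto
  then show "x i \<noteq> x j" if "i < n" "j < n" "i \<noteq> j" for i j
    using that by (metis nat_neq_iff)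
  show "x i + x j \<noteq> 0" if "i \<le> j" "j < n" for i j
    using even_chamberD(1)[OF assms, of i] even_chamberD(1)[OF assms, of j] that by auto
qed

text \<open>For j > a the entries a and j add up to 2 (t - j) - 1, an odd number which is positive
  exactly for j < t. The entries before a are so large that all sums with them stay
  positive.\<close>

lemma odd_chamber_nonempty:
  assumes "a \<le> t" "t \<le> n" "a < n"
  shows "odd_chamber n a t (\<lambda>i. if i < a then 5 * int n - int i else if i = a then 2 * (int t - int a) - 1
    else - 2 * (int i - int a))"
  unfolding odd_chamber_def preceding_def using assms by (auto split: if_splits)

text \<open>For j > a the entry a minus the entry j is 2 (j - t) + 1, negative exactly for j < t.
  The entries before a are at most n and thus below all later ones.\<close>

lemma even_chamber_nonempty:
  assumes "a < t" "t \<le> n"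
  shows "even_chamber n a t (\<lambda>i. if i < a then int i + 1 else if i = a then 4 * int n - 2 * int t + 1
    else 4 * int n - 2 * int i)"
  unfolding even_chamber_def preceding_def using assms by (auto split: if_splits)

text \<open>Replacing t by t + 1 changes \<open>preceding\<close> at the pair (a, t) alone, so the
  roots of every other pair keep their sign.\<close>

lemma odd_chamber_adjacent:
  assumes x: "odd_chamber n a t x" and x': "odd_chamber n a (Suc t) x'" and t: "a \<le> t" "t < n"
  shows "adjacent n x x' (\<lambda>k. of_bool (k = a) + of_bool (k = t))"
proof -
  have a: "a < n" using t by simp
  have d: "x i > x j" "x' i > x' j" if "i < j" "j < n" for i j
    using x x' that unfolding odd_chamber_def by blast+
  have s: "x i + x j > 0" "x' i + x' j > 0" if "preceding a t i j" "i \<le> j" "j < n" for i j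
  proof -
    have "preceding a (Suc t) i j" using that unfolding preceding_def by auto
    then show "x i + x j > 0" "x' i + x' j > 0" using odd_chamberD(2)[OF x] odd_chamberD(2)[OF x'] that by blast+
  qed
  have s': "x i + x j < 0" "x' i + x' j < 0" if "\<not> preceding a t i j" "i \<le> j" "j < n" "(i, j) \<noteq> (a, t)" for i j
  proof -
    have "\<not> preceding a (Suc t) i j" using that unfolding preceding_def by auto
    then show "x i + x j < 0" "x' i + x' j < 0" using odd_chamberD(3)[OF x] odd_chamberD(3)[OF x'] that by blast+
  qed
  have f: "x a + x t < 0" "x' a + x' t > 0"
    using odd_chamberD(3)[OF x t(2), of a] odd_chamberD(2)[OF x' t(2), of a] t by (simp_all add: preceding_def)
  show ?thesis
    unfolding adjacent_def
  proof (intro conjI allI impI, goal_cases)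
    case 1
    then show ?case using f a t by (simp add: pairing_roots)
  next
    case 2
    then show ?case using f a t by (simp add: pairing_roots)
  next
    case (3 p w z)
    then have z: "weight_vector n p w z" "z \<noteq> 0\<^sub>m (n + n) (n + n)" "pairing n x' w > 0" by auto
    then have "w \<noteq> (\<lambda>_. 0)" by auto
    with z(1,2) show ?case
    proof (cases rule: weight_vector_cases)
      case (E i j c)
      then show ?thesis using d[of i j] d[of j i] z(3) by (cases "i < j") (auto simp: pairing_roots)
    next
      case (B i j c)
      then show ?thesis using s[of i j] s'[of i j] z(3) by (cases "preceding a t i j") (auto simp: pairing_roots)
    next
      case (C i j c)
      show ?thesis
      proof (cases "(i, j) = (a, t)")
        case True
        then show ?thesis using C f z(3) by (simp add: pairing_roots)
      next
        case False
        then show ?thesis using C s[of i j] s'[of i j] z(3) by (cases "preceding a t i j") (auto simp: pairing_roots)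
      qed
    qed
  next
    case (4 p w z)
    then have z: "weight_vector n p w z" "z \<noteq> 0\<^sub>m (n + n) (n + n)" "pairing n x w > 0" by auto
    then have "w \<noteq> (\<lambda>_. 0)" by auto
    with z(1,2) show ?case
    proof (cases rule: weight_vector_cases)
      case (E i j c)
      then show ?thesis using d[of i j] d[of j i] z(3) by (cases "i < j") (auto simp: pairing_roots)
    next
      case (B i j c)
      then show ?thesis using s[of i j] s'[of i j] f z(3) by (cases "preceding a t i j") (auto simp: pairing_roots)
    next
      case (C i j c)
      show ?thesis
      proof (cases "(i, j) = (a, t)")
        case True
        then show ?thesis using C by simp
      next
        case False
        then show ?thesis using C s[of i j] s'[of i j] z(3) by (cases "preceding a t i j") (auto simp: pairing_roots)
      qed
    qed
  qed
qed

lemma even_chamber_adjacent: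
  assumes x: "even_chamber n a t x" and x': "even_chamber n a (Suc t) x'" and t: "a < t" "t < n"
  shows "adjacent n x x' (\<lambda>k. of_bool (k = t) - of_bool (k = a))"
proof -
  have a: "a < n" using t by simp
  have p: "x i > 0" "x' i > 0" if "i < n" for i
    using x x' that unfolding even_chamber_def by blast+
  have s: "x i < x j" "x' i < x' j" if "preceding a t i j" "i < j" "j < n" for i j
  proof -
    have "preceding a (Suc t) i j" using that unfolding preceding_def by auto
    then show "x i < x j" "x' i < x' j" using even_chamberD(2)[OF x] even_chamberD(2)[OF x'] that by blast+
  qed
  have s': "x i > x j" "x' i > x' j" if "\<not> preceding a t i j" "i < j" "j < n" "(i, j) \<noteq> (a, t)" for i j
  proof -
    have "\<not> preceding a (Suc t) i j" using that unfolding preceding_def by auto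
    then show "x i > x j" "x' i > x' j" using even_chamberD(3)[OF x] even_chamberD(3)[OF x'] that by blast+
  qed
  have f: "x a > x t" "x' a < x' t"
    using even_chamberD(3)[OF x t(2), of a] even_chamberD(2)[OF x' t(2), of a] t by (simp_all add: preceding_def)
  show ?thesis
    unfolding adjacent_def
  proof (intro conjI allI impI, goal_cases)
    case 1
    then show ?case using f a t by (simp add: pairing_roots)
  next
    case 2
    then show ?case using f a t by (simp add: pairing_roots)
  next
    case (3 p w z)
    then have z: "weight_vector n p w z" "z \<noteq> 0\<^sub>m (n + n) (n + n)" "pairing n x' w > 0" by auto
    then have "w \<noteq> (\<lambda>_. 0)" by auto
    with z(1,2) show ?case
    proof (cases rule: weight_vector_cases)
      case (E i j c)
      then consider "i < j" "preceding a t i j" | "i < j" "\<not> preceding a t i j" | "j < i" "preceding a t j i"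
        | "j < i" "\<not> preceding a t j i"
        using nat_neq_iff by blast
      then show ?thesis
      proof cases
        case 1
        then show ?thesis using E s[of i j] z(3) by (simp add: pairing_roots)
      next
        case 2
        then show ?thesis using E s'[of i j] z(3) f by (cases "(i, j) = (a, t)") (auto simp: pairing_roots)
      next
        case 3
        then show ?thesis using E s[of j i] by (simp add: pairing_roots)
      next
        case 4
        then show ?thesis using E s'[of j i] z(3) f by (cases "(j, i) = (a, t)") (auto simp: pairing_roots)
      qed
    next
      case (B i j c)
      then show ?thesis using p[of i] p[of j] by (auto simp: pairing_roots)
    next
      case (C i j c)
      then show ?thesis using p[of i] p[of j] z(3) by (auto simp: pairing_roots)
    qed
  next
    case (4 p w z)
    then have z: "weight_vector n p w z" "z \<noteq> 0\<^sub>m (n + n) (n + n)" "pairing n x w > 0" by auto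
    then have "w \<noteq> (\<lambda>_. 0)" by auto
    with z(1,2) show ?case
    proof (cases rule: weight_vector_cases)
      case (E i j c)
      then consider "i < j" "preceding a t i j" | "i < j" "\<not> preceding a t i j" | "j < i" "preceding a t j i"
        | "j < i" "\<not> preceding a t j i"
        using nat_neq_iff by blast
      then show ?thesis
      proof cases
        case 1
        then show ?thesis using E s[of i j] z(3) by (simp add: pairing_roots)
      next
        case 2
        show ?thesis
        proof (cases "(i, j) = (a, t)")
          case True
          then show ?thesis using E by auto
        next
          case False
          then show ?thesis using E 2 s'[of i j] z(3) by (simp add: pairing_roots)
        qed
      next
        case 3
        then show ?thesis using E s[of j i] by (simp add: pairing_roots)
      next
        case 4
        then show ?thesis using E s'[of j i] z(3) f by (cases "(j, i) = (a, t)") (auto simp: pairing_roots)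
      qed
    next
      case (B i j c)
      then show ?thesis using p[of i] p[of j] by (auto simp: pairing_roots)
    next
      case (C i j c)
      then show ?thesis using p[of i] p[of j] z(3) by (auto simp: pairing_roots)
    qed
  qed
qed

text \<open>Roots are sums and differences of coordinates up to sign, and both chambers fix the same
  signs for all of them; extremality is therefore independent of the chosen functional.\<close>

lemma odd_chamber_unique:
  assumes x: "odd_chamber n a t x" and x': "odd_chamber n a' t' x'"
    and eq: "\<And>i j. i \<le> j \<Longrightarrow> j < n \<Longrightarrow> preceding a t i j = preceding a' t' i j"
    and z: "weight_vector n p w z" "z \<noteq> 0\<^sub>m (n + n) (n + n)" and pos: "pairing n x w > 0"
  shows "pairing n x' w > 0"
proof -
  have d: "x i > x j" "x' i > x' j" if "i < j" "j < n" for i j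
    using x x' that unfolding odd_chamber_def by blast+
  have s: "if preceding a t i j then x i + x j > 0 \<and> x' i + x' j > 0 else x i + x j < 0 \<and> x' i + x' j < 0"
    if "i \<le> j" "j < n" for i j
    using odd_chamberD[OF x that(2), of i] odd_chamberD[OF x' that(2), of i] that eq[OF that] by auto
  have "w \<noteq> (\<lambda>_. 0)" using pos by auto
  with z show ?thesis
  proof (cases rule: weight_vector_cases)
    case (E i j c)
    then show ?thesis using d[of i j] d[of j i] pos by (cases "i < j") (auto simp: pairing_roots)
  next
    case (B i j c)
    then show ?thesis using s[of i j] pos by (cases "preceding a t i j") (auto simp: pairing_roots)
  next
    case (C i j c)
    then show ?thesis using s[of i j] pos by (cases "preceding a t i j") (auto simp: pairing_roots)
  qed
qed

section \<open>The weights along the path\<close>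

definition odd_step :: "nat \<Rightarrow> nat \<Rightarrow> (nat \<Rightarrow> int) \<Rightarrow> (nat \<Rightarrow> int)" where
  "odd_step a b nu = (if nu a \<noteq> nu b then (\<lambda>k. nu k + of_bool (k = a) + of_bool (k = b)) else nu)"

text \<open>The list starts at a + 1: the root 2 \<epsilon>_a of the pair (a, a) is crossed as well,
  but leaves the weight unchanged.\<close>

definition odd_stage :: "nat \<Rightarrow> nat \<Rightarrow> (nat \<Rightarrow> int) \<Rightarrow> (nat \<Rightarrow> int)" where
  "odd_stage n a = fold (odd_step a) [a + 1..<n]"

text \<open>The invariant of the even path. On pairs not yet crossed the weight still decreases
  weakly, which makes the length of the next string nonnegative.\<close>

definition monotone_weight :: "nat \<Rightarrow> nat \<Rightarrow> nat \<Rightarrow> (nat \<Rightarrow> int) \<Rightarrow> bool" where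
  "monotone_weight n a t nu \<longleftrightarrow>
     (\<forall>i j. i < j \<and> j < n \<longrightarrow> (if preceding a t i j then nu i \<le> nu j else nu i \<ge> nu j))"

text \<open>A pair meeting position a or t after the exchange is compared through the pair meeting
  the other position before it; the pair (a, t) itself uses \<nu>_a \<ge> \<nu>_t.\<close>

lemma monotone_weight_swap:
  assumes m: "monotone_weight n a t nu" and t: "a < t" "t < n"
  shows "monotone_weight n a (Suc t) (nu(a := nu t, t := nu a))"
proof -
  have le: "nu i \<le> nu j" if "preceding a t i j" "i < j" "j < n" for i j
    using m that unfolding monotone_weight_def by simp
  have ge: "nu i \<ge> nu j" if "\<not> preceding a t i j" "i < j" "j < n" for i j
    using m that unfolding monotone_weight_def by simp
  show ?thesis
    unfolding monotone_weight_def
  proof (intro allI impI, elim conjE)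
    fix i j assume ij: "i < j" "j < n"
    have cs: "i < a \<or> i = a \<or> a < i \<and> i < t \<or> i = t \<or> t < i"
      using t(1) by auto
    consider "i < a" "j = a" | "i < a" "j = t" | "i < a" "j \<noteq> a" "j \<noteq> t" | "i = a" "j < t" | "i = a" "j = t" | "i = a" "j > t"
      | "a < i" "i < t" "j = t" | "a < i" "i < t" "j \<noteq> t" | "i = t" | "i > t"
      using cs nat_neq_iff[of j t] by blast
    then show "if preceding a (Suc t) i j then (nu(a := nu t, t := nu a)) i \<le> (nu(a := nu t, t := nu a)) j
      else (nu(a := nu t, t := nu a)) j \<le> (nu(a := nu t, t := nu a)) i"
    proof cases
      case 1 then show ?thesis using le[of i t] t ij by (auto simp: preceding_def)
    next
      case 2 then show ?thesis using le[of i a] t ij by (auto simp: preceding_def)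
    next
      case 3 then show ?thesis using le[of i j] t ij by (auto simp: preceding_def)
    next
      case 4 then show ?thesis using ge[of j t] t ij by (auto simp: preceding_def)
    next
      case 5 then show ?thesis using ge[of a t] t ij by (auto simp: preceding_def)
    next
      case 6 then show ?thesis using ge[of t j] t ij by (auto simp: preceding_def)
    next
      case 7 then show ?thesis using le[of a i] t ij by (auto simp: preceding_def)
    next
      case 8 then show ?thesis using ge[of i j] t ij by (auto simp: preceding_def)
    next
      case 9 then show ?thesis using ge[of a j] t ij by (auto simp: preceding_def)
    next
      case 10 then show ?thesis using ge[of i j] t ij by (auto simp: preceding_def)
    qed
  qed
qed

context simple_psupermodule
begin

lemma extremal_chamber_cong:
  assumes "extremal n M x nu q v"
    "\<And>p w z. weight_vector n p w z \<Longrightarrow> z \<noteq> 0\<^sub>m (n + n) (n + n) \<Longrightarrow> pairing n x' w > 0 \<Longrightarrow> pairing n x w > 0"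
  shows "extremal n M x' nu q v"
  using assms act_zero_mat[OF extremalD(2)[OF assms(1)]] unfolding extremal_def by blast

text \<open>The parity is kept as the image of a natural number k that counts the moves: the same
  number controls |\<nu>|, which the parity alone would determine only modulo 4.\<close>

lemma odd_step_extremal:
  assumes x: "odd_chamber n a t x" and ext: "extremal n M x nu (of_nat k) v" and t: "a < t" "t < n"
    and x': "odd_chamber n a (Suc t) x'"
  shows "\<exists>k' v'. extremal n M x' (odd_step a t nu) (of_nat k') v' \<and>
    (\<Sum>i<n. odd_step a t nu i) = (\<Sum>i<n. nu i) + 2 * (int k' - int k)"
proof -
  have adj: "adjacent n x x' (\<lambda>k. of_bool (k = a) + of_bool (k = t))"
    using odd_chamber_adjacent[OF x x' _ t(2)] t(1) by simp
  note reg = odd_chamber_regular[OF x]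
  show ?thesis
  proof (cases "nu a = nu t")
    case True
    then show ?thesis
      using reflect_odd_trivial[OF reg ext t adj True] by (intro exI[of _ k] exI[of _ v]) (simp add: odd_step_def)
  next
    case False
    have "extremal n M x' (odd_step a t nu) (of_nat (Suc k)) (act M (B_mat n a t) v)"
      using reflect_odd[OF reg ext t adj False] False unfolding odd_step_def of_nat_Suc by (simp only: add.commute if_True not_False_eq_True)
    moreover have "(\<Sum>i<n. odd_step a t nu i) = (\<Sum>i<n. nu i) + 2"
      using False t by (simp add: odd_step_def sum.distrib of_bool_def)
    ultimately show ?thesis by (intro exI[of _ "Suc k"]) auto
  qed
qed

lemma odd_stage_extremal:
  assumes x: "odd_chamber n a a x" and ext: "extremal n M x nu (of_nat k) v" and a: "a < n"
    and x': "odd_chamber n a n x'"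
  shows "\<exists>k' v'. extremal n M x' (odd_stage n a nu) (of_nat k') v' \<and>
    (\<Sum>i<n. odd_stage n a nu i) = (\<Sum>i<n. nu i) + 2 * (int k' - int k)"
proof -
  \<comment> \<open>Stated for every functional in the chamber: the next reflection starts at an
    explicit one and ends at an arbitrary one.\<close>
  have "\<forall>y. odd_chamber n a t y \<longrightarrow> (\<exists>k' v'. extremal n M y (fold (odd_step a) [a + 1..<t] nu) (of_nat k') v' \<and>
    (\<Sum>i<n. fold (odd_step a) [a + 1..<t] nu i) = (\<Sum>i<n. nu i) + 2 * (int k' - int k))"
    if "Suc a \<le> t" "t \<le> n" for t
    using that
  proof (induction t rule: dec_induct)
    case base
    show ?case
    proof (intro allI impI)
      fix y assume y: "odd_chamber n a (Suc a) y"
      \<comment> \<open>The stage opens with the root 2 \<epsilon>_a, which moves nothing.\<close>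
      have "extremal n M y nu (of_nat k) v"
        by (rule reflect_double[OF odd_chamber_regular[OF x] ext a odd_chamber_adjacent[OF x y order_refl a]])
      then show "\<exists>k' v'. extremal n M y (fold (odd_step a) [a + 1..<Suc a] nu) (of_nat k') v' \<and>
          (\<Sum>i<n. fold (odd_step a) [a + 1..<Suc a] nu i) = (\<Sum>i<n. nu i) + 2 * (int k' - int k)"
        by auto
    qed
  next
    case (step t)
    define y where "y = (\<lambda>i. if i < a then 5 * int n - int i else if i = a then 2 * (int t - int a) - 1
      else - 2 * (int i - int a))"
    have y: "odd_chamber n a t y"
      unfolding y_def by (rule odd_chamber_nonempty) (use step in auto)
    obtain k' v' where *: "extremal n M y (fold (odd_step a) [a + 1..<t] nu) (of_nat k') v'"
      "(\<Sum>i<n. fold (odd_step a) [a + 1..<t] nu i) = (\<Sum>i<n. nu i) + 2 * (int k' - int k)"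
      using step y by (meson Suc_leD)
    show ?case
    proof (intro allI impI)
      fix y' assume y': "odd_chamber n a (Suc t) y'"
      have eq: "fold (odd_step a) [a + 1..<Suc t] nu = odd_step a t (fold (odd_step a) [a + 1..<t] nu)"
        using step(1) by simp
      have "a < t" "t < n" using step by auto
      from odd_step_extremal[OF y *(1) this y'] obtain k'' v''
        where **: "extremal n M y' (fold (odd_step a) [a + 1..<Suc t] nu) (of_nat k'') v''"
        "(\<Sum>i<n. fold (odd_step a) [a + 1..<Suc t] nu i) = (\<Sum>i<n. fold (odd_step a) [a + 1..<t] nu i) + 2 * (int k'' - int k')"
        unfolding eq by blast
      show "\<exists>k' v'. extremal n M y' (fold (odd_step a) [a + 1..<Suc t] nu) (of_nat k') v' \<and>
          (\<Sum>i<n. fold (odd_step a) [a + 1..<Suc t] nu i) = (\<Sum>i<n. nu i) + 2 * (int k' - int k)"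
        using **(1) **(2)[unfolded *(2)] by (intro exI[of _ k''] exI[of _ v'']) auto
    qed
  qed
  from this[of n] x' a show ?thesis unfolding odd_stage_def by simp
qed

lemma odd_path:
  assumes ext: "extremal n M (\<lambda>i. - int i - 1) nu 0 v" and n: "0 < n"
  shows "\<exists>x k v'. odd_chamber n n n x \<and> extremal n M x (fold (odd_stage n) [0..<n] nu) (of_nat k) v' \<and>
    (\<Sum>i<n. fold (odd_stage n) [0..<n] nu i) = (\<Sum>i<n. nu i) + 2 * int k"
proof -
  have "\<exists>x k v'. odd_chamber n a a x \<and> extremal n M x (fold (odd_stage n) [0..<a] nu) (of_nat k) v' \<and>
    (\<Sum>i<n. fold (odd_stage n) [0..<a] nu i) = (\<Sum>i<n. nu i) + 2 * int k" if "a \<le> n" for a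
    using that
  proof (induction a)
    case 0
    \<comment> \<open>This functional is decreasing and negative, so its positive roots are those of
      b_0 and g_(-1).\<close>
    have "odd_chamber n 0 0 (\<lambda>i. - int i - 1)"
      unfolding odd_chamber_def preceding_def by auto
    then show ?case using ext by (intro exI[of _ "\<lambda>i. - int i - 1"] exI[of _ 0] exI[of _ v]) simp
  next
    case (Suc a)
    then obtain x k v' where *: "odd_chamber n a a x" "extremal n M x (fold (odd_stage n) [0..<a] nu) (of_nat k) v'"
      "(\<Sum>i<n. fold (odd_stage n) [0..<a] nu i) = (\<Sum>i<n. nu i) + 2 * int k" by auto
    have a: "a < n" using Suc by simp
    define y where "y = (\<lambda>i. if i < a then 5 * int n - int i else if i = a then 2 * (int n - int a) - 1
      else - 2 * (int i - int a))"
    have y: "odd_chamber n a n y"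
      unfolding y_def by (rule odd_chamber_nonempty) (use a in auto)
    \<comment> \<open>The end of stage a and the start of stage a + 1 are the same chamber, because
      only pairs with i \<le> j count.\<close>
    have y': "odd_chamber n (Suc a) (Suc a) y"
      using y unfolding odd_chamber_def preceding_def by (auto simp: less_Suc_eq)
    obtain k' v'' where "extremal n M y (odd_stage n a (fold (odd_stage n) [0..<a] nu)) (of_nat k') v''"
      "(\<Sum>i<n. odd_stage n a (fold (odd_stage n) [0..<a] nu) i) = (\<Sum>i<n. fold (odd_stage n) [0..<a] nu i) + 2 * (int k' - int k)"
      using odd_stage_extremal[OF *(1,2) a y] by blast
    with y' *(3) show ?case by (intro exI[of _ y] exI[of _ k'] exI[of _ v'']) simp
  qed
  then show ?thesis by blast
qed

text \<open>The final weight is recorded as a weakly increasing rearrangement of \<nu>; these two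
  properties determine its first n entries.\<close>

lemma even_path:
  assumes x: "odd_chamber n n n x" and ext: "extremal n M x nu q v" and n: "0 < n"
    and mono: "\<And>i j. i < j \<Longrightarrow> j < n \<Longrightarrow> nu i \<ge> nu j"
  shows "\<exists>nu' v'. extremal n M (\<lambda>i. int i + 1) nu' q v' \<and> mset (map nu' [0..<n]) = mset (map nu [0..<n]) \<and>
    (\<forall>i j. i < j \<and> j < n \<longrightarrow> nu' i \<le> nu' j)"
proof -
  let ?P = "\<lambda>a t. \<forall>y. even_chamber n a t y \<longrightarrow> (\<exists>nu' v'. extremal n M y nu' q v' \<and>
    mset (map nu' [0..<n]) = mset (map nu [0..<n]) \<and> monotone_weight n a t nu')"
  have stage: "?P a t" if start: "?P a (Suc a)" and "Suc a \<le> t" "t \<le> n" for a t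
    using that(2,3)
  proof (induction t rule: dec_induct)
    case base
    show ?case by (rule start)
  next
    case (step t)
    then have t: "a < t" "t < n" by auto
    define y where "y = (\<lambda>i. if i < a then int i + 1 else if i = a then 4 * int n - 2 * int t + 1
      else 4 * int n - 2 * int i)"
    have y: "even_chamber n a t y"
      unfolding y_def by (rule even_chamber_nonempty) (use t in auto)
    with step obtain nu' v' where *: "extremal n M y nu' q v'" "mset (map nu' [0..<n]) = mset (map nu [0..<n])"
      "monotone_weight n a t nu'" by (meson Suc_leD)
    have ge: "nu' a \<ge> nu' t"
      using *(3) t unfolding monotone_weight_def preceding_def by simp
    have "mset (map (nu'(a := nu' t, t := nu' a)) [0..<n]) = mset (map nu [0..<n])"
    proof -
      have "map (nu'(a := nu' t, t := nu' a)) [0..<n] = (map nu' [0..<n])[a := map nu' [0..<n] ! t, t := map nu' [0..<n] ! a]"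
        using t by (auto intro!: nth_equalityI simp: nth_list_update)
      then show ?thesis using mset_swap[of t "map nu' [0..<n]" a] *(2) t by (simp add: list_update_swap)
    qed
    moreover have "\<exists>v''. extremal n M y' (nu'(a := nu' t, t := nu' a)) q v''" if "even_chamber n a (Suc t) y'" for y'
      using reflect_even[OF even_chamber_regular[OF y] *(1) _ t(2) _ even_chamber_adjacent[OF y that t] ge] t by auto
    ultimately show ?case
      using monotone_weight_swap[OF *(3) t] by blast
  qed
  have "?P a (Suc a)" if "a < n" for a
    using that
  proof (induction a)
    case 0
    show ?case
    proof (intro allI impI)
      fix y assume y: "even_chamber n 0 (Suc 0) y"
      \<comment> \<open>Before any even pair is crossed, the even chamber consists of the decreasing
        positive functionals, which is the last odd chamber.\<close>
      have "odd_chamber n n n y"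
        using y unfolding odd_chamber_def even_chamber_def preceding_def by (auto intro: add_pos_pos)
      then have "extremal n M y nu q v"
        by (intro extremal_chamber_cong[OF ext] odd_chamber_unique[OF _ x]) auto
      moreover have "monotone_weight n 0 (Suc 0) nu"
        using mono unfolding monotone_weight_def preceding_def by auto
      ultimately show "\<exists>nu' v'. extremal n M y nu' q v' \<and>
        mset (map nu' [0..<n]) = mset (map nu [0..<n]) \<and> monotone_weight n 0 (Suc 0) nu'" by blast
    qed
  next
    case (Suc a)
    have P: "?P a n" using stage[OF _ _ order_refl, of a] Suc by simp
    show ?case
    proof (intro allI impI)
      fix y assume "even_chamber n (Suc a) (Suc (Suc a)) y"
      \<comment> \<open>Here too the last chamber of one stage is the first of the next.\<close>
      then have "even_chamber n a n y"
        unfolding even_chamber_def preceding_def by (auto simp: less_Suc_eq)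
      with P obtain nu' v' where "extremal n M y nu' q v'" "mset (map nu' [0..<n]) = mset (map nu [0..<n])"
        "monotone_weight n a n nu'" by blast
      moreover from this(3) have "monotone_weight n (Suc a) (Suc (Suc a)) nu'"
        unfolding monotone_weight_def preceding_def by (auto simp: less_Suc_eq)
      ultimately show "\<exists>nu' v'. extremal n M y nu' q v' \<and>
        mset (map nu' [0..<n]) = mset (map nu [0..<n]) \<and> monotone_weight n (Suc a) (Suc (Suc a)) nu'" by blast
    qed
  qed
  from this[of "n - 1"] have "?P (n - 1) n" using n by simp
  moreover have "even_chamber n (n - 1) n (\<lambda>i. int i + 1)"
    unfolding even_chamber_def preceding_def by auto
  ultimately obtain nu' v' where "extremal n M (\<lambda>i. int i + 1) nu' q v'"
    "mset (map nu' [0..<n]) = mset (map nu [0..<n])" "monotone_weight n (n - 1) n nu'" by blast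
  moreover have "preceding (n - 1) n i j" if "i < j" "j < n" for i j
    using that by (auto simp: preceding_def)
  with calculation(3) have "\<forall>i j. i < j \<and> j < n \<longrightarrow> nu' i \<le> nu' j"
    unfolding monotone_weight_def by auto
  ultimately show ?thesis by blast
qed

end

section \<open>Combinatorics of the weight diagrams\<close>

definition descending :: "nat \<Rightarrow> (nat \<Rightarrow> int) \<Rightarrow> bool" where
  "descending n nu \<longleftrightarrow> (\<forall>i j. i < j \<and> j < n \<longrightarrow> nu i \<ge> nu j)"

lemma descendingD: "descending n nu \<Longrightarrow> i \<le> j \<Longrightarrow> j < n \<Longrightarrow> nu i \<ge> nu j"
  unfolding descending_def by (cases "i = j") auto

definition ball_position :: "nat \<Rightarrow> (nat \<Rightarrow> int) \<Rightarrow> nat \<Rightarrow> int" where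
  "ball_position n nu i = nu i + int n - 1 - int i"

lemma dominant_iff_descending: "map nu [0..<n] \<in> dominant_weights n \<longleftrightarrow> descending n nu"
  unfolding dominant_weights_def descending_def by (auto simp: sorted_wrt_iff_nth_less)

lemma diagram_map: "diagram (map nu [0..<n]) = ball_position n nu ` {..<n}"
proof (intro equalityI subsetI)
  fix p assume "p \<in> ball_position n nu ` {..<n}"
  then obtain i where "i < n" "p = ball_position n nu i" by auto
  then show "p \<in> diagram (map nu [0..<n])"
    unfolding diagram_def by (auto simp: ball_position_def intro!: exI[of _ i])
qed (auto simp: diagram_def ball_position_def)

lemma ball_strict: "descending n nu \<Longrightarrow> i < j \<Longrightarrow> j < n \<Longrightarrow> ball_position n nu i > ball_position n nu j"
  using descendingD[of n nu i j] by (simp add: ball_position_def)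

lemma ball_inj: "descending n nu \<Longrightarrow> i < n \<Longrightarrow> j < n \<Longrightarrow> ball_position n nu i = ball_position n nu j \<longleftrightarrow> i = j"
  using ball_strict[of n nu i j] ball_strict[of n nu j i] by (cases i j rule: linorder_cases) auto

lemma sorted_diagram:
  assumes "descending n nu"
  shows "rev (sorted_list_of_set (diagram (map nu [0..<n]))) = map (ball_position n nu) [0..<n]"
proof -
  have "sorted_wrt (<) (rev (map (ball_position n nu) [0..<n]))"
    unfolding sorted_wrt_rev unfolding sorted_wrt_iff_nth_less using ball_strict[OF assms] by auto
  moreover have "set (rev (map (ball_position n nu) [0..<n])) = diagram (map nu [0..<n])"
    unfolding diagram_map by auto
  ultimately have "sorted_list_of_set (diagram (map nu [0..<n])) = rev (map (ball_position n nu) [0..<n])"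
    by (intro strict_sorted_equal) (auto simp: diagram_map)
  then show ?thesis by simp
qed

lemma ball_pos_diagram:
  assumes "descending n nu" "a < n"
  shows "ball_pos (diagram (map nu [0..<n])) (Suc a) = ball_position n nu a"
  unfolding ball_pos_def sorted_diagram[OF assms(1)] using assms(2) by simp

lemma weight_of_diagram_eq:
  assumes "descending n nu"
  shows "weight_of_diagram n (diagram (map nu [0..<n])) = map nu [0..<n]"
  unfolding weight_of_diagram_def
proof (rule the_equality)
  show "map nu [0..<n] \<in> dominant_weights n \<and> diagram (map nu [0..<n]) = diagram (map nu [0..<n])"
    using assms dominant_iff_descending by blast
  fix l assume l: "l \<in> dominant_weights n \<and> diagram l = diagram (map nu [0..<n])"
  then have len: "length l = n" by (simp add: dominant_weights_def)
  have eq: "l = map ((!) l) [0..<n]" using len map_nth by metis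
  have d: "descending n ((!) l)" using l eq dominant_iff_descending by metis
  have "map (ball_position n ((!) l)) [0..<n] = map (ball_position n nu) [0..<n]"
    using sorted_diagram[OF d] sorted_diagram[OF assms] l eq by metis
  then have "\<forall>i<n. l ! i = nu i" by (simp add: ball_position_def)
  then show "l = map nu [0..<n]" using len by (intro nth_equalityI) auto
qed

text \<open>The diagram rule asks for empty positions, the weight rule for \<nu>_a \<noteq> \<nu>_b.
  If the entries agree, ball b is blocked by ball b - 1. If they differ, dominance of the new weight
  says that the moved balls meet no other ball.\<close>

lemma move_eq_odd_step:
  assumes d: "descending n nu" and d': "descending n (odd_step a b nu)" and ab: "a < b" "b < n"
  shows "move n (Suc a) (Suc b) (map nu [0..<n]) = map (odd_step a b nu) [0..<n]"
proof -
  let ?S = "diagram (map nu [0..<n])"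
  have a: "a < n" using ab by simp
  note pos = ball_pos_diagram[OF d a] ball_pos_diagram[OF d ab(2)]
  show ?thesis
  proof (cases "nu a = nu b")
    case True
    \<comment> \<open>Squeezed between the equal entries a and b.\<close>
    have "nu (b - 1) = nu b"
      using descendingD[OF d, of a "b - 1"] descendingD[OF d, of "b - 1" b] ab True by auto
    then have "ball_position n nu b + 1 = ball_position n nu (b - 1)" using ab by (simp add: ball_position_def of_nat_diff)
    then have "ball_position n nu b + 1 \<in> ?S" unfolding diagram_map using ab by auto
    then show ?thesis
      unfolding move_def Let_def pos using True by (simp add: odd_step_def)
  next
    case False
    let ?nu = "odd_step a b nu"
    have lt: "nu a > nu b" using False descendingD[OF d, of a b] ab by auto
    have same: "ball_position n ?nu i = ball_position n nu i" if "i \<noteq> a" "i \<noteq> b" for i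
      using that False by (simp add: odd_step_def ball_position_def)
    have up: "ball_position n ?nu a = ball_position n nu a + 1" "ball_position n ?nu b = ball_position n nu b + 1"
      using False ab by (auto simp: odd_step_def ball_position_def)
    \<comment> \<open>The two moving balls cannot block each other.\<close>
    have far: "ball_position n nu b + 1 < ball_position n nu a"
      using lt ab by (simp add: ball_position_def)
    have na: "ball_position n nu a + 1 \<notin> ?S"
    proof
      assume "ball_position n nu a + 1 \<in> ?S"
      then obtain i where i: "i < n" "ball_position n nu a + 1 = ball_position n nu i" unfolding diagram_map by auto
      then have "i \<noteq> a" "i \<noteq> b" using far by auto
      then show False using ball_inj[OF d' i(1) a] i up(1) same by auto
    qed
    have nb: "ball_position n nu b + 1 \<notin> ?S"
    proof
      assume "ball_position n nu b + 1 \<in> ?S"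
      then obtain i where i: "i < n" "ball_position n nu b + 1 = ball_position n nu i" unfolding diagram_map by auto
      then have "i \<noteq> a" "i \<noteq> b" using far by auto
      then show False using ball_inj[OF d' i(1) ab(2)] i up(2) same by auto
    qed
    have "(?S - {ball_position n nu a, ball_position n nu b}) \<union> {ball_position n nu a + 1, ball_position n nu b + 1} = diagram (map ?nu [0..<n])"
    proof (intro equalityI subsetI)
      fix p assume "p \<in> (?S - {ball_position n nu a, ball_position n nu b}) \<union> {ball_position n nu a + 1, ball_position n nu b + 1}"
      then consider i where "i < n" "p = ball_position n nu i" "i \<noteq> a" "i \<noteq> b" | "p = ball_position n ?nu a" | "p = ball_position n ?nu b"
        unfolding diagram_map up by auto
      then show "p \<in> diagram (map ?nu [0..<n])"
        unfolding diagram_map using a ab(2) by cases (auto simp: same[symmetric])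
    next
      fix p assume "p \<in> diagram (map ?nu [0..<n])"
      then obtain i where i: "i < n" "p = ball_position n ?nu i" unfolding diagram_map by auto
      show "p \<in> (?S - {ball_position n nu a, ball_position n nu b}) \<union> {ball_position n nu a + 1, ball_position n nu b + 1}"
      proof (cases "i = a \<or> i = b")
        case True
        then show ?thesis using i up by auto
      next
        case False
        then show ?thesis
          using i same ball_inj[OF d i(1) a] ball_inj[OF d i(1) ab(2)] unfolding diagram_map by auto
      qed
    qed
    then show ?thesis
      unfolding move_def Let_def pos using na nb weight_of_diagram_eq[OF d'] by simp
  qed
qed

section \<open>Dominance throughout the lexicographic moves\<close>

text \<open>Its size is the number of moves that ball a has made in its stage when the pair (a, t)
  is reached.\<close>

definition smaller_after :: "(nat \<Rightarrow> int) \<Rightarrow> nat \<Rightarrow> nat \<Rightarrow> nat set" where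
  "smaller_after nu a t = {j. a < j \<and> j < t \<and> nu j < nu a}"

lemma finite_smaller_after [simp]: "finite (smaller_after nu a t)"
  by (rule finite_subset[of _ "{..<t}"]) (auto simp: smaller_after_def)

text \<open>The state of stage \<open>a\<close> after the pairs \<open>(a, b)\<close> with \<open>b < t\<close> have been processed.\<close>

definition stage_state :: "(nat \<Rightarrow> int) \<Rightarrow> nat \<Rightarrow> nat \<Rightarrow> nat \<Rightarrow> int" where
  "stage_state nu a t k = (if k = a then nu a + int (card (smaller_after nu a t))
     else if a < k \<and> k < t then nu k + of_bool (nu k < nu a) else nu k)"

text \<open>The gap which leaves room for all moves of the ball \<open>a\<close> during its stage.\<close>

definition stage_ready :: "nat \<Rightarrow> (nat \<Rightarrow> int) \<Rightarrow> nat \<Rightarrow> bool" where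
  "stage_ready n nu a \<longleftrightarrow> (\<forall>i<a. nu i \<ge> nu a + int (card (smaller_after nu a n)))"

text \<open>The test uses the current entry at a, which may have grown, but it agrees with comparing
  the original entries: if \<nu>_t = \<nu>_a, then by monotonicity no earlier j > a had a smaller
  entry, and a has not moved.\<close>

lemma fold_odd_step:
  assumes d: "descending n nu" and "Suc a \<le> t" "t \<le> n"
  shows "fold (odd_step a) [Suc a..<t] nu = stage_state nu a t"
  using assms(2,3)
proof (induction t rule: dec_induct)
  case base
  have "smaller_after nu a (Suc a) = {}" by (auto simp: smaller_after_def)
  then show ?case by (auto simp: stage_state_def fun_eq_iff)
next
  case (step t)
  have t: "a < t" "t < n" using step by auto
  have "odd_step a t (stage_state nu a t) = stage_state nu a (Suc t)"
  proof (cases "nu t < nu a")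
    case True
    have "smaller_after nu a (Suc t) = insert t (smaller_after nu a t)" "t \<notin> smaller_after nu a t"
      using True t by (auto simp: smaller_after_def)
    then show ?thesis
      using True t by (auto simp: odd_step_def stage_state_def fun_eq_iff less_Suc_eq)
  next
    case False
    have "smaller_after nu a s = {}" if "s \<le> Suc t" for s
    proof -
      have "\<not> nu j < nu a" if "j \<le> t" for j
        using descendingD[OF d that t(2)] False by linarith
      then show ?thesis using that by (auto simp: smaller_after_def)
    qed
    moreover have "nu t = nu a" using descendingD[OF d, of a t] False t by simp
    ultimately show ?thesis
      using t by (auto simp: odd_step_def stage_state_def fun_eq_iff less_Suc_eq)
  qed
  then show ?case using step t by simp
qed

text \<open>By readiness an earlier entry is at least every value that entry a reaches. A later
  entry moves by one only if it is below \<nu>_a, and an unmoved entry between a and it is then at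
  least \<nu>_a.\<close>

lemma stage_state_descending:
  assumes d: "descending n nu" and r: "stage_ready n nu a" and a: "a < n" and t: "t \<le> n"
  shows "descending n (stage_state nu a t)"
  unfolding descending_def
proof (intro allI impI, elim conjE)
  fix i j assume ij: "i < j" "j < n"
  have c: "card (smaller_after nu a t) \<le> card (smaller_after nu a n)"
    by (rule card_mono) (use t in \<open>auto simp: smaller_after_def\<close>)
  have le: "nu j \<le> nu i" using descendingD[OF d] ij by simp
  consider "i = a" | "a < i" | "i < a" "j = a" | "i < a" "j \<noteq> a" by linarith
  then show "stage_state nu a t j \<le> stage_state nu a t i"
  proof cases
    case 1
    then show ?thesis using ij le by (auto simp: stage_state_def)
  next
    case 2
    then show ?thesis using ij le descendingD[OF d, of a i] by (auto simp: stage_state_def)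
  next
    case 3
    have "nu a + int (card (smaller_after nu a n)) \<le> nu i" using r 3 unfolding stage_ready_def by blast
    then show ?thesis using 3 c by (auto simp: stage_state_def)
  next
    case 4
    then show ?thesis using ij le descendingD[OF d, of i a] a by (auto simp: stage_state_def)
  qed
qed

text \<open>If \<nu>_(a+1) < \<nu>_a, then all later entries are smaller and ball a has moved once
  for each of them, at least as often as ball a + 1 can. If the two agree, every entry below the new
  entry a + 1 was already below \<nu>_a.\<close>

lemma stage_ready_Suc:
  assumes d: "descending n nu" and r: "stage_ready n nu a" and a: "Suc a < n"
  shows "stage_ready n (stage_state nu a n) (Suc a)"
proof -
  let ?g = "stage_state nu a n"
  have an: "a < n" using a by simp
  have top: "?g a \<ge> ?g (Suc a) + int (card (smaller_after ?g (Suc a) n))"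
  proof (cases "nu (Suc a) < nu a")
    case True
    have "smaller_after nu a n = {a<..<n}"
    proof -
      have "nu j < nu a" if "a < j" "j < n" for j
        using descendingD[OF d, of "Suc a" j] that True by simp
      then show ?thesis by (auto simp: smaller_after_def)
    qed
    moreover have "smaller_after ?g (Suc a) n \<subseteq> {a<..<n}" by (auto simp: smaller_after_def)
    ultimately have "card (smaller_after ?g (Suc a) n) \<le> card (smaller_after nu a n)"
      by (metis card_mono finite_greaterThanLessThan)
    then show ?thesis using True a by (simp add: stage_state_def)
  next
    case False
    then have eq: "nu (Suc a) = nu a" using descendingD[OF d, of a "Suc a"] a by simp
    then have g: "?g (Suc a) = nu a" using a by (simp add: stage_state_def)
    have "smaller_after ?g (Suc a) n \<subseteq> smaller_after nu a n"
      using g by (auto simp: smaller_after_def stage_state_def split: if_splits)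
    then have "card (smaller_after ?g (Suc a) n) \<le> card (smaller_after nu a n)"
      by (intro card_mono) auto
    then show ?thesis using g by (simp add: stage_state_def)
  qed
  show ?thesis
    unfolding stage_ready_def
  proof (intro allI impI)
    fix i assume "i < Suc a"
    then have "?g i \<ge> ?g a"
      using descendingD[OF stage_state_descending[OF d r an order_refl], of i a] an by simp
    then show "?g i \<ge> ?g (Suc a) + int (card (smaller_after ?g (Suc a) n))" using top by simp
  qed
qed

lemma odd_stage_eq:
  assumes "descending n nu" "a < n"
  shows "odd_stage n a nu = stage_state nu a n"
  unfolding odd_stage_def using fold_odd_step[OF assms(1), of a n] assms(2) by simp

text \<open>Balls are numbered from 1 and weight entries from 0, which accounts for the successors.
  \<open>move_eq_odd_step\<close> applies each time because all intermediate states of the stage are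
  dominant.\<close>

lemma move_stage:
  assumes d: "descending n nu" and r: "stage_ready n nu a" and a: "a < n"
  shows "fold (\<lambda>(a, b). move n a b) (map (Pair (Suc a)) [Suc a + 1..<n + 1]) (map nu [0..<n]) =
    map (odd_stage n a nu) [0..<n]"
proof -
  have "fold (\<lambda>(a, b). move n a b) (map (Pair (Suc a)) (map Suc [Suc a..<t])) (map nu [0..<n]) =
    map (fold (odd_step a) [Suc a..<t] nu) [0..<n]" if "Suc a \<le> t" "t \<le> n" for t
    using that
  proof (induction t rule: dec_induct)
    case (step t)
    have e: "fold (odd_step a) [Suc a..<t] nu = stage_state nu a t"
      by (rule fold_odd_step[OF d]) (use step in auto)
    have e': "odd_step a t (stage_state nu a t) = stage_state nu a (Suc t)"
      using fold_odd_step[OF d, of a "Suc t"] e step by simp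
    have "move n (Suc a) (Suc t) (map (stage_state nu a t) [0..<n]) = map (odd_step a t (stage_state nu a t)) [0..<n]"
      by (rule move_eq_odd_step) (use step stage_state_descending[OF d r a] e' in auto)
    with step e show ?case by simp
  qed simp
  from this[of n] a show ?thesis
    unfolding odd_stage_def by (simp add: map_Suc_upt)
qed

lemma fold_concat_map: "fold f (concat (map g xs)) s = fold (\<lambda>x. fold f (g x)) xs s"
  by (induction xs arbitrary: s) auto

text \<open>Dominance and readiness together are the invariant over the stages; for stage 0
  readiness is vacuous.\<close>

lemma weight_dagger_eq:
  assumes d: "descending n nu"
  shows "weight_dagger n (map nu [0..<n]) = map (fold (odd_stage n) [0..<n] nu) [0..<n]"
    "descending n (fold (odd_stage n) [0..<n] nu)"
proof -
  let ?f = "\<lambda>a. fold (\<lambda>(a, b). move n a b) (map (Pair (Suc a)) [Suc a + 1..<n + 1])"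
  have main: "fold ?f [0..<a] (map nu [0..<n]) = map (fold (odd_stage n) [0..<a] nu) [0..<n] \<and>
    descending n (fold (odd_stage n) [0..<a] nu) \<and> (a < n \<longrightarrow> stage_ready n (fold (odd_stage n) [0..<a] nu) a)"
    if "a \<le> n" for a
    using that
  proof (induction a)
    case 0
    then show ?case using d by (simp add: stage_ready_def)
  next
    case (Suc a)
    let ?nu = "fold (odd_stage n) [0..<a] nu"
    have IH: "fold ?f [0..<a] (map nu [0..<n]) = map ?nu [0..<n]" "descending n ?nu" "stage_ready n ?nu a" and a: "a < n"
      using Suc by auto
    have e: "odd_stage n a ?nu = stage_state ?nu a n" by (rule odd_stage_eq[OF IH(2) a])
    have "fold ?f [0..<Suc a] (map nu [0..<n]) = ?f a (fold ?f [0..<a] (map nu [0..<n]))" by simp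
    also have "\<dots> = map (odd_stage n a ?nu) [0..<n]" unfolding IH(1) by (rule move_stage[OF IH(2,3) a])
    finally show ?case
      using stage_state_descending[OF IH(2,3) a order_refl] stage_ready_Suc[OF IH(2,3)] e by auto
  qed
  have "weight_dagger n (map nu [0..<n]) =
    fold (\<lambda>a. fold (\<lambda>(a, b). move n a b) (map (Pair a) [a + 1..<n + 1])) (map Suc [0..<n]) (map nu [0..<n])"
    unfolding weight_dagger_def fold_concat_map by (simp add: map_Suc_upt)
  also have "\<dots> = fold ?f [0..<n] (map nu [0..<n])"
    by (simp add: fold_map o_def)
  finally show "weight_dagger n (map nu [0..<n]) = map (fold (odd_stage n) [0..<n] nu) [0..<n]"
    using main[of n] by simp
  show "descending n (fold (odd_stage n) [0..<n] nu)" using main[of n] by simp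
qed

text \<open>The reflection sends the ball of entry i, at position \<mu>_i + n - 1 - i, to i -
  \<mu>_i, which is the position of the entry -\<mu>_i at index n - 1 - i.\<close>

lemma weight_sharp_eq:
  assumes d: "descending n nu"
  shows "weight_sharp n (map nu [0..<n]) = map (\<lambda>i. - fold (odd_stage n) [0..<n] nu (n - 1 - i)) [0..<n]"
proof -
  let ?mu = "fold (odd_stage n) [0..<n] nu"
  let ?sh = "\<lambda>i. - ?mu (n - 1 - i)"
  have d': "descending n ?sh"
    unfolding descending_def using descendingD[OF weight_dagger_eq(2)[OF d]] by auto
  have b: "ball_position n ?sh i = int n - 1 - ball_position n ?mu (n - 1 - i)" if "i < n" for i
    using that by (simp add: ball_position_def of_nat_diff)
  have "(\<lambda>x. int n - 1 - x) ` diagram (map ?mu [0..<n]) = diagram (map ?sh [0..<n])"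
  proof (intro equalityI subsetI)
    fix p assume "p \<in> (\<lambda>x. int n - 1 - x) ` diagram (map ?mu [0..<n])"
    then obtain i where "i < n" "p = int n - 1 - ball_position n ?mu i" unfolding diagram_map by auto
    then have "p = ball_position n ?sh (n - 1 - i)" "n - 1 - i < n" using b[of "n - 1 - i"] by auto
    then show "p \<in> diagram (map ?sh [0..<n])" unfolding diagram_map by blast
  next
    fix p assume "p \<in> diagram (map ?sh [0..<n])"
    then obtain i where "i < n" "p = int n - 1 - ball_position n ?mu (n - 1 - i)" unfolding diagram_map using b by auto
    then show "p \<in> (\<lambda>x. int n - 1 - x) ` diagram (map ?mu [0..<n])" unfolding diagram_map by auto
  qed
  then show ?thesis
    unfolding weight_sharp_def weight_dagger_eq(1)[OF d] using weight_of_diagram_eq[OF d'] by simp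
qed

section \<open>The dual supermodule\<close>

text \<open>Parities are kept in the form p + q, in which the degree rules are stated.\<close>

declare add_bit_eq_xor [simp del]

lemma hom_comp_hom_part:
  assumes "x \<in> periplectic n"
  shows "hom_comp n p x \<in> hom_part n (periplectic n) p"
proof -
  have c: "x \<in> carrier_mat (n + n) (n + n)" using assms periplectic_carrier by blast
  show ?thesis
    unfolding hom_comp_eq[OF c]
  proof (rule hom_partI)
    fix i j assume ij: "i < n" "j < n"
    note D = periplecticD[OF assms ij]
    let ?y = "mat (n + n) (n + n) (\<lambda>(i, j). if (p = 0) = ((i < n) = (j < n)) then x $$ (i, j) else 0)"
    show "?y $$ (n + i, n + j) = - ?y $$ (j, i)" "?y $$ (i, n + j) = ?y $$ (j, n + i)"
      using ij D(1,2) by auto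
    show "?y $$ (n + i, j) = - ?y $$ (n + j, i)"
      using ij by (simp, subst D(3), simp)
    show "p \<noteq> 0 \<Longrightarrow> ?y $$ (i, j) = 0" "p = 0 \<Longrightarrow> ?y $$ (i, n + j) = 0 \<and> ?y $$ (n + i, j) = 0"
      using ij by auto
  qed simp
qed

lemma hom_comp_add:
  assumes "x \<in> carrier_mat (n + n) (n + n)" "y \<in> carrier_mat (n + n) (n + n)"
  shows "hom_comp n p (x + y) = hom_comp n p x + hom_comp n p y"
  using assms by (auto simp: hom_comp_eq intro!: eq_matI)

lemma hom_comp_smult:
  assumes "x \<in> carrier_mat (n + n) (n + n)"
  shows "hom_comp n p (c \<cdot>\<^sub>m x) = c \<cdot>\<^sub>m hom_comp n p x"
  using assms by (auto simp: hom_comp_eq intro!: eq_matI)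

lemma hom_comp_self: "x \<in> hom_part n g p \<Longrightarrow> hom_comp n p x = x"
  by (simp add: hom_part_def)

lemma hom_comp_other:
  assumes "x \<in> hom_part n (periplectic n) p" "p \<noteq> q"
  shows "hom_comp n q x = 0\<^sub>m (n + n) (n + n)"
proof -
  have c: "x \<in> carrier_mat (n + n) (n + n)" using hom_part_carrier[OF assms(1)] .
  have q: "(q = 0) = (p \<noteq> 0)" using assms(2) bit_exhaust[of p] bit_exhaust[of q] by auto
  have z: "(if (q = 0) = ((i < n) = (j < n)) then x $$ (i, j) else 0) = 0" if "i < n + n" "j < n + n" for i j
    using assms(1) that unfolding hom_part_periplectic_iff q by (cases "(p = 0) = ((i < n) = (j < n))") auto
  show ?thesis
    unfolding hom_comp_eq[OF c] by (rule eq_matI) (simp_all add: z)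
qed

lemma hom_comp_sum:
  assumes "x \<in> carrier_mat (n + n) (n + n)"
  shows "hom_comp n 0 x + hom_comp n 1 x = x"
  using assms by (auto simp: hom_comp_eq intro!: eq_matI)

section \<open>Parity projections and the sign twist\<close>

context psupermodule
begin

lemma proj_eq:
  assumes "u \<in> part M q" "w \<in> part M (q + 1)"
  shows "proj M q (u \<oplus> w) = u"
  unfolding proj_def
proof (rule the_equality)
  have "q \<noteq> q + 1" by (cases q) auto
  then show "u' = u" if "u' \<in> part M q \<and> (\<exists>w'\<in>part M (q + 1). u \<oplus> w = u' \<oplus> w')" for u'
    using that assms part_decompose_unique(1)[of u q w "q + 1" u'] by metis
qed (use assms in blast)

lemma part_decompose':
  assumes "v \<in> carrier M"
  obtains a b where "a \<in> part M q" "b \<in> part M (q + 1)" "v = a \<oplus> b"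
proof -
  obtain v0 v1 where v: "v0 \<in> part M 0" "v1 \<in> part M 1" "v = v0 \<oplus> v1"
    using part_decompose[OF assms] .
  from bit_exhaust[of q] show thesis
  proof
    assume "q = 0"
    then show thesis using v that by simp
  next
    assume "q = 1"
    then show thesis using v that[of v1 v0] part_closed by (simp add: a_comm)
  qed
qed

lemma proj_part: "v \<in> carrier M \<Longrightarrow> proj M q v \<in> part M q"
  using part_decompose'[of v q] proj_eq by metis

lemma proj_closed: "v \<in> carrier M \<Longrightarrow> proj M q v \<in> carrier M"
  using proj_part part_closed by blast

lemma proj_sum: "v \<in> carrier M \<Longrightarrow> v = proj M q v \<oplus> proj M (q + 1) v"
proof -
  assume v: "v \<in> carrier M"
  obtain a b where ab: "a \<in> part M q" "b \<in> part M (q + 1)" "v = a \<oplus> b" using part_decompose'[OF v] .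
  then have "v = b \<oplus> a" using part_closed by (simp add: a_comm)
  then have "proj M (q + 1) v = b" using proj_eq[of b "q + 1" a] ab unfolding bit_add_one_twice by simp
  then show ?thesis using ab proj_eq by simp
qed

lemma proj_add:
  assumes "v \<in> carrier M" "w \<in> carrier M"
  shows "proj M q (v \<oplus> w) = proj M q v \<oplus> proj M q w"
proof -
  have "v \<oplus> w = (proj M q v \<oplus> proj M q w) \<oplus> (proj M (q + 1) v \<oplus> proj M (q + 1) w)"
    using proj_sum[OF assms(1), of q] proj_sum[OF assms(2), of q] proj_closed assms
    by (metis add_shuffle)
  then show ?thesis
    using proj_eq[of "proj M q v \<oplus> proj M q w" q "proj M (q + 1) v \<oplus> proj M (q + 1) w"]
      proj_part assms lin_subspaceD(3)[OF part_subspace] by simp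
qed

lemma proj_scale:
  assumes "v \<in> carrier M"
  shows "proj M q (c \<odot> v) = c \<odot> proj M q v"
proof -
  have "c \<odot> v = c \<odot> proj M q v \<oplus> c \<odot> proj M (q + 1) v"
    using proj_sum[OF assms, of q] proj_closed[OF assms] by (metis scale_add_right)
  then show ?thesis
    using proj_eq[of "c \<odot> proj M q v" q "c \<odot> proj M (q + 1) v"] proj_part[OF assms]
      lin_subspaceD(4)[OF part_subspace] by simp
qed

lemma proj_self: "v \<in> part M q \<Longrightarrow> proj M q v = v"
  using proj_eq[of v q \<zero>] lin_subspaceD(2)[OF part_subspace] part_closed by simp

lemma proj_other: "v \<in> part M (q + 1) \<Longrightarrow> proj M q v = \<zero>"
  using proj_eq[of \<zero> q v] lin_subspaceD(2)[OF part_subspace] part_closed by simp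

lemma proj_act:
  assumes "x \<in> hom_part n (periplectic n) p" "v \<in> carrier M"
  shows "proj M (p + q) (act M x v) = act M x (proj M q v)"
proof -
  have x: "x \<in> periplectic n" using hom_part_subset assms(1) by blast
  have "act M x v = act M x (proj M q v) \<oplus> act M x (proj M (q + 1) v)"
    using proj_sum[OF assms(2), of q] act_add[OF x] proj_closed[OF assms(2)] by metis
  moreover have "act M x (proj M q v) \<in> part M (p + q)" "act M x (proj M (q + 1) v) \<in> part M (p + q + 1)"
    using act_part[OF assms(1) proj_part[OF assms(2)]] by (simp_all only: add.assoc)
  ultimately show ?thesis using proj_eq by simp
qed

text \<open>The operator (-1)^(p |v|), extended linearly. It moves the sign of the dual action from
  the functional to the vector, so that inhomogeneous functionals need no separate
  treatment.\<close>

definition parity_twist :: "bit \<Rightarrow> 'v \<Rightarrow> 'v" where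
  "parity_twist p v = (if p = 0 then v else proj M 0 v \<oplus> (- 1) \<odot> proj M 1 v)"

lemma twist_closed: "v \<in> carrier M \<Longrightarrow> parity_twist p v \<in> carrier M"
  unfolding parity_twist_def using proj_closed by auto

lemma twist_add: "v \<in> carrier M \<Longrightarrow> w \<in> carrier M \<Longrightarrow> parity_twist p (v \<oplus> w) = parity_twist p v \<oplus> parity_twist p w"
  unfolding parity_twist_def using proj_closed by (auto simp: proj_add scale_add_right add_shuffle)

lemma twist_scale: "v \<in> carrier M \<Longrightarrow> parity_twist p (c \<odot> v) = c \<odot> parity_twist p v"
  unfolding parity_twist_def using proj_closed by (auto simp: proj_scale scale_add_right scale_scale mult.commute)

lemma twist_homogeneous: "v \<in> part M q \<Longrightarrow> parity_twist p v = koszul_sign p q \<odot> v"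
  using proj_self[of v q] proj_other[of v "q + 1"] part_closed[of v q] bit_exhaust[of q] bit_exhaust[of p]
  unfolding parity_twist_def koszul_sign_def by auto

lemma twist_part: "v \<in> part M q \<Longrightarrow> parity_twist p v \<in> part M q"
  using twist_homogeneous lin_subspaceD(4)[OF part_subspace] by simp

lemma twist_twist:
  assumes v: "v \<in> carrier M"
  shows "parity_twist p (parity_twist q v) = parity_twist (p + q) v"
proof -
  have "parity_twist p (parity_twist q u) = parity_twist (p + q) u" if u: "u \<in> part M r" for u r
  proof -
    have "parity_twist p (parity_twist q u) = (koszul_sign q r * koszul_sign p r) \<odot> u"
      using u part_closed by (simp add: twist_homogeneous twist_scale scale_scale)
    also have "koszul_sign q r * koszul_sign p r = koszul_sign (p + q) r"
      using bit_exhaust[of p] bit_exhaust[of q] by (auto simp: koszul_sign_def)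
    finally show ?thesis using twist_homogeneous[OF u] by simp
  qed
  note hom = this
  obtain v0 v1 where "v0 \<in> part M 0" "v1 \<in> part M 1" "v = v0 \<oplus> v1" using part_decompose[OF v] .
  then show ?thesis using part_closed twist_closed hom by (simp add: twist_add)
qed

text \<open>The parity of x v is |x| + |v|, so a Koszul sign for x splits off.\<close>

lemma twist_act:
  assumes x: "x \<in> hom_part n (periplectic n) p" and v: "v \<in> carrier M"
  shows "parity_twist q (act M x v) = koszul_sign p q \<odot> act M x (parity_twist q v)"
proof -
  have xg: "x \<in> periplectic n" using hom_part_subset x by blast
  have hom: "parity_twist q (act M x u) = koszul_sign p q \<odot> act M x (parity_twist q u)" if u: "u \<in> part M r" for u r
  proof -
    have "koszul_sign p q * koszul_sign q r = koszul_sign q (p + r)"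
      using bit_exhaust[of p] bit_exhaust[of r] by (auto simp: koszul_sign_def)
    then show ?thesis
      using u part_closed act_closed[OF xg] twist_homogeneous[OF act_part[OF x u], of q]
      by (simp add: twist_homogeneous[OF u] act_smult[OF xg] scale_scale)
  qed
  obtain v0 v1 where "v0 \<in> part M 0" "v1 \<in> part M 1" "v = v0 \<oplus> v1" using part_decompose[OF v] .
  then show ?thesis using part_closed twist_closed hom act_closed[OF xg]
    by (simp add: twist_add act_add[OF xg] scale_add_right)
qed

section \<open>Functionals and the dual action\<close>

definition functionals :: "('v \<Rightarrow> complex) set" where
  "functionals = {f \<in> extensional (carrier M).
       (\<forall>v\<in>carrier M. \<forall>w\<in>carrier M. f (v \<oplus> w) = f v + f w) \<and>
       (\<forall>c. \<forall>v\<in>carrier M. f (c \<odot> v) = c * f v)}"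

lemma functionalsD:
  assumes "f \<in> functionals"
  shows "f \<in> extensional (carrier M)" "v \<in> carrier M \<Longrightarrow> w \<in> carrier M \<Longrightarrow> f (v \<oplus> w) = f v + f w"
    "v \<in> carrier M \<Longrightarrow> f (c \<odot> v) = c * f v"
  using assms unfolding functionals_def by auto

lemma functionals_zero: "f \<in> functionals \<Longrightarrow> f \<zero> = 0"
  using functionalsD(3)[of f \<zero> 0] by simp

lemma restrict_functional:
  assumes "\<And>v w. v \<in> carrier M \<Longrightarrow> w \<in> carrier M \<Longrightarrow> h (v \<oplus> w) = h v + h w"
    "\<And>c v. v \<in> carrier M \<Longrightarrow> h (c \<odot> v) = c * h v"
  shows "(\<lambda>v\<in>carrier M. h v) \<in> functionals"
  using assms unfolding functionals_def by auto

lemma functionals_eqI: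
  assumes "f \<in> functionals" "h \<in> functionals" "\<And>v. v \<in> carrier M \<Longrightarrow> f v = h v"
  shows "f = h"
  using assms functionalsD(1) extensionalityI by metis

lemma dual_simps:
  "carrier (dual n M) = functionals" "\<zero>\<^bsub>dual n M\<^esub> = (\<lambda>v\<in>carrier M. 0)"
  "f \<oplus>\<^bsub>dual n M\<^esub> h = (\<lambda>v\<in>carrier M. f v + h v)" "c \<odot>\<^bsub>dual n M\<^esub> f = (\<lambda>v\<in>carrier M. c * f v)"
  "part (dual n M) p = {f \<in> functionals. \<forall>v\<in>part M (p + 1). f v = 0}"
  by (auto simp: dual_def functionals_def)

text \<open>Summing over the parities of the components of the functional weights each component of
  the vector with its sign, which is what the twist does.\<close>

lemma dual_act_eq:
  assumes f: "f \<in> functionals" and x: "x \<in> periplectic n" and v: "v \<in> carrier M"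
  shows "act (dual n M) x f v =
    - f (parity_twist 0 (act M (hom_comp n 0 x) v)) - f (parity_twist 1 (act M (hom_comp n 1 x) v))"
proof -
  have a: "act M (hom_comp n p x) v \<in> carrier M" for p
    using act_closed[OF hom_part_subset[OF hom_comp_hom_part[OF x]] v] .
  have "(\<Sum>q\<in>{0, 1}. koszul_sign p q * f (proj M q y)) = f (parity_twist p y)" if y: "y \<in> carrier M" for p y
  proof (cases "p = 0")
    case True
    then show ?thesis
      using proj_sum[OF y, of 0] functionalsD(2)[OF f proj_closed[OF y] proj_closed[OF y], of 0 1]
      by (simp add: parity_twist_def koszul_sign_def)
  next
    case False
    then show ?thesis
      using proj_closed[OF y] by (simp add: parity_twist_def koszul_sign_def functionalsD[OF f])
  qed
  with a have "(\<Sum>q\<in>{0, 1}. koszul_sign p q * f (proj M q (act M (hom_comp n p x) v))) =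
      f (parity_twist p (act M (hom_comp n p x) v))" for p
    by blast
  note e = this
  have "act (dual n M) x f v = - (\<Sum>p\<in>{0, 1}. \<Sum>q\<in>{0, 1}. koszul_sign p q * f (proj M q (act M (hom_comp n p x) v)))"
    unfolding dual_def using v by (simp only: smod.select_convs restrict_apply' if_True)
  also have "\<dots> = - (\<Sum>p\<in>{0, 1}. f (parity_twist p (act M (hom_comp n p x) v)))"
    unfolding e ..
  finally show ?thesis by simp
qed

lemma dual_act_hom:
  assumes f: "f \<in> functionals" and x: "x \<in> hom_part n (periplectic n) p" and v: "v \<in> carrier M"
  shows "act (dual n M) x f v = - f (parity_twist p (act M x v))"
proof -
  have z: "f (parity_twist q (act M (0\<^sub>m (n + n) (n + n)) v)) = 0" for q
  proof -
    have "parity_twist q \<zero> = 0 \<odot> parity_twist q \<zero>"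
      using twist_scale[of \<zero> q 0] by simp
    then have "parity_twist q \<zero> = \<zero>" using twist_closed[of \<zero> q] by simp
    then show ?thesis using act_zero_mat[OF v] functionals_zero[OF f] by simp
  qed
  have xg: "x \<in> periplectic n" using hom_part_subset x by blast
  from bit_exhaust[of p] show ?thesis
  proof
    assume p: "p = 0"
    then show ?thesis
      using dual_act_eq[OF f xg v] hom_comp_self[OF x] hom_comp_other[OF x, of 1] z[of 1] by simp
  next
    assume p: "p = 1"
    then show ?thesis
      using dual_act_eq[OF f xg v] hom_comp_self[OF x] hom_comp_other[OF x, of 0] z[of 0] by simp
  qed
qed

lemma dual_act_functional:
  assumes f: "f \<in> functionals" and x: "x \<in> periplectic n"
  shows "act (dual n M) x f \<in> functionals"
proof -
  have g: "hom_comp n p x \<in> periplectic n" for p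
    using hom_part_subset[OF hom_comp_hom_part[OF x]] .
  have eq: "act (dual n M) x f = (\<lambda>v\<in>carrier M. - f (parity_twist 0 (act M (hom_comp n 0 x) v)) - f (parity_twist 1 (act M (hom_comp n 1 x) v)))"
    (is "_ = ?h")
  proof
    fix v
    show "act (dual n M) x f v = ?h v"
      using dual_act_eq[OF f x, of v] by (cases "v \<in> carrier M") (simp_all add: dual_def)
  qed
  show ?thesis
    unfolding eq
    by (rule restrict_functional)
      (simp_all add: act_add[OF g] act_smult[OF g] act_closed[OF g] twist_add twist_scale twist_closed functionalsD[OF f] algebra_simps)
qed

lemma dual_module: "Module.module complex_ring (dual n M)"
proof (rule moduleI)
  show "abelian_group (dual n M)"
  proof (rule abelian_groupI)
    fix f h assume "f \<in> carrier (dual n M)" "h \<in> carrier (dual n M)"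
    then show "f \<oplus>\<^bsub>dual n M\<^esub> h \<in> carrier (dual n M)"
      unfolding dual_simps by (intro restrict_functional) (auto simp: functionalsD algebra_simps)
  next
    show "\<zero>\<^bsub>dual n M\<^esub> \<in> carrier (dual n M)"
      unfolding dual_simps by (intro restrict_functional) auto
  next
    fix f assume f: "f \<in> carrier (dual n M)"
    show "\<zero>\<^bsub>dual n M\<^esub> \<oplus>\<^bsub>dual n M\<^esub> f = f"
      using f functionalsD(1)[of f] unfolding dual_simps by (auto simp: extensional_def fun_eq_iff)
    have "(\<lambda>v\<in>carrier M. - f v) \<in> functionals"
      using f unfolding dual_simps by (intro restrict_functional) (auto simp: functionalsD)
    then show "\<exists>h\<in>carrier (dual n M). h \<oplus>\<^bsub>dual n M\<^esub> f = \<zero>\<^bsub>dual n M\<^esub>"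
      unfolding dual_simps by (intro bexI[of _ "\<lambda>v\<in>carrier M. - f v"]) (auto simp: fun_eq_iff)
  qed (auto simp: dual_simps fun_eq_iff algebra_simps)
  fix a and f assume "f \<in> carrier (dual n M)"
  then show "a \<odot>\<^bsub>dual n M\<^esub> f \<in> carrier (dual n M)"
    unfolding dual_simps by (intro restrict_functional) (auto simp: functionalsD algebra_simps)
next
  fix f assume "f \<in> carrier (dual n M)"
  then show "\<one>\<^bsub>complex_ring\<^esub> \<odot>\<^bsub>dual n M\<^esub> f = f"
    using functionalsD(1)[of f] unfolding dual_simps by (auto simp: extensional_def fun_eq_iff)
qed (auto simp: dual_simps fun_eq_iff algebra_simps cring_complex_ring)

lemma dual_part_sum: "carrier (dual n M) = part (dual n M) 0 <+>\<^bsub>dual n M\<^esub> part (dual n M) 1"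
proof (intro equalityI subsetI)
  fix f assume "f \<in> carrier (dual n M)"
  then have f: "f \<in> functionals" by (simp add: dual_simps)
  define h where "h q = (\<lambda>v\<in>carrier M. f (proj M q v))" for q
  have h: "h q \<in> functionals" for q
    unfolding h_def by (rule restrict_functional) (simp_all add: proj_add proj_scale proj_closed functionalsD[OF f])
  have "h q \<in> part (dual n M) q" for q
    using h functionals_zero[OF f] part_closed by (auto simp: dual_simps h_def proj_other)
  moreover have "f = h 0 \<oplus>\<^bsub>dual n M\<^esub> h 1"
  proof (rule functionals_eqI[OF f])
    show "h 0 \<oplus>\<^bsub>dual n M\<^esub> h 1 \<in> functionals"
      using h unfolding dual_simps by (intro restrict_functional) (auto simp: functionalsD algebra_simps)
    fix v assume v: "v \<in> carrier M"
    then show "f v = (h 0 \<oplus>\<^bsub>dual n M\<^esub> h 1) v"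
      using functionalsD(2)[OF f proj_closed[OF v, of 0] proj_closed[OF v, of 1]] proj_sum[OF v, of 0]
      by (simp add: dual_simps h_def)
  qed
  ultimately show "f \<in> part (dual n M) 0 <+>\<^bsub>dual n M\<^esub> part (dual n M) 1"
    unfolding set_add_def' by blast
next
  fix f assume "f \<in> part (dual n M) 0 <+>\<^bsub>dual n M\<^esub> part (dual n M) 1"
  then obtain a b where "a \<in> functionals" "b \<in> functionals" "f = a \<oplus>\<^bsub>dual n M\<^esub> b"
    unfolding set_add_def' dual_simps(5) by blast
  then show "f \<in> carrier (dual n M)"
    unfolding dual_simps by (auto intro!: restrict_functional simp: functionalsD algebra_simps)
qed

text \<open>For the bracket axiom, dualizing reverses the order of x and y; commuting the inner
  twist past an action supplies the Koszul sign, and the two twists add up to one of parity p +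
  q.\<close>

lemma dual_psupermodule: "psupermodule n (dual n M)"
  unfolding psupermodule_def
proof (rule supermodule.intro[OF dual_module supermodule_axioms.intro])
  interpret D: cspace "dual n M"
    unfolding cspace_def by (rule dual_module)
  fix p q
  show "submodule (part (dual n M) p) complex_ring (dual n M)"
    unfolding D.submodule_iff_lin_subspace
  proof (rule D.lin_subspaceI)
    show "part (dual n M) p \<subseteq> carrier (dual n M)" by (auto simp: dual_simps)
    show "\<zero>\<^bsub>dual n M\<^esub> \<in> part (dual n M) p"
      using D.zero_closed part_closed by (auto simp: dual_simps)
    fix f h c assume f: "f \<in> part (dual n M) p" and h: "h \<in> part (dual n M) p"
    then have "f \<oplus>\<^bsub>dual n M\<^esub> h \<in> functionals" "c \<odot>\<^bsub>dual n M\<^esub> f \<in> functionals"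
      using D.a_closed[of f h] D.scale_closed[of f c] by (simp_all add: dual_simps)
    then show "f \<oplus>\<^bsub>dual n M\<^esub> h \<in> part (dual n M) p" "c \<odot>\<^bsub>dual n M\<^esub> f \<in> part (dual n M) p"
      using f h by (auto simp: dual_simps part_closed)
  qed
  show "carrier (dual n M) = part (dual n M) 0 <+>\<^bsub>dual n M\<^esub> part (dual n M) 1"
    by (rule dual_part_sum)
  show "part (dual n M) 0 \<inter> part (dual n M) 1 = {\<zero>\<^bsub>dual n M\<^esub>}"
  proof (intro equalityI subsetI)
    fix f assume f: "f \<in> part (dual n M) 0 \<inter> part (dual n M) 1"
    then have ff: "f \<in> functionals" and v1: "v \<in> part M 1 \<Longrightarrow> f v = 0" and v0: "v \<in> part M 0 \<Longrightarrow> f v = 0" for v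
      by (auto simp: dual_simps)
    have "f v = 0" if "v \<in> carrier M" for v
      using part_decompose[OF that] v0 v1 functionalsD(2)[OF ff] part_closed by (metis add_0)
    then have "f = \<zero>\<^bsub>dual n M\<^esub>"
      using D.zero_closed by (intro functionals_eqI[OF ff]) (simp_all add: dual_simps)
    then show "f \<in> {\<zero>\<^bsub>dual n M\<^esub>}" by simp
  next
    fix f assume "f \<in> {\<zero>\<^bsub>dual n M\<^esub>}"
    then show "f \<in> part (dual n M) 0 \<inter> part (dual n M) 1"
      using D.zero_closed part_closed by (auto simp: dual_simps)
  qed
next
  interpret D: cspace "dual n M"
    unfolding cspace_def by (rule dual_module)
  fix x y f h c p q
  assume x: "x \<in> periplectic n" and f: "f \<in> carrier (dual n M)"
  then have ff: "f \<in> functionals" by (simp add: dual_simps)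
  have xc: "hom_comp n r x \<in> periplectic n" "act M (hom_comp n r x) v \<in> carrier M" if "v \<in> carrier M" for r v
    using hom_part_subset[OF hom_comp_hom_part[OF x]] act_closed that by blast+
  show ac: "act (dual n M) x f \<in> carrier (dual n M)"
    using dual_act_functional[OF ff x] by (simp add: dual_simps)
  show "act (dual n M) x (c \<odot>\<^bsub>dual n M\<^esub> f) = c \<odot>\<^bsub>dual n M\<^esub> act (dual n M) x f"
  proof (rule functionals_eqI)
    have cf: "c \<odot>\<^bsub>dual n M\<^esub> f \<in> functionals" using D.scale_closed[OF f] by (simp add: dual_simps)
    then show "act (dual n M) x (c \<odot>\<^bsub>dual n M\<^esub> f) \<in> functionals" by (rule dual_act_functional[OF _ x])
    show "c \<odot>\<^bsub>dual n M\<^esub> act (dual n M) x f \<in> functionals" using D.scale_closed[OF ac] by (simp add: dual_simps)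
    fix v assume v: "v \<in> carrier M"
    show "act (dual n M) x (c \<odot>\<^bsub>dual n M\<^esub> f) v = (c \<odot>\<^bsub>dual n M\<^esub> act (dual n M) x f) v"
      unfolding dual_act_eq[OF cf x v] using v xc by (simp add: dual_simps(4) dual_act_eq[OF ff x v] twist_closed algebra_simps)
  qed
  show "act (dual n M) (c \<cdot>\<^sub>m x) f = c \<odot>\<^bsub>dual n M\<^esub> act (dual n M) x f"
  proof (rule functionals_eqI)
    show "act (dual n M) (c \<cdot>\<^sub>m x) f \<in> functionals" by (rule dual_act_functional[OF ff periplectic_smult[OF x]])
    show "c \<odot>\<^bsub>dual n M\<^esub> act (dual n M) x f \<in> functionals" using D.scale_closed[OF ac] by (simp add: dual_simps)
    fix v assume v: "v \<in> carrier M"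
    have cx: "x \<in> carrier_mat (n + n) (n + n)" using x periplectic_carrier by blast
    show "act (dual n M) (c \<cdot>\<^sub>m x) f v = (c \<odot>\<^bsub>dual n M\<^esub> act (dual n M) x f) v"
      using v xc by (simp add: dual_act_eq[OF ff periplectic_smult[OF x] v] dual_simps(4) dual_act_eq[OF ff x v]
          hom_comp_smult[OF cx] smult_act twist_scale twist_closed functionalsD[OF ff] algebra_simps)
  qed
  show "act (dual n M) x (f \<oplus>\<^bsub>dual n M\<^esub> h) = act (dual n M) x f \<oplus>\<^bsub>dual n M\<^esub> act (dual n M) x h"
    if h: "h \<in> carrier (dual n M)"
  proof (rule functionals_eqI)
    have hh: "h \<in> functionals" using h by (simp add: dual_simps)
    have fh: "f \<oplus>\<^bsub>dual n M\<^esub> h \<in> functionals" using D.a_closed[OF f h] by (simp add: dual_simps)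
    then show "act (dual n M) x (f \<oplus>\<^bsub>dual n M\<^esub> h) \<in> functionals" by (rule dual_act_functional[OF _ x])
    show "act (dual n M) x f \<oplus>\<^bsub>dual n M\<^esub> act (dual n M) x h \<in> functionals"
      using D.a_closed[OF ac] dual_act_functional[OF hh x] by (simp add: dual_simps)
    fix v assume v: "v \<in> carrier M"
    show "act (dual n M) x (f \<oplus>\<^bsub>dual n M\<^esub> h) v = (act (dual n M) x f \<oplus>\<^bsub>dual n M\<^esub> act (dual n M) x h) v"
      unfolding dual_act_eq[OF fh x v] using v xc by (simp add: dual_simps(3) dual_act_eq[OF ff x v] dual_act_eq[OF hh x v] twist_closed)
  qed
  show "act (dual n M) (x + y) f = act (dual n M) x f \<oplus>\<^bsub>dual n M\<^esub> act (dual n M) y f"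
    if y: "y \<in> periplectic n"
  proof (rule functionals_eqI)
    show "act (dual n M) (x + y) f \<in> functionals" by (rule dual_act_functional[OF ff periplectic_add[OF x y]])
    show "act (dual n M) x f \<oplus>\<^bsub>dual n M\<^esub> act (dual n M) y f \<in> functionals"
      using D.a_closed[OF ac] dual_act_functional[OF ff y] by (simp add: dual_simps)
    fix v assume v: "v \<in> carrier M"
    have cx: "x \<in> carrier_mat (n + n) (n + n)" "y \<in> carrier_mat (n + n) (n + n)"
      using x y periplectic_carrier by blast+
    have yc: "hom_comp n r y \<in> periplectic n" "act M (hom_comp n r y) v \<in> carrier M" for r
      using hom_part_subset[OF hom_comp_hom_part[OF y]] act_closed v by blast+
    show "act (dual n M) (x + y) f v = (act (dual n M) x f \<oplus>\<^bsub>dual n M\<^esub> act (dual n M) y f) v"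
      using v xc yc by (simp add: dual_act_eq[OF ff periplectic_add[OF x y] v] dual_simps(3) dual_act_eq[OF ff x v]
          dual_act_eq[OF ff y v] hom_comp_add[OF cx] add_act twist_add twist_closed functionalsD[OF ff])
  qed
next
  fix x f p q
  assume x: "x \<in> hom_part n (periplectic n) p" and f: "f \<in> part (dual n M) q"
  then have ff: "f \<in> functionals" by (simp add: dual_simps)
  have xg: "x \<in> periplectic n" using hom_part_subset x by blast
  have "act (dual n M) x f v = 0" if v: "v \<in> part M (p + q + 1)" for v
  proof -
    have "parity_twist p (act M x v) \<in> part M (p + (p + q + 1))"
      using twist_part act_part[OF x v] by blast
    also have "p + (p + q + 1) = q + 1" using bit_exhaust[of p] by (auto simp: add.assoc[symmetric] bit_add_self)
    finally show ?thesis
      using dual_act_hom[OF ff x part_closed[OF v]] f by (simp add: dual_simps)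
  qed
  then show "act (dual n M) x f \<in> part (dual n M) (p + q)"
    using dual_act_functional[OF ff xg] by (simp add: dual_simps(5))
next
  interpret D: cspace "dual n M"
    unfolding cspace_def by (rule dual_module)
  fix x y f p q
  assume x: "x \<in> hom_part n (periplectic n) p" and y: "y \<in> hom_part n (periplectic n) q" and f: "f \<in> carrier (dual n M)"
  then have ff: "f \<in> functionals" by (simp add: dual_simps)
  have xg: "x \<in> periplectic n" "y \<in> periplectic n" using hom_part_subset x y by blast+
  have b: "superbracket p q x y \<in> hom_part n (periplectic n) (p + q)" by (rule superbracket_hom_part[OF x y])
  have xf: "act (dual n M) x f \<in> functionals" "act (dual n M) y f \<in> functionals"
    using dual_act_functional[OF ff] xg by auto
  have xyf: "act (dual n M) x (act (dual n M) y f) \<in> functionals" "act (dual n M) y (act (dual n M) x f) \<in> functionals"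
    using dual_act_functional xf xg by auto
  have kk: "koszul_sign p q * koszul_sign p q = 1" "koszul_sign q p = koszul_sign p q" by (auto simp: koszul_sign_def)
  show "act (dual n M) (superbracket p q x y) f =
    act (dual n M) x (act (dual n M) y f) \<ominus>\<^bsub>dual n M\<^esub> koszul_sign p q \<odot>\<^bsub>dual n M\<^esub> act (dual n M) y (act (dual n M) x f)"
  proof (rule functionals_eqI)
    show "act (dual n M) (superbracket p q x y) f \<in> functionals"
      by (rule dual_act_functional[OF ff hom_part_subset[OF b]])
    show "act (dual n M) x (act (dual n M) y f) \<ominus>\<^bsub>dual n M\<^esub> koszul_sign p q \<odot>\<^bsub>dual n M\<^esub> act (dual n M) y (act (dual n M) x f) \<in> functionals"
      using D.minus_closed D.scale_closed xyf by (simp add: dual_simps(1))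
    fix v assume v: "v \<in> carrier M"
    have c: "act M x v \<in> carrier M" "act M y v \<in> carrier M" "act M x (act M y v) \<in> carrier M" "act M y (act M x v) \<in> carrier M"
      using act_closed xg v by auto
    have xy: "act (dual n M) x (act (dual n M) y f) v = koszul_sign p q * f (parity_twist (p + q) (act M y (act M x v)))"
    proof -
      have "act M y (parity_twist p (act M x v)) = koszul_sign p q \<odot> parity_twist p (act M y (act M x v))"
        using twist_act[OF y c(1), of p] kk act_closed[OF xg(2) twist_closed[OF c(1)]]
        by (simp add: scale_scale)
      then show ?thesis
        using c twist_closed by (simp add: dual_act_hom[OF xf(2) x v] dual_act_hom[OF ff y] twist_scale twist_twist functionalsD(3)[OF ff] add.commute)
    qed
    have yx: "act (dual n M) y (act (dual n M) x f) v = koszul_sign p q * f (parity_twist (p + q) (act M x (act M y v)))"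
    proof -
      have "act M x (parity_twist q (act M y v)) = koszul_sign p q \<odot> parity_twist q (act M x (act M y v))"
        using twist_act[OF x c(2), of q] kk act_closed[OF xg(1) twist_closed[OF c(2)]]
        by (simp add: scale_scale)
      then show ?thesis
        using c twist_closed by (simp add: dual_act_hom[OF xf(1) y v] dual_act_hom[OF ff x] twist_scale twist_twist functionalsD(3)[OF ff])
    qed
    have "act (dual n M) (superbracket p q x y) f v = - f (parity_twist (p + q) (act M x (act M y v))) +
      koszul_sign p q * f (parity_twist (p + q) (act M y (act M x v)))"
      using c twist_closed by (simp add: dual_act_hom[OF ff b v] act_superbracket[OF x y v] minus_eq_scale scale_scale twist_add twist_scale functionalsD[OF ff])
    also have "\<dots> = act (dual n M) x (act (dual n M) y f) v - koszul_sign p q * act (dual n M) y (act (dual n M) x f) v"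
      unfolding xy yx using kk(1) by (simp add: algebra_simps flip: mult.assoc)
    also have "\<dots> = (act (dual n M) x (act (dual n M) y f) \<ominus>\<^bsub>dual n M\<^esub> koszul_sign p q \<odot>\<^bsub>dual n M\<^esub> act (dual n M) y (act (dual n M) x f)) v"
      using v xyf D.minus_eq_scale[of "act (dual n M) x (act (dual n M) y f)" "koszul_sign p q \<odot>\<^bsub>dual n M\<^esub> act (dual n M) y (act (dual n M) x f)"]
        D.scale_closed[of "act (dual n M) y (act (dual n M) x f)" "koszul_sign p q"]
      by (simp add: dual_simps(1,3,4))
    finally show "act (dual n M) (superbracket p q x y) f v =
      (act (dual n M) x (act (dual n M) y f) \<ominus>\<^bsub>dual n M\<^esub> koszul_sign p q \<odot>\<^bsub>dual n M\<^esub> act (dual n M) y (act (dual n M) x f)) v" .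
  qed
qed

end

section \<open>The dual of a simple supermodule\<close>

inductive_set (in cspace) lin_span for B where
  base: "b \<in> B \<Longrightarrow> b \<in> lin_span B"
| zero: "\<zero> \<in> lin_span B"
| add: "v \<in> lin_span B \<Longrightarrow> w \<in> lin_span B \<Longrightarrow> v \<oplus> w \<in> lin_span B"
| scale: "v \<in> lin_span B \<Longrightarrow> c \<odot> v \<in> lin_span B"

context cspace
begin

lemma lin_span_closed: "B \<subseteq> carrier M \<Longrightarrow> y \<in> lin_span B \<Longrightarrow> y \<in> carrier M"
  by (erule lin_span.induct) auto

lemma lin_span_insert:
  assumes B: "insert b B \<subseteq> carrier M" and y: "y \<in> lin_span (insert b B)"
  shows "\<exists>c. \<exists>s\<in>lin_span B. y = c \<odot> b \<oplus> s"
  using y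
proof induction
  case (base b')
  then show ?case
  proof
    assume "b' = b"
    then show ?thesis using B by (intro exI[of _ 1] bexI[of _ \<zero>]) (auto intro: lin_span.zero)
  next
    assume "b' \<in> B"
    then show ?thesis using B by (intro exI[of _ 0] bexI[of _ b']) (auto intro: lin_span.base)
  qed
next
  case zero
  then show ?case using B by (intro exI[of _ 0] bexI[of _ \<zero>]) (auto intro: lin_span.zero)
next
  case (add v w)
  then obtain c s c' s' where *: "s \<in> lin_span B" "v = c \<odot> b \<oplus> s" "s' \<in> lin_span B" "w = c' \<odot> b \<oplus> s'" by blast
  have "s \<in> carrier M" "s' \<in> carrier M" using lin_span_closed[of B] B * by auto
  then have "v \<oplus> w = (c + c') \<odot> b \<oplus> (s \<oplus> s')"
    using * B by (simp add: scale_add_left add_shuffle)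
  then show ?case using * lin_span.add by blast
next
  case (scale v a)
  then obtain c s where *: "s \<in> lin_span B" "v = c \<odot> b \<oplus> s" by blast
  have "s \<in> carrier M" using lin_span_closed[of B] B * by auto
  then have "a \<odot> v = (a * c) \<odot> b \<oplus> a \<odot> s"
    using * B by (simp add: scale_add_right scale_scale)
  then show ?case using * lin_span.scale by blast
qed

definition linear_functional :: "('a \<Rightarrow> complex) \<Rightarrow> bool" where
  "linear_functional f \<longleftrightarrow> (\<forall>v\<in>carrier M. \<forall>w\<in>carrier M. f (v \<oplus> w) = f v + f w) \<and>
     (\<forall>c. \<forall>v\<in>carrier M. f (c \<odot> v) = c * f v)"

lemma linear_functionalD:
  assumes "linear_functional f"
  shows "v \<in> carrier M \<Longrightarrow> w \<in> carrier M \<Longrightarrow> f (v \<oplus> w) = f v + f w"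
    "v \<in> carrier M \<Longrightarrow> f (c \<odot> v) = c * f v"
  using assms unfolding linear_functional_def by blast+

section \<open>Finite-dimensional duality without bases\<close>

text \<open>Induction over the spanning set: a new vector b costs at most one more functional. If
  some y0 in the larger span is killed by F but not by f0, then y0 involves b, and subtracting a
  multiple of y0 brings any vector back into the old span.\<close>

lemma finitely_many_functionals_suffice:
  assumes "finite B" "B \<subseteq> carrier M" and N: "\<And>f. f \<in> N \<Longrightarrow> linear_functional f"
  shows "\<exists>F. finite F \<and> F \<subseteq> N \<and> (\<forall>y\<in>lin_span B. (\<forall>f\<in>F. f y = 0) \<longrightarrow> (\<forall>f\<in>N. f y = 0))"
  using assms(1,2)
proof (induction B)
  case empty
  have "y = \<zero>" if "y \<in> lin_span {}" for y
    using that by induction auto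
  moreover have "f \<zero> = 0" if "f \<in> N" for f
    using linear_functionalD(2)[OF N[OF that], of \<zero> 0] by simp
  ultimately show ?case by (intro exI[of _ "{}"]) auto
next
  case (insert b B)
  then have "\<exists>F. finite F \<and> F \<subseteq> N \<and> (\<forall>y\<in>lin_span B. (\<forall>f\<in>F. f y = 0) \<longrightarrow> (\<forall>f\<in>N. f y = 0))"
    by simp
  then obtain F where F: "finite F" "F \<subseteq> N"
    and F0: "\<forall>y\<in>lin_span B. (\<forall>f\<in>F. f y = 0) \<longrightarrow> (\<forall>f\<in>N. f y = 0)"
    by (elim exE conjE)
  show ?case
  proof (cases "\<forall>y\<in>lin_span (insert b B). (\<forall>f\<in>F. f y = 0) \<longrightarrow> (\<forall>f\<in>N. f y = 0)")
    case True
    then show ?thesis using F by blast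
  next
    case False
    then obtain y0 f0 where y0: "y0 \<in> lin_span (insert b B)" "\<forall>f\<in>F. f y0 = 0" "f0 \<in> N" "f0 y0 \<noteq> 0" by blast
    obtain c0 s0 where s0: "s0 \<in> lin_span B" "y0 = c0 \<odot> b \<oplus> s0"
      using lin_span_insert[OF insert(4) y0(1)] by blast
    have car: "b \<in> carrier M" "s0 \<in> carrier M" "y0 \<in> carrier M"
      using lin_span_closed[of B s0] lin_span_closed[of "insert b B" y0] insert(4) s0(1) y0(1) by simp_all
    have c0: "c0 \<noteq> 0"
    proof
      assume "c0 = 0"
      then have "y0 = s0" using s0(2) car by simp
      then have "\<forall>f\<in>N. f y0 = 0" using F0 s0(1) y0(2) by simp
      then show False using y0(3,4) by simp
    qed
    have "\<forall>f\<in>N. f y = 0" if y: "y \<in> lin_span (insert b B)" "\<forall>f\<in>insert f0 F. f y = 0" for y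
    proof -
      obtain c s where s: "s \<in> lin_span B" "y = c \<odot> b \<oplus> s"
        using lin_span_insert[OF insert(4) y(1)] by blast
      have sc: "s \<in> carrier M" "y \<in> carrier M"
        using lin_span_closed[of B s] lin_span_closed[of "insert b B" y] insert(4) s(1) y(1) by simp_all
      \<comment> \<open>The multiple of s0 is that of y0 which cancels b, so t lies in the span of
        B.\<close>
      define t where "t = (- (c / c0)) \<odot> s0 \<oplus> s"
      have tB: "t \<in> lin_span B" unfolding t_def using s(1) s0(1) by (intro lin_span.add lin_span.scale)
      have tf: "f t = f y - c / c0 * f y0" if "f \<in> N" for f
        using c0 car(1,2) sc(1) unfolding t_def s(2) s0(2) by (simp add: linear_functionalD[OF N[OF that]] distrib_left)
      have "f t = 0" if "f \<in> F" for f
      proof -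
        have f: "f \<in> N" "f y = 0" "f y0 = 0" using that F(2) y(2) y0(2) by auto
        then show ?thesis using tf[OF f(1)] by simp
      qed
      then have "f0 t = 0" using F0 tB y0(3) by simp
      moreover have "f0 y = 0" using y(2) by simp
      ultimately have "c = 0" using tf[OF y0(3)] y0(4) c0 by simp
      then have "y = s" using s(2) car sc by simp
      then show ?thesis using F0 s(1) y(2) by simp
    qed
    then have "\<forall>y\<in>lin_span (insert b B). (\<forall>f\<in>insert f0 F. f y = 0) \<longrightarrow> (\<forall>f\<in>N. f y = 0)"
      by blast
    moreover have "finite (insert f0 F)" "insert f0 F \<subseteq> N" using F(1,2) y0(3) by simp_all
    ultimately show ?thesis by blast
  qed
qed

text \<open>Induction over F with U arbitrary: on the kernel of f the induction hypothesis gives h,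
  and a multiple of f corrects h at one vector outside the kernel.\<close>

lemma functional_in_span:
  assumes "finite F" "F \<subseteq> N" and N: "\<And>f. f \<in> N \<Longrightarrow> linear_functional f"
    and N0: "h0 \<in> N" "\<And>f h a b. f \<in> N \<Longrightarrow> h \<in> N \<Longrightarrow> \<exists>k\<in>N. \<forall>y\<in>carrier M. k y = a * f y + b * h y"
    and g: "linear_functional g" and U: "lin_subspace U" "\<And>y. y \<in> U \<Longrightarrow> (\<forall>f\<in>F. f y = 0) \<Longrightarrow> g y = 0"
  shows "\<exists>h\<in>N. \<forall>y\<in>U. g y = h y"
  using assms(1,2) U
proof (induction F arbitrary: U)
  case empty
  obtain k where k: "k \<in> N" "\<forall>y\<in>carrier M. k y = 0 * h0 y + 0 * h0 y" using N0(2)[OF N0(1) N0(1)] by blast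
  show ?case
    by (rule bexI[OF _ k(1)]) (use empty k(2) lin_subspaceD(1)[OF empty(2)] in auto)
next
  case (insert f F)
  have f: "linear_functional f" "f \<in> N" using insert(4) N by auto
  note Uc = lin_subspaceD[OF insert(5)]
  define U' where "U' = {y \<in> U. f y = 0}"
  have "f \<zero> = 0" using linear_functionalD(2)[OF f(1), of \<zero> 0] by simp
  then have "lin_subspace U'"
    unfolding U'_def using Uc
    by (intro lin_subspaceI) (auto simp: linear_functionalD[OF f(1)] subset_iff)
  then obtain h where h: "h \<in> N" "\<forall>y\<in>U'. g y = h y"
    using insert(3)[of U'] insert(4,6) unfolding U'_def by blast
  show ?case
  proof (cases "\<forall>y\<in>U. f y = 0")
    case True
    then show ?thesis using h unfolding U'_def by blast
  next
    case False
    then obtain y0 where y0: "y0 \<in> U" "f y0 \<noteq> 0" by blast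
    \<comment> \<open>The coefficient of f is forced by agreement with g at y0.\<close>
    obtain k where k: "k \<in> N" "\<forall>y\<in>carrier M. k y = 1 * h y + ((g y0 - h y0) / f y0) * f y"
      using N0(2)[OF h(1) f(2)] by blast
    have "g y = k y" if y: "y \<in> U" for y
    proof -
      let ?t = "y \<oplus> (- (f y / f y0)) \<odot> y0"
      have c: "y \<in> carrier M" "y0 \<in> carrier M" using y y0 Uc(1) by auto
      have "?t \<in> U" using y y0 Uc(3,4) by blast
      moreover have "f ?t = 0" using c y0(2) by (simp add: linear_functionalD[OF f(1)])
      ultimately have "g ?t = h ?t" using h(2) unfolding U'_def by blast
      then have "g y - f y / f y0 * g y0 = h y - f y / f y0 * h y0"
        using c by (simp add: linear_functionalD[OF g] linear_functionalD[OF N[OF h(1)]])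
      moreover have "k y = h y + f y / f y0 * (g y0 - h y0)" using k(2) c(1) by simp
      ultimately have "g y + f y / f y0 * h y0 = k y + f y / f y0 * h y0"
        by (simp add: algebra_simps diff_divide_distrib)
      then show ?thesis by simp
    qed
    then show ?thesis using k(1) by blast
  qed
qed

end

context psupermodule
begin

lemma functionals_linear: "f \<in> functionals \<Longrightarrow> linear_functional f"
  unfolding functionals_def linear_functional_def by blast

lemma hom_shifts_proj:
  assumes "y \<in> carrier M"
  shows "shifts x cs (proj M q y) = proj M q (shifts x cs y)"
proof (induction cs)
  case (Cons c cs)
  have "proj M q (act M (grading_elt n x) z) = act M (grading_elt n x) (proj M q z)" if "z \<in> carrier M" for z
    using proj_act[OF weight_vector_hom_part[OF grading_elt_weight[of n x]] that, of q] by simp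
  then have "shift n M x c (proj M q z) = proj M q (shift n M x c z)" if "z \<in> carrier M" for z
    unfolding shift_def using that wv_act_closed[OF grading_elt_weight that]
    by (simp add: proj_add proj_scale)
  then show ?case using Cons shifts_closed[OF assms] by simp
qed simp

lemma low_proj: "y \<in> low n M x k \<Longrightarrow> proj M q y \<in> low n M x k"
proof -
  assume y: "y \<in> low n M x k"
  then obtain cs where c: "y \<in> carrier M" "\<forall>c\<in>set cs. c < k" "shifts x cs y = \<zero>"
    unfolding low_def by auto
  have "shifts x cs (proj M q y) = \<zero>"
    using hom_shifts_proj[OF c(1)] c(3) proj_self[OF lin_subspaceD(2)[OF part_subspace]] by simp
  with c show ?thesis unfolding low_def using proj_closed by auto
qed

lemma low_twist: "y \<in> low n M x k \<Longrightarrow> parity_twist p y \<in> low n M x k"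
  unfolding parity_twist_def using low_proj lin_subspaceD(3,4)[OF low_subspace] by simp

end

context simple_psupermodule
begin

section \<open>The coefficient functional of an extremal vector\<close>

context
  fixes x nu q u
  assumes reg: "regular n x" and ext: "extremal n M x nu q u"
begin

abbreviation lower_part :: "'a set" where
  "lower_part \<equiv> low n M x (pairing n x nu)"

lemma multiple_low: "c \<odot> u \<in> lower_part \<Longrightarrow> c = 0"
proof -
  assume l: "c \<odot> u \<in> lower_part"
  note e = extremalD[OF ext]
  have "act M (grading_elt n x) (c \<odot> u) = of_int (pairing n x nu) \<odot> (c \<odot> u)"
    using e(2,6) by (simp add: wv_act_scale[OF grading_elt_weight] scale_scale mult.commute)
  then have "c \<odot> u = \<zero>" using low_eigen_zero[OF l] by blast
  then show "c = 0" using e(2,3) by (simp add: scale_eq_zero_iff)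
qed

lemma top_coefficient_unique:
  assumes "l \<in> lower_part" "l' \<in> lower_part" "c \<odot> u \<oplus> l = c' \<odot> u \<oplus> l'"
  shows "c = c'"
proof -
  note e = extremalD[OF ext]
  have lc: "l \<in> carrier M" "l' \<in> carrier M" using assms low_carrier by auto
  have "(c \<odot> u \<oplus> l) \<oplus> ((- c') \<odot> u \<oplus> (- 1) \<odot> l) = (c' \<odot> u \<oplus> l') \<oplus> ((- c') \<odot> u \<oplus> (- 1) \<odot> l)"
    using assms(3) by simp
  also have "(c \<odot> u \<oplus> l) \<oplus> ((- c') \<odot> u \<oplus> (- 1) \<odot> l) = (c + - c') \<odot> u \<oplus> (1 + - 1) \<odot> l"
    using lc e(2) by (simp only: add_shuffle scale_closed scale_add_left scale_one)
  also have "(c' \<odot> u \<oplus> l') \<oplus> ((- c') \<odot> u \<oplus> (- 1) \<odot> l) = (c' + - c') \<odot> u \<oplus> (l' \<oplus> (- 1) \<odot> l)"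
    using lc e(2) by (simp only: add_shuffle scale_closed scale_add_left)
  finally have "(c - c') \<odot> u = l' \<oplus> (- 1) \<odot> l"
    using lc e(2) by simp
  moreover have "l' \<oplus> (- 1) \<odot> l \<in> lower_part" using assms lin_subspaceD(3,4)[OF low_subspace] by simp
  ultimately show ?thesis using multiple_low[of "c - c'"] by simp
qed

text \<open>The lower degrees complement the line of u, so this is the coordinate along u; it
  becomes the extremal vector of the dual.\<close>

definition top_coefficient :: "'a \<Rightarrow> complex" where
  "top_coefficient y = (THE c. \<exists>l\<in>lower_part. y = c \<odot> u \<oplus> l)"

lemma top_coefficient_eq: "l \<in> lower_part \<Longrightarrow> top_coefficient (c \<odot> u \<oplus> l) = c"
  unfolding top_coefficient_def using top_coefficient_unique by (intro the_equality) blast+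

lemma top_coefficient_low: "l \<in> lower_part \<Longrightarrow> top_coefficient l = 0"
  using top_coefficient_eq[of l 0] extremalD(2)[OF ext] low_carrier by simp

lemma top_decompose:
  assumes "y \<in> carrier M"
  obtains l where "l \<in> lower_part" "y = top_coefficient y \<odot> u \<oplus> l"
  using extremal_decompose[OF reg ext assms] top_coefficient_eq by metis

lemma top_coefficient_add:
  assumes "y \<in> carrier M" "z \<in> carrier M"
  shows "top_coefficient (y \<oplus> z) = top_coefficient y + top_coefficient z"
proof -
  obtain l where l: "l \<in> lower_part" "y = top_coefficient y \<odot> u \<oplus> l" using top_decompose[OF assms(1)] .
  obtain l' where l': "l' \<in> lower_part" "z = top_coefficient z \<odot> u \<oplus> l'" using top_decompose[OF assms(2)] .
  have "y \<oplus> z = (top_coefficient y + top_coefficient z) \<odot> u \<oplus> (l \<oplus> l')"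
    using l l' extremalD(2)[OF ext] low_carrier by (metis add_shuffle scale_add_left scale_closed)
  then show ?thesis using top_coefficient_eq lin_subspaceD(3)[OF low_subspace] l(1) l'(1) by simp
qed

lemma top_coefficient_scale:
  assumes "y \<in> carrier M"
  shows "top_coefficient (c \<odot> y) = c * top_coefficient y"
proof -
  obtain l where l: "l \<in> lower_part" "y = top_coefficient y \<odot> u \<oplus> l" using top_decompose[OF assms(1)] .
  have "c \<odot> y = (c * top_coefficient y) \<odot> u \<oplus> c \<odot> l"
    using l extremalD(2)[OF ext] low_carrier by (metis scale_add_right scale_closed scale_scale)
  then show ?thesis using top_coefficient_eq lin_subspaceD(4)[OF low_subspace] l(1) by simp
qed

text \<open>All degrees are at most that of u, and a negative root vector lowers them by at least
  one.\<close>

lemma act_negative_low: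
  assumes z: "weight_vector n p w z" "pairing n x w < 0" and y: "y \<in> carrier M"
  shows "act M z y \<in> lower_part"
proof -
  obtain l where l: "l \<in> lower_part" "y = top_coefficient y \<odot> u \<oplus> l" using top_decompose[OF y] .
  have "u \<in> low n M x (pairing n x nu + 1)"
    by (rule low_eigen[OF extremalD(2,6)[OF ext]]) simp
  moreover have "l \<in> low n M x (pairing n x nu + 1)"
    using l(1) low_mono[of "pairing n x nu" "pairing n x nu + 1" x] by auto
  ultimately have "y \<in> low n M x (pairing n x nu + 1)"
    by (subst l(2)) (intro lin_subspaceD(3,4)[OF low_subspace])
  then show ?thesis
    using low_act[OF z(1), of y x "pairing n x nu + 1"] z(2)
      low_mono[of "pairing n x nu + 1 + pairing n x w" "pairing n x nu" x] by auto
qed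

text \<open>A root positive for -x is negative for x and maps everything into the lower part, where
  the functional vanishes. On the dual the torus acts with the opposite sign, and the parity is that
  of u because the functional vanishes on the other part.\<close>

lemma dual_extremal: "extremal n (dual n M) (\<lambda>i. - x i) (\<lambda>i. - nu i) q (\<lambda>y\<in>carrier M. top_coefficient y)"
proof -
  let ?xi = "\<lambda>y\<in>carrier M. top_coefficient y"
  have xi: "?xi \<in> functionals"
    by (rule restrict_functional) (auto simp: top_coefficient_add top_coefficient_scale)
  note e = extremalD[OF ext]
  have z: "\<zero> \<in> lower_part" using lin_subspaceD(2)[OF low_subspace] .
  interpret D: psupermodule n "dual n M" by (rule dual_psupermodule)
  show ?thesis
    unfolding extremal_def
  proof (intro conjI allI impI)
    have "top_coefficient y = 0" if y: "y \<in> part M (q + 1)" for y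
    proof -
      have yc: "y \<in> carrier M" using part_closed[OF y] .
      obtain l where l: "l \<in> lower_part" "y = top_coefficient y \<odot> u \<oplus> l" using top_decompose[OF yc] .
      \<comment> \<open>Projection to the parity of u keeps the coefficient of u but kills
        y.\<close>
      have "proj M q y = top_coefficient y \<odot> u \<oplus> proj M q l"
        using e(1,2) l low_carrier by (metis proj_add proj_scale proj_self scale_closed)
      from trans[OF sym[OF this] proj_other[OF y]] have "top_coefficient y \<odot> u \<oplus> proj M q l = 0 \<odot> u \<oplus> \<zero>"
        using e(2) by simp
      then show ?thesis using top_coefficient_unique[OF low_proj[OF l(1)] z] by blast
    qed
    then show "?xi \<in> part (dual n M) q"
      using xi part_closed by (auto simp: dual_simps)
    have "?xi u = 1" using e(2) top_coefficient_eq[OF z, of 1] by simp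
    then show "?xi \<noteq> \<zero>\<^bsub>dual n M\<^esub>" using e(2) by (auto simp: dual_simps dest!: fun_cong[of _ _ u])
  next
    fix p w f assume "weight_vector n p w f \<and> 0 < pairing n (\<lambda>i. - x i) w"
    then have f: "weight_vector n p w f" "pairing n x w < 0" by (auto simp: pairing_neg_left)
    show "act (dual n M) f ?xi = \<zero>\<^bsub>dual n M\<^esub>"
    proof (rule functionals_eqI)
      show "act (dual n M) f ?xi \<in> functionals" by (rule dual_act_functional[OF xi weight_vector_periplectic[OF f(1)]])
      show "\<zero>\<^bsub>dual n M\<^esub> \<in> functionals" using D.zero_closed by (simp add: dual_simps)
      fix y assume y: "y \<in> carrier M"
      have "parity_twist p (act M f y) \<in> lower_part" by (rule low_twist[OF act_negative_low[OF f y]])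
      then show "act (dual n M) f ?xi y = \<zero>\<^bsub>dual n M\<^esub> y"
        using dual_act_hom[OF xi weight_vector_hom_part[OF f(1)] y] y low_carrier top_coefficient_low by (simp add: dual_simps)
    qed
  next
    fix f assume f: "weight_vector n 0 (\<lambda>_. 0) f"
    show "act (dual n M) f ?xi = torus_weight n f (\<lambda>i. - nu i) \<odot>\<^bsub>dual n M\<^esub> ?xi"
    proof (rule functionals_eqI)
      have "?xi \<in> carrier (dual n M)" using xi by (simp add: dual_simps)
      then show "torus_weight n f (\<lambda>i. - nu i) \<odot>\<^bsub>dual n M\<^esub> ?xi \<in> functionals"
        using D.scale_closed by (simp add: dual_simps(1))
      show "act (dual n M) f ?xi \<in> functionals" by (rule dual_act_functional[OF xi weight_vector_periplectic[OF f]])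
      fix y assume y: "y \<in> carrier M"
      obtain l where l: "l \<in> lower_part" "y = top_coefficient y \<odot> u \<oplus> l" using top_decompose[OF y] .
      have "act M f y = top_coefficient y \<odot> (torus_weight n f nu \<odot> u) \<oplus> act M f l"
        using wv_act_add[OF f, of "top_coefficient y \<odot> u" l] wv_act_scale[OF f] e(2) e(5)[OF f] l low_carrier by simp
      then have "act M f y = (torus_weight n f nu * top_coefficient y) \<odot> u \<oplus> act M f l"
        using e(2) by (simp add: scale_scale mult.commute)
      moreover have "act M f l \<in> lower_part" using low_act[OF f l(1)] by simp
      ultimately have "top_coefficient (act M f y) = torus_weight n f nu * top_coefficient y"
        using top_coefficient_eq by simp
      moreover have "torus_weight n f (\<lambda>i. - nu i) = - torus_weight n f nu"
        by (simp add: torus_weight_def sum_negf)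
      ultimately show "act (dual n M) f ?xi y = (torus_weight n f (\<lambda>i. - nu i) \<odot>\<^bsub>dual n M\<^esub> ?xi) y"
        using dual_act_hom[OF xi weight_vector_hom_part[OF f] y] y wv_act_closed[OF f y]
        by (simp add: dual_simps parity_twist_def)
    qed
  qed
qed

end

lemma grading_elt_neg: "y \<in> carrier M \<Longrightarrow> act M (grading_elt n (\<lambda>i. - x i)) y = (- 1) \<odot> act M (grading_elt n x) y"
proof -
  assume y: "y \<in> carrier M"
  have "grading_elt n (\<lambda>i. - x i) = (- 1) \<cdot>\<^sub>m grading_elt n x"
    by (auto simp: grading_elt_def torus_mat_def intro!: eq_matI)
  then show ?thesis using act_smult_mat[OF grading_elt_weight y, of "- 1" x] by simp
qed

section \<open>Finite dimension and simplicity of the dual\<close>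

text \<open>Seen from v, words of length k in negative root vectors have degree at most that of v
  minus k. Seen from u, which is extremal for -x, the degrees are bounded below. So long words
  vanish, and the finitely many short ones span.\<close>

lemma finite_dimensional:
  assumes reg: "regular n x" "regular n (\<lambda>i. - x i)"
    and v: "extremal n M x nu q v" and u: "extremal n M (\<lambda>i. - x i) nu' q' u"
  shows "\<exists>B. finite B \<and> B \<subseteq> carrier M \<and> carrier M = lin_span B"
proof -
  \<comment> \<open>Finitely many negative root vectors, of which every nonzero weight vector with
    negative pairing is a multiple.\<close>
  define Rts where "Rts = {e \<in> (\<lambda>(i, j). E_mat n i j) ` ({..<n} \<times> {..<n}) \<union> (\<lambda>(i, j). B_mat n i j) ` ({..<n} \<times> {..<n})
    \<union> (\<lambda>(i, j). C_mat n i j) ` ({..<n} \<times> {..<n}). \<exists>p w. weight_vector n p w e \<and> pairing n x w < 0}"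
  have finRts: "finite Rts" unfolding Rts_def by auto
  define U where "U k = ((\<lambda>S. (\<lambda>(e, y). act M e y) ` (Rts \<times> S)) ^^ k) {v}" for k
  have USuc: "U (Suc k) = (\<lambda>(e, y). act M e y) ` (Rts \<times> U k)" for k
    unfolding U_def by simp
  have U0: "U 0 = {v}" unfolding U_def by simp
  have Ufin: "finite (U k)" for k
    by (induction k) (auto simp: U0 USuc finRts)
  have Ueig: "y \<in> carrier M \<and> (\<exists>d\<le>pairing n x nu - int k. act M (grading_elt n x) y = of_int d \<odot> y)" if "y \<in> U k" for y k
    using that
  proof (induction k arbitrary: y)
    case 0
    then show ?case using extremalD[OF v] by (auto simp: U0)
  next
    case (Suc k)
    then obtain e z where ez: "e \<in> Rts" "z \<in> U k" "y = act M e z" unfolding USuc by auto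
    obtain p w where we: "weight_vector n p w e" "pairing n x w < 0" using ez(1) unfolding Rts_def by auto
    obtain d where d: "z \<in> carrier M" "d \<le> pairing n x nu - int k" "act M (grading_elt n x) z = of_int d \<odot> z"
      using Suc(1)[OF ez(2)] by auto
    have "act M (grading_elt n x) y = of_int d \<odot> y \<oplus> of_int (pairing n x w) \<odot> y"
      unfolding ez(3) act_torus_comm[OF grading_elt_weight we(1) d(1)] d(3) grading_elt_torus_weight
      using wv_act_scale[OF we(1) d(1)] by simp
    then have "act M (grading_elt n x) y = of_int (d + pairing n x w) \<odot> y"
      using wv_act_closed[OF we(1) d(1)] ez(3) by (simp add: scale_add_left)
    then show ?case
      using wv_act_closed[OF we(1) d(1)] ez(3) d(2) we(2) by (intro conjI exI[of _ "d + pairing n x w"]) auto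
  qed
  \<comment> \<open>One above the largest eigenvalue of the opposite grading element, so that every
    vector lies below K for -x.\<close>
  define K where "K = pairing n (\<lambda>i. - x i) nu' + 1"
  have all_low: "y \<in> low n M (\<lambda>i. - x i) K" if y: "y \<in> carrier M" for y
  proof -
    obtain c l where l: "l \<in> low n M (\<lambda>i. - x i) (pairing n (\<lambda>i. - x i) nu')" "y = c \<odot> u \<oplus> l"
      using extremal_decompose[OF reg(2) u y] .
    have "u \<in> low n M (\<lambda>i. - x i) K"
      by (rule low_eigen[OF extremalD(2,6)[OF u]]) (simp add: K_def)
    moreover have "l \<in> low n M (\<lambda>i. - x i) K"
      using l(1) low_mono[of _ K "\<lambda>i. - x i"] unfolding K_def by (meson less_add_one less_imp_le subsetD)
    ultimately show ?thesis unfolding l(2) by (intro lin_subspaceD(3,4)[OF low_subspace])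
  qed
  \<comment> \<open>Length N pushes the degree d so far down that -d is at least K.\<close>
  define N where "N = nat (pairing n x nu + K)"
  have UN: "y = \<zero>" if "y \<in> U N" for y
  proof -
    obtain d where d: "y \<in> carrier M" "d \<le> pairing n x nu - int N" "act M (grading_elt n x) y = of_int d \<odot> y"
      using Ueig[OF \<open>y \<in> U N\<close>] by auto
    have "act M (grading_elt n (\<lambda>i. - x i)) y = of_int (- d) \<odot> y"
      using grading_elt_neg[OF d(1)] d by (simp add: scale_scale)
    moreover have "K \<le> - d" using d(2) unfolding N_def by linarith
    ultimately show ?thesis using low_eigen_zero[OF all_low[OF d(1)]] by blast
  qed
  define B where "B = (\<Union>k\<le>N. U k)"
  have Bc: "B \<subseteq> carrier M" using Ueig unfolding B_def by blast
  have closed: "act M e y \<in> lin_span B" if e: "e \<in> Rts" and y: "y \<in> lin_span B" for e y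
  proof -
    obtain p w where we: "weight_vector n p w e" using e unfolding Rts_def by auto
    from y show ?thesis
    proof induction
      case (base b)
      then obtain k where k: "k \<le> N" "b \<in> U k" unfolding B_def by auto
      have s: "act M e b \<in> U (Suc k)" using e k(2) unfolding USuc by auto
      show ?case
      proof (cases "k = N")
        case True
        then have "b = \<zero>" using UN k(2) by simp
        then show ?thesis using wv_act_zero[OF we] lin_span.zero by simp
      next
        case False
        then have "act M e b \<in> B" using s k(1) unfolding B_def by (intro UN_I[of "Suc k"]) auto
        then show ?thesis by (rule lin_span.base)
      qed
    next
      case zero
      then show ?case using wv_act_zero[OF we] lin_span.zero by simp
    next
      case (add v w)
      then show ?case using wv_act_add[OF we] lin_span_closed[OF Bc] lin_span.add by simp
    next
      case (scale v c)
      then show ?case using wv_act_scale[OF we] lin_span_closed[OF Bc] lin_span.scale by simp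
    qed
  qed
  have "y \<in> lin_span B" if "y \<in> lower_span n M x v" for y
    using that
  proof (induction rule: lower_span.induct)
    case base
    have "v \<in> B" unfolding B_def by (rule UN_I[of 0]) (auto simp: U0)
    then show ?case by (rule lin_span.base)
  next
    case (act p w z y)
    have yc: "y \<in> carrier M" using lin_span_closed[OF Bc act.IH] .
    show ?case
    proof (cases "z = 0\<^sub>m (n + n) (n + n)")
      case True
      then show ?thesis using act_zero_mat[OF yc] lin_span.zero by simp
    next
      case nz: False
      have "w \<noteq> (\<lambda>_. 0)" using act(2) by auto
      with act(1) nz have "\<exists>c. \<exists>e\<in>Rts. z = c \<cdot>\<^sub>m e"
      proof (cases rule: weight_vector_cases)
        case (E i j c)
        then have "E_mat n i j \<in> Rts" using weight_vector_E_mat[of i n j] act(2) unfolding Rts_def by blast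
        then show ?thesis using E by blast
      next
        case (B i j c)
        then have "B_mat n i j \<in> Rts" using weight_vector_B_mat[of i n j] act(2) unfolding Rts_def by fastforce
        then show ?thesis using B by blast
      next
        case (C i j c)
        then have "C_mat n i j \<in> Rts" using weight_vector_C_mat[of i n j] act(2) unfolding Rts_def by fastforce
        then show ?thesis using C by blast
      qed
      then obtain c e where e: "e \<in> Rts" "z = c \<cdot>\<^sub>m e" by blast
      then obtain p w where "weight_vector n p w e" unfolding Rts_def by auto
      then have "act M z y = c \<odot> act M e y" unfolding e(2) using act_smult_mat yc by blast
      then show ?thesis using closed[OF e(1) act.IH] lin_span.scale by simp
    qed
  qed (auto intro: lin_span.intros)
  then have "carrier M \<subseteq> lin_span B" using lower_span_eq_carrier[OF reg(1) v] by blast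
  then show ?thesis
    using Bc lin_span_closed[OF Bc] Ufin by (intro exI[of _ B]) (auto simp: B_def)
qed

text \<open>The annihilator A of a graded submodule N of the dual is a graded submodule of M, hence
  everything or zero. In the first case N is zero. In the second, finitely many functionals of N
  already have zero common kernel, and every functional then lies in N.\<close>

lemma dual_simple:
  assumes B: "finite B" "B \<subseteq> carrier M" "carrier M = lin_span B"
    and u: "regular n x" "extremal n M x nu q u"
  shows "simple_psupermodule n (dual n M)"
  unfolding simple_psupermodule_def simple_psupermodule_axioms_def
proof (intro conjI allI impI)
  show "psupermodule n (dual n M)" by (rule dual_psupermodule)
  interpret D: psupermodule n "dual n M" by (rule dual_psupermodule)
  have step: "N = {\<zero>\<^bsub>dual n M\<^esub>} \<or> N = carrier (dual n M)" if gN: "graded_submodule (periplectic n) (dual n M) N" for N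
  proof -
    have sN: "D.lin_subspace N" and aN: "\<And>z f. z \<in> periplectic n \<Longrightarrow> f \<in> N \<Longrightarrow> act (dual n M) z f \<in> N"
      and pN: "N = (N \<inter> part (dual n M) 0) <+>\<^bsub>dual n M\<^esub> (N \<inter> part (dual n M) 1)"
      using gN unfolding graded_submodule_def D.submodule_iff_lin_subspace by blast+
    have Nf: "f \<in> functionals" if "f \<in> N" for f using D.lin_subspaceD(1)[OF sN] that by (auto simp: dual_simps)
    define A where "A = {y \<in> carrier M. \<forall>f\<in>N. f y = 0}"
    have Nproj: "\<exists>h\<in>N. \<forall>v\<in>carrier M. h v = f (proj M q v)" if f: "f \<in> N" for f q
    proof -
      obtain f0 f1 where f01: "f0 \<in> N \<inter> part (dual n M) 0" "f1 \<in> N \<inter> part (dual n M) 1" "f = f0 \<oplus>\<^bsub>dual n M\<^esub> f1"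
        using f pN unfolding set_add_def' by blast
      have ff: "f0 \<in> functionals" "f1 \<in> functionals" using f01 Nf by auto
      have "f0 v = f (proj M 0 v) \<and> f1 v = f (proj M 1 v)" if v: "v \<in> carrier M" for v
      proof -
        have p: "proj M 0 v \<in> carrier M" "proj M 1 v \<in> carrier M" using proj_closed[OF v] by auto
        have "f0 (proj M 1 v) = 0" "f1 (proj M 0 v) = 0"
          using f01 proj_part[OF v, of 1] proj_part[OF v, of 0] by (auto simp: dual_simps)
        then show ?thesis
          using functionalsD(2)[OF ff(1) p] functionalsD(2)[OF ff(2) p] proj_sum[OF v, of 0] p f01(3)
          by (simp add: dual_simps)
      qed
      then show ?thesis using f01 bit_exhaust[of q] by blast
    qed
    have gA: "graded_submodule (periplectic n) M A"
      unfolding graded_submodule_def submodule_iff_lin_subspace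
    proof (intro conjI ballI)
      show "lin_subspace A"
        unfolding A_def using Nf functionals_zero by (intro lin_subspaceI) (auto simp: functionalsD)
      show "A = (A \<inter> part M 0) <+>\<^bsub>M\<^esub> (A \<inter> part M 1)"
      proof (intro equalityI subsetI)
        fix y assume y: "y \<in> A"
        then have yc: "y \<in> carrier M" by (simp add: A_def)
        have "proj M q y \<in> A \<inter> part M q" for q
        proof -
          have "f (proj M q y) = 0" if "f \<in> N" for f
            using Nproj[OF that, of q] y unfolding A_def by auto
          then show ?thesis using proj_part[OF yc] proj_closed[OF yc] unfolding A_def by auto
        qed
        then show "y \<in> (A \<inter> part M 0) <+>\<^bsub>M\<^esub> (A \<inter> part M 1)"
          using proj_sum[OF yc, of 0] unfolding set_add_def' by fastforce
      next
        fix y assume "y \<in> (A \<inter> part M 0) <+>\<^bsub>M\<^esub> (A \<inter> part M 1)"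
        then show "y \<in> A"
          unfolding set_add_def' A_def using Nf by (auto simp: functionalsD)
      qed
      fix z y assume z: "z \<in> periplectic n" and y: "y \<in> A"
      then have yc: "y \<in> carrier M" by (simp add: A_def)
      have "f (act M z y) = 0" if f: "f \<in> N" for f
      proof -
        have hp: "f (act M z' y) = 0" if z': "z' \<in> hom_part n (periplectic n) p" for z' p
        proof -
          have z'g: "z' \<in> periplectic n" using hom_part_subset[OF z'] .
          have ac: "act M z' y \<in> carrier M" using act_closed[OF z'g yc] .
          have tw: "h (parity_twist p (act M z' y)) = 0" if "h \<in> N" for h
            using aN[OF z'g that] dual_act_hom[OF Nf[OF that] z' yc] y unfolding A_def by fastforce
          \<comment> \<open>The action on N controls functionals on twisted vectors only. As N is
            graded, the parity components of the twisted vector are killed too, and twisting a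
            second time recovers the vector.\<close>
          have pr: "h (proj M q (parity_twist p (act M z' y))) = 0" if "h \<in> N" for h q
            using Nproj[OF that, of q] tw twist_closed[OF ac] by metis
          have "parity_twist p (parity_twist p (act M z' y)) = act M z' y"
            unfolding twist_twist[OF ac] bit_add_self by (simp add: parity_twist_def)
          moreover have "f (parity_twist p (parity_twist p (act M z' y))) = 0"
          proof (cases "p = 0")
            case True
            then show ?thesis using tw[OF f] by (simp add: parity_twist_def)
          next
            case False
            let ?t = "parity_twist p (act M z' y)"
            have "parity_twist p ?t = proj M 0 ?t \<oplus> (- 1) \<odot> proj M 1 ?t"
              using False by (simp add: parity_twist_def)
            then show ?thesis
              using pr[OF f] proj_closed[OF twist_closed[OF ac]] by (simp add: functionalsD[OF Nf[OF f]])
          qed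
          ultimately show ?thesis by simp
        qed
        have "z = hom_comp n 0 z + hom_comp n 1 z"
          using hom_comp_sum z periplectic_carrier by (metis subsetD)
        then have "act M z y = act M (hom_comp n 0 z) y \<oplus> act M (hom_comp n 1 z) y"
          using add_act[OF hom_part_subset[OF hom_comp_hom_part[OF z]] hom_part_subset[OF hom_comp_hom_part[OF z]] yc] by metis
        then show ?thesis
          using hp[OF hom_comp_hom_part[OF z]] act_closed[OF hom_part_subset[OF hom_comp_hom_part[OF z]] yc]
          by (simp add: functionalsD[OF Nf[OF f]])
      qed
      then show "act M z y \<in> A" unfolding A_def using act_closed[OF z yc] by simp
    qed
    from simple[OF gA] show ?thesis
    proof
      assume A: "A = carrier M"
      have "f = \<zero>\<^bsub>dual n M\<^esub>" if f: "f \<in> N" for f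
      proof (rule functionals_eqI[OF Nf[OF f]])
        show "\<zero>\<^bsub>dual n M\<^esub> \<in> functionals" using D.zero_closed by (simp add: dual_simps)
        show "f v = \<zero>\<^bsub>dual n M\<^esub> v" if "v \<in> carrier M" for v
          using that f A unfolding A_def by (auto simp: dual_simps)
      qed
      then show ?thesis using D.lin_subspaceD(2)[OF sN] by blast
    next
      assume A: "A = {\<zero>}"
      have lN: "linear_functional f" if "f \<in> N" for f using functionals_linear[OF Nf[OF that]] .
      obtain F where F: "finite F" "F \<subseteq> N" "\<forall>y\<in>lin_span B. (\<forall>f\<in>F. f y = 0) \<longrightarrow> (\<forall>f\<in>N. f y = 0)"
        using finitely_many_functionals_suffice[OF B(1,2), of N] lN by blast
      have comb: "\<exists>k\<in>N. \<forall>y\<in>carrier M. k y = a * f y + b * h y" if fh: "f \<in> N" "h \<in> N" for f h a b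
      proof -
        have "a \<odot>\<^bsub>dual n M\<^esub> f \<oplus>\<^bsub>dual n M\<^esub> b \<odot>\<^bsub>dual n M\<^esub> h \<in> N"
          using D.lin_subspaceD(3,4)[OF sN] fh by blast
        then show ?thesis by (rule bexI[rotated]) (auto simp: dual_simps)
      qed
      have "g \<in> N" if g: "g \<in> carrier (dual n M)" for g
      proof -
        have gf: "g \<in> functionals" using g by (simp add: dual_simps)
        have "g y = 0" if y: "y \<in> carrier M" "\<forall>f\<in>F. f y = 0" for y
        proof -
          have "y \<in> A" using F(3) y B(3) unfolding A_def by auto
          then show ?thesis using A functionals_zero[OF gf] by simp
        qed
        then have "\<exists>h\<in>N. \<forall>y\<in>carrier M. g y = h y"
          using functional_in_span[OF F(1,2) lN D.lin_subspaceD(2)[OF sN] comb functionals_linear[OF gf], of "carrier M"]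
            carrier_is_submodule submodule_iff_lin_subspace by blast
        then obtain h where h: "h \<in> N" "\<forall>y\<in>carrier M. g y = h y" by blast
        then have "g = h" using functionals_eqI[OF gf Nf[OF h(1)]] by blast
        then show ?thesis using h(1) by simp
      qed
      then show ?thesis using D.lin_subspaceD(1)[OF sN] by blast
    qed
  qed
  then show "graded_submodule (periplectic n) (dual n M) N \<Longrightarrow> N = {\<zero>\<^bsub>dual n M\<^esub>} \<or> N = carrier (dual n M)" for N .
  show "carrier (dual n M) \<noteq> {\<zero>\<^bsub>dual n M\<^esub>}"
    using D.extremalD(2,3)[OF dual_extremal[OF u]] by blast
qed

end

section \<open>Uniqueness of simple supermodules with a given extremal vector\<close>

lemma (in cspace) eqI_scale:
  assumes "a \<in> carrier M" "b \<in> carrier M" "a \<oplus> (- 1) \<odot> b = \<zero>"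
  shows "a = b"
  using assms by (simp add: neg_eq_scale[symmetric] add.inv_solve_right')

text \<open>Closure under the parity projections is easier to transfer between modules than a
  decomposition as a sum of two sets.\<close>

lemma (in psupermodule) graded_submodule_iff:
  "graded_submodule (periplectic n) M S \<longleftrightarrow> lin_subspace S \<and> (\<forall>z\<in>periplectic n. \<forall>y\<in>S. act M z y \<in> S) \<and>
     (\<forall>y\<in>S. \<forall>q. proj M q y \<in> S)"
proof -
  have "S = (S \<inter> part M 0) <+> (S \<inter> part M 1) \<longleftrightarrow> (\<forall>y\<in>S. \<forall>q. proj M q y \<in> S)" if S: "lin_subspace S"
  proof
    assume e: "S = (S \<inter> part M 0) <+> (S \<inter> part M 1)"
    show "\<forall>y\<in>S. \<forall>q. proj M q y \<in> S"
    proof (intro ballI allI)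
      fix y q assume "y \<in> S"
      then obtain a b where ab: "a \<in> S \<inter> part M 0" "b \<in> S \<inter> part M 1" "y = a \<oplus> b"
        using e unfolding set_add_def' by blast
      then have "proj M 0 y = a" "proj M 1 (b \<oplus> a) = b" using proj_eq[of a 0 b] proj_eq[of b 1 a] by simp_all
      moreover have "y = b \<oplus> a" using ab part_closed[of a 0] part_closed[of b 1] a_comm[of a b] by simp
      ultimately show "proj M q y \<in> S" using ab bit_exhaust[of q] by auto
    qed
  next
    assume p: "\<forall>y\<in>S. \<forall>q. proj M q y \<in> S"
    show "S = (S \<inter> part M 0) <+> (S \<inter> part M 1)"
    proof (intro equalityI subsetI)
      fix y assume y: "y \<in> S"
      then have yc: "y \<in> carrier M" using lin_subspaceD(1)[OF S] by blast
      have "proj M q y \<in> S \<inter> part M q" for q using p y proj_part[OF yc] by blast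
      then show "y \<in> (S \<inter> part M 0) <+> (S \<inter> part M 1)"
        using proj_sum[OF yc, of 0] unfolding set_add_def' by fastforce
    qed (use lin_subspaceD(3)[OF S] in \<open>auto simp: set_add_def'\<close>)
  qed
  then show ?thesis
    unfolding graded_submodule_def submodule_iff_lin_subspace by blast
qed

text \<open>The surrounding module for the graph of the isomorphism in
  \<open>simple_unique\<close>.\<close>

definition direct_sum :: "'v smod \<Rightarrow> 'w smod \<Rightarrow> ('v \<times> 'w) smod" where
  "direct_sum M M' = \<lparr>carrier = carrier M \<times> carrier M', monoid.mult = undefined, one = undefined,
     ring.zero = (\<zero>\<^bsub>M\<^esub>, \<zero>\<^bsub>M'\<^esub>),
     add = (\<lambda>a b. (fst a \<oplus>\<^bsub>M\<^esub> fst b, snd a \<oplus>\<^bsub>M'\<^esub> snd b)),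
     module.smult = (\<lambda>c a. (c \<odot>\<^bsub>M\<^esub> fst a, c \<odot>\<^bsub>M'\<^esub> snd a)),
     part = (\<lambda>p. part M p \<times> part M' p),
     act = (\<lambda>x a. (act M x (fst a), act M' x (snd a)))\<rparr>"

lemma direct_sum_simps [simp]:
  "carrier (direct_sum M M') = carrier M \<times> carrier M'"
  "\<zero>\<^bsub>direct_sum M M'\<^esub> = (\<zero>\<^bsub>M\<^esub>, \<zero>\<^bsub>M'\<^esub>)"
  "a \<oplus>\<^bsub>direct_sum M M'\<^esub> b = (fst a \<oplus>\<^bsub>M\<^esub> fst b, snd a \<oplus>\<^bsub>M'\<^esub> snd b)"
  "c \<odot>\<^bsub>direct_sum M M'\<^esub> a = (c \<odot>\<^bsub>M\<^esub> fst a, c \<odot>\<^bsub>M'\<^esub> snd a)"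
  "part (direct_sum M M') p = part M p \<times> part M' p"
  "act (direct_sum M M') x a = (act M x (fst a), act M' x (snd a))"
  by (simp_all add: direct_sum_def)

lemma direct_sum_psupermodule:
  fixes M :: "'v smod" and M' :: "'w smod"
  assumes "psupermodule n M" "psupermodule n M'"
  shows "psupermodule n (direct_sum M M')"
proof -
  interpret A: psupermodule n M by (rule assms(1))
  interpret B: psupermodule n M' by (rule assms(2))
  let ?D = "direct_sum M M'"
  have mod: "Module.module complex_ring ?D"
  proof (rule moduleI)
    show "abelian_group ?D"
    proof (rule abelian_groupI)
      fix a assume a: "a \<in> carrier ?D"
      then show "\<exists>b\<in>carrier ?D. b \<oplus>\<^bsub>?D\<^esub> a = \<zero>\<^bsub>?D\<^esub>"
        by (intro bexI[of _ "(\<ominus>\<^bsub>M\<^esub> fst a, \<ominus>\<^bsub>M'\<^esub> snd a)"]) (auto simp: A.l_neg B.l_neg)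
    qed (auto simp: A.a_ac B.a_ac)
  qed (auto simp: cring_complex_ring A.scale_add_left A.scale_add_right A.scale_scale B.scale_add_left B.scale_add_right B.scale_scale)
  interpret D: cspace ?D unfolding cspace_def by (rule mod)
  show ?thesis
    unfolding psupermodule_def
  proof (rule supermodule.intro[OF mod supermodule_axioms.intro])
    fix p
    show "submodule (part ?D p) complex_ring ?D"
      unfolding D.submodule_iff_lin_subspace
      using A.lin_subspaceD[OF A.part_subspace[of p]] B.lin_subspaceD[OF B.part_subspace[of p]]
      by (intro D.lin_subspaceI) auto
    show "carrier ?D = part ?D 0 <+>\<^bsub>?D\<^esub> part ?D 1"
    proof (intro equalityI subsetI)
      fix y assume "y \<in> carrier ?D"
      then obtain a b where y: "y = (a, b)" "a \<in> carrier M" "b \<in> carrier M'" by auto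
      obtain a0 a1 where a: "a0 \<in> part M 0" "a1 \<in> part M 1" "a = a0 \<oplus>\<^bsub>M\<^esub> a1" using A.part_decompose[OF y(2)] .
      obtain b0 b1 where b: "b0 \<in> part M' 0" "b1 \<in> part M' 1" "b = b0 \<oplus>\<^bsub>M'\<^esub> b1" using B.part_decompose[OF y(3)] .
      have "y = (a0, b0) \<oplus>\<^bsub>?D\<^esub> (a1, b1)" using y a b by simp
      moreover have "(a0, b0) \<in> part ?D 0" "(a1, b1) \<in> part ?D 1" using a b by auto
      ultimately show "y \<in> part ?D 0 <+>\<^bsub>?D\<^esub> part ?D 1" unfolding set_add_def' by blast
    qed (auto simp: set_add_def' A.part_closed B.part_closed)
    show "part ?D 0 \<inter> part ?D 1 = {\<zero>\<^bsub>?D\<^esub>}"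
      using A.part_inter B.part_inter by auto
  next
    fix x y v p q
    assume x: "x \<in> hom_part n (periplectic n) p" and y: "y \<in> hom_part n (periplectic n) q" and "v \<in> carrier ?D"
    then obtain a b where v: "v = (a, b)" "a \<in> carrier M" "b \<in> carrier M'" by auto
    note g = hom_part_subset[OF x] hom_part_subset[OF y]
    have cA: "act M x (act M y a) \<in> carrier M" "act M y (act M x a) \<in> carrier M"
      using A.act_closed g v by auto
    have cB: "act M' x (act M' y b) \<in> carrier M'" "act M' y (act M' x b) \<in> carrier M'"
      using B.act_closed g v by auto
    have "act ?D x (act ?D y v) \<in> carrier ?D" "koszul_sign p q \<odot>\<^bsub>?D\<^esub> act ?D y (act ?D x v) \<in> carrier ?D"
      using cA cB v by auto
    note m = D.minus_eq_scale[OF this]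
    show "act ?D (superbracket p q x y) v = act ?D x (act ?D y v) \<ominus>\<^bsub>?D\<^esub> koszul_sign p q \<odot>\<^bsub>?D\<^esub> act ?D y (act ?D x v)"
      unfolding m using cA cB
      by (simp add: v(1) A.act_superbracket[OF x y v(2)] B.act_superbracket[OF x y v(3)] A.minus_eq_scale B.minus_eq_scale)
  qed (auto simp: A.act_closed B.act_closed A.act_add B.act_add A.act_smult B.act_smult A.add_act B.add_act
      A.smult_act B.smult_act A.act_part B.act_part)
qed

text \<open>The submodule N of the direct sum generated by (v, v') is the graph of an isomorphism.
  Each projection of N is onto by simplicity. Its kernel is zero or everything, again by simplicity,
  and it is not everything since v and v' occur in N with equal coefficients only.\<close>

lemma simple_unique:
  fixes M :: "'v smod" and M' :: "'w smod"
  assumes M: "simple_psupermodule n M" and M': "simple_psupermodule n M'" and reg: "regular n x"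
    and v: "extremal n M x nu q v" and v': "extremal n M' x nu q v'"
  shows "smod_iso (periplectic n) M' M"
proof -
  interpret A: simple_psupermodule n M by (rule M)
  interpret B: simple_psupermodule n M' by (rule M')
  let ?D = "direct_sum M M'"
  interpret D: psupermodule n ?D
    by (rule direct_sum_psupermodule[OF A.psupermodule_axioms B.psupermodule_axioms])
  note ev = A.extremalD[OF v] and ev' = B.extremalD[OF v']
  have ext: "extremal n ?D x nu q (v, v')"
    using v v' unfolding extremal_def by auto
  define N where "N = lower_span n ?D x (v, v')"
  have top: "(v, v') \<in> N" unfolding N_def by (rule lower_span.base)
  have gN: "D.lin_subspace N" "\<And>z y. z \<in> periplectic n \<Longrightarrow> y \<in> N \<Longrightarrow> act ?D z y \<in> N" "\<And>y q. y \<in> N \<Longrightarrow> proj ?D q y \<in> N"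
    using D.lower_span_graded[OF reg ext] unfolding D.graded_submodule_iff N_def by blast+
  note sN = D.lin_subspaceD[OF gN(1)]
  have Nc: "a \<in> carrier M" "b \<in> carrier M'" if "(a, b) \<in> N" for a b
    using sN(1) that by auto
  have projD: "proj ?D r (a, b) = (proj M r a, proj M' r b)" if "a \<in> carrier M" "b \<in> carrier M'" for r a b
    using D.proj_eq[of "(proj M r a, proj M' r b)" r "(proj M (r + 1) a, proj M' (r + 1) b)"]
      A.proj_part[OF that(1)] B.proj_part[OF that(2)] A.proj_sum[OF that(1), of r] B.proj_sum[OF that(2), of r]
    by simp
  have Nadd: "(a \<oplus>\<^bsub>M\<^esub> a', b \<oplus>\<^bsub>M'\<^esub> b') \<in> N" if "(a, b) \<in> N" "(a', b') \<in> N" for a b a' b'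
    using sN(3)[OF that] by simp
  have Nscale: "(c \<odot>\<^bsub>M\<^esub> a, c \<odot>\<^bsub>M'\<^esub> b) \<in> N" if "(a, b) \<in> N" for a b c
    using sN(4)[OF that, of c] by simp
  have Nact: "(act M z a, act M' z b) \<in> N" if "z \<in> periplectic n" "(a, b) \<in> N" for z a b
    using gN(2)[OF that] by simp
  have Nproj: "(proj M r a, proj M' r b) \<in> N" if "(a, b) \<in> N" for r a b
    using gN(3)[OF that, of r] projD[OF Nc[OF that]] by simp
  have N0: "(\<zero>\<^bsub>M\<^esub>, \<zero>\<^bsub>M'\<^esub>) \<in> N" using sN(2) by simp
  have p0: "proj M r \<zero>\<^bsub>M\<^esub> = \<zero>\<^bsub>M\<^esub>" "proj M' r \<zero>\<^bsub>M'\<^esub> = \<zero>\<^bsub>M'\<^esub>" for r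
    using A.proj_self[OF A.lin_subspaceD(2)[OF A.part_subspace]] B.proj_self[OF B.lin_subspaceD(2)[OF B.part_subspace]] by auto
  have lowD: "a \<in> low n M x k \<and> b \<in> low n M' x k" if low: "(a, b) \<in> low n ?D x k" for a b k
  proof -
    obtain cs where c: "a \<in> carrier M" "b \<in> carrier M'" "\<forall>c\<in>set cs. c < k" "foldr (shift n ?D x) cs (a, b) = (\<zero>\<^bsub>M\<^esub>, \<zero>\<^bsub>M'\<^esub>)"
      using low unfolding low_def by auto
    have "foldr (shift n ?D x) cs (a, b) = (foldr (shift n M x) cs a, foldr (shift n M' x) cs b)"
      by (induction cs) (simp_all add: shift_def)
    with c show ?thesis unfolding low_def by auto
  qed
  \<comment> \<open>Both coordinates share the coefficient c because N consists of multiples of (v,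
    v') plus elements of lower degree.\<close>
  have coeff: "\<exists>c. \<exists>l\<in>low n M x (pairing n x nu). \<exists>l'\<in>low n M' x (pairing n x nu). a = c \<odot>\<^bsub>M\<^esub> v \<oplus>\<^bsub>M\<^esub> l \<and> b = c \<odot>\<^bsub>M'\<^esub> v' \<oplus>\<^bsub>M'\<^esub> l'"
    if ab: "(a, b) \<in> N" for a b
  proof -
    obtain c l where cl: "l \<in> low n ?D x (pairing n x nu)" "(a, b) = c \<odot>\<^bsub>?D\<^esub> (v, v') \<oplus>\<^bsub>?D\<^esub> l"
      using D.lower_span_low[OF reg ext] ab unfolding N_def by blast
    then show ?thesis using lowD[of "fst l" "snd l"] by (cases l) auto
  qed
  have zl: "\<zero>\<^bsub>M\<^esub> \<in> low n M x (pairing n x nu)" "\<zero>\<^bsub>M'\<^esub> \<in> low n M' x (pairing n x nu)"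
    using A.lin_subspaceD(2)[OF A.low_subspace] B.lin_subspaceD(2)[OF B.low_subspace] by auto
  have not_left: "(v, \<zero>\<^bsub>M'\<^esub>) \<notin> N"
  proof
    assume "(v, \<zero>\<^bsub>M'\<^esub>) \<in> N"
    then obtain c l l' where cl: "l \<in> low n M x (pairing n x nu)" "l' \<in> low n M' x (pairing n x nu)"
      "v = c \<odot>\<^bsub>M\<^esub> v \<oplus>\<^bsub>M\<^esub> l" "\<zero>\<^bsub>M'\<^esub> = c \<odot>\<^bsub>M'\<^esub> v' \<oplus>\<^bsub>M'\<^esub> l'" using coeff by blast
    have "c \<odot>\<^bsub>M\<^esub> v \<oplus>\<^bsub>M\<^esub> l = 1 \<odot>\<^bsub>M\<^esub> v \<oplus>\<^bsub>M\<^esub> \<zero>\<^bsub>M\<^esub>" using cl(3) ev(2) by simp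
    then have "c = 1" using A.top_coefficient_unique[OF reg v cl(1) zl(1)] by blast
    moreover have "c \<odot>\<^bsub>M'\<^esub> v' \<oplus>\<^bsub>M'\<^esub> l' = 0 \<odot>\<^bsub>M'\<^esub> v' \<oplus>\<^bsub>M'\<^esub> \<zero>\<^bsub>M'\<^esub>" using cl(4)[symmetric] ev'(2) by simp
    then have "c = 0" using B.top_coefficient_unique[OF reg v' cl(2) zl(2)] by blast
    ultimately show False by simp
  qed
  have not_right: "(\<zero>\<^bsub>M\<^esub>, v') \<notin> N"
  proof
    assume "(\<zero>\<^bsub>M\<^esub>, v') \<in> N"
    then obtain c l l' where cl: "l \<in> low n M x (pairing n x nu)" "l' \<in> low n M' x (pairing n x nu)"
      "\<zero>\<^bsub>M\<^esub> = c \<odot>\<^bsub>M\<^esub> v \<oplus>\<^bsub>M\<^esub> l" "v' = c \<odot>\<^bsub>M'\<^esub> v' \<oplus>\<^bsub>M'\<^esub> l'" using coeff by blast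
    have "c \<odot>\<^bsub>M'\<^esub> v' \<oplus>\<^bsub>M'\<^esub> l' = 1 \<odot>\<^bsub>M'\<^esub> v' \<oplus>\<^bsub>M'\<^esub> \<zero>\<^bsub>M'\<^esub>" using cl(4) ev'(2) by simp
    then have "c = 1" using B.top_coefficient_unique[OF reg v' cl(2) zl(2)] by blast
    moreover have "c \<odot>\<^bsub>M\<^esub> v \<oplus>\<^bsub>M\<^esub> l = 0 \<odot>\<^bsub>M\<^esub> v \<oplus>\<^bsub>M\<^esub> \<zero>\<^bsub>M\<^esub>" using cl(3)[symmetric] ev(2) by simp
    then have "c = 0" using A.top_coefficient_unique[OF reg v cl(1) zl(1)] by blast
    ultimately show False by simp
  qed
  have kerA: "a = \<zero>\<^bsub>M\<^esub>" if "(a, \<zero>\<^bsub>M'\<^esub>) \<in> N" for a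
  proof -
    let ?K = "{a. (a, \<zero>\<^bsub>M'\<^esub>) \<in> N}"
    have "graded_submodule (periplectic n) M ?K"
      unfolding A.graded_submodule_iff
    proof (intro conjI ballI allI)
      show "A.lin_subspace ?K"
        by (rule A.lin_subspaceI) (use Nc N0 Nadd[of _ "\<zero>\<^bsub>M'\<^esub>" _ "\<zero>\<^bsub>M'\<^esub>"] Nscale[of _ "\<zero>\<^bsub>M'\<^esub>"] in auto)
      show "act M z a \<in> ?K" if "z \<in> periplectic n" "a \<in> ?K" for z a
        using Nact[of z a "\<zero>\<^bsub>M'\<^esub>"] that B.act_zero by simp
      show "proj M r a \<in> ?K" if "a \<in> ?K" for a r
        using Nproj[of a "\<zero>\<^bsub>M'\<^esub>" r] that p0 by simp
    qed
    from A.simple[OF this] show ?thesis using that not_left ev(2) by blast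
  qed
  have kerB: "b = \<zero>\<^bsub>M'\<^esub>" if "(\<zero>\<^bsub>M\<^esub>, b) \<in> N" for b
  proof -
    let ?K = "{b. (\<zero>\<^bsub>M\<^esub>, b) \<in> N}"
    have "graded_submodule (periplectic n) M' ?K"
      unfolding B.graded_submodule_iff
    proof (intro conjI ballI allI)
      show "B.lin_subspace ?K"
        by (rule B.lin_subspaceI) (use Nc N0 Nadd[of "\<zero>\<^bsub>M\<^esub>" _ "\<zero>\<^bsub>M\<^esub>"] Nscale[of "\<zero>\<^bsub>M\<^esub>"] in auto)
      show "act M' z b \<in> ?K" if "z \<in> periplectic n" "b \<in> ?K" for z b
        using Nact[of z "\<zero>\<^bsub>M\<^esub>" b] that A.act_zero by simp
      show "proj M' r b \<in> ?K" if "b \<in> ?K" for b r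
        using Nproj[of "\<zero>\<^bsub>M\<^esub>" b r] that p0 by simp
    qed
    from B.simple[OF this] show ?thesis using that not_right ev'(2) by blast
  qed
  have imA: "\<exists>b. (a, b) \<in> N" if "a \<in> carrier M" for a
  proof -
    have "graded_submodule (periplectic n) M (fst ` N)"
      unfolding A.graded_submodule_iff
    proof (intro conjI ballI allI)
      show "A.lin_subspace (fst ` N)"
      proof (rule A.lin_subspaceI)
        show "\<zero>\<^bsub>M\<^esub> \<in> fst ` N" using N0 by force
        show "a \<oplus>\<^bsub>M\<^esub> a' \<in> fst ` N" if "a \<in> fst ` N" "a' \<in> fst ` N" for a a'
          using that Nadd by force
        show "c \<odot>\<^bsub>M\<^esub> a \<in> fst ` N" if "a \<in> fst ` N" for c a
          using that Nscale by force
      qed (use Nc in auto)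
      show "act M z a \<in> fst ` N" if "z \<in> periplectic n" "a \<in> fst ` N" for z a
        using that Nact by force
      show "proj M r a \<in> fst ` N" if "a \<in> fst ` N" for a r
        using that Nproj by force
    qed
    moreover have "v \<in> fst ` N" using top by force
    ultimately have "fst ` N = carrier M" using A.simple ev(3) by blast
    then show ?thesis using that by force
  qed
  have imB: "\<exists>a. (a, b) \<in> N" if "b \<in> carrier M'" for b
  proof -
    have "graded_submodule (periplectic n) M' (snd ` N)"
      unfolding B.graded_submodule_iff
    proof (intro conjI ballI allI)
      show "B.lin_subspace (snd ` N)"
      proof (rule B.lin_subspaceI)
        show "\<zero>\<^bsub>M'\<^esub> \<in> snd ` N" using N0 by force
        show "b \<oplus>\<^bsub>M'\<^esub> b' \<in> snd ` N" if "b \<in> snd ` N" "b' \<in> snd ` N" for b b'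
          using that Nadd by force
        show "c \<odot>\<^bsub>M'\<^esub> b \<in> snd ` N" if "b \<in> snd ` N" for c b
          using that Nscale by force
      qed (use Nc in auto)
      show "act M' z b \<in> snd ` N" if "z \<in> periplectic n" "b \<in> snd ` N" for z b
        using that Nact by force
      show "proj M' r b \<in> snd ` N" if "b \<in> snd ` N" for b r
        using that Nproj by force
    qed
    moreover have "v' \<in> snd ` N" using top by force
    ultimately have "snd ` N = carrier M'" using B.simple ev'(3) by blast
    then show ?thesis using that by force
  qed
  have uniqA: "a = a'" if "(a, b) \<in> N" "(a', b) \<in> N" for a a' b
  proof -
    have "(a \<oplus>\<^bsub>M\<^esub> (- 1) \<odot>\<^bsub>M\<^esub> a', b \<oplus>\<^bsub>M'\<^esub> (- 1) \<odot>\<^bsub>M'\<^esub> b) \<in> N" using Nadd[OF that(1) Nscale[OF that(2)]] .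
    moreover have "b \<oplus>\<^bsub>M'\<^esub> (- 1) \<odot>\<^bsub>M'\<^esub> b = \<zero>\<^bsub>M'\<^esub>"
      using Nc(2)[OF that(1)] B.neg_eq_scale[of b] B.r_neg[of b] by simp
    ultimately have "a \<oplus>\<^bsub>M\<^esub> (- 1) \<odot>\<^bsub>M\<^esub> a' = \<zero>\<^bsub>M\<^esub>" using kerA by simp
    then show ?thesis using A.eqI_scale Nc(1)[OF that(1)] Nc(1)[OF that(2)] by blast
  qed
  have uniqB: "b = b'" if "(a, b) \<in> N" "(a, b') \<in> N" for a b b'
  proof -
    have "(a \<oplus>\<^bsub>M\<^esub> (- 1) \<odot>\<^bsub>M\<^esub> a, b \<oplus>\<^bsub>M'\<^esub> (- 1) \<odot>\<^bsub>M'\<^esub> b') \<in> N" using Nadd[OF that(1) Nscale[OF that(2)]] .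
    moreover have "a \<oplus>\<^bsub>M\<^esub> (- 1) \<odot>\<^bsub>M\<^esub> a = \<zero>\<^bsub>M\<^esub>"
      using Nc(1)[OF that(1)] A.neg_eq_scale[of a] A.r_neg[of a] by simp
    ultimately have "b \<oplus>\<^bsub>M'\<^esub> (- 1) \<odot>\<^bsub>M'\<^esub> b' = \<zero>\<^bsub>M'\<^esub>" using kerB by simp
    then show ?thesis using B.eqI_scale Nc(2)[OF that(1)] Nc(2)[OF that(2)] by blast
  qed
  define \<phi> where "\<phi> b = (THE a. (a, b) \<in> N)" for b
  have \<phi>: "\<phi> b = a" if "(a, b) \<in> N" for a b
    unfolding \<phi>_def using that uniqA by blast
  have \<phi>N: "(\<phi> b, b) \<in> N" if "b \<in> carrier M'" for b
    using imB[OF that] \<phi> by blast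
  have "\<phi> \<in> smod_hom (periplectic n) M' M"
    unfolding smod_hom_def
  proof (intro CollectI conjI ballI allI)
    show "\<phi> \<in> carrier M' \<rightarrow> carrier M" using \<phi>N Nc(1) by blast
    show "\<phi> (a \<oplus>\<^bsub>M'\<^esub> b) = \<phi> a \<oplus>\<^bsub>M\<^esub> \<phi> b" if "a \<in> carrier M'" "b \<in> carrier M'" for a b
      using \<phi>[OF Nadd[OF \<phi>N[OF that(1)] \<phi>N[OF that(2)]]] .
    show "\<phi> (c \<odot>\<^bsub>M'\<^esub> a) = c \<odot>\<^bsub>M\<^esub> \<phi> a" if "a \<in> carrier M'" for c a
      using \<phi>[OF Nscale[OF \<phi>N[OF that]]] .
    show "\<phi> (act M' z a) = act M z (\<phi> a)" if "z \<in> periplectic n" "a \<in> carrier M'" for z a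
      using \<phi>[OF Nact[OF that(1) \<phi>N[OF that(2)]]] .
    show "\<phi> ` part M' p \<subseteq> part M p" for p
    proof
      fix a assume "a \<in> \<phi> ` part M' p"
      then obtain b where b: "b \<in> part M' p" "a = \<phi> b" by blast
      have N: "(a, b) \<in> N" using \<phi>N[OF B.part_closed[OF b(1)]] b(2) by simp
      \<comment> \<open>Both a and its projection are paired with b, as b is homogeneous of parity
        p.\<close>
      have "proj M p a = a" by (rule uniqA[OF _ N]) (use Nproj[OF N, of p] B.proj_self[OF b(1)] in simp)
      then show "a \<in> part M p" using A.proj_part[OF Nc(1)[OF N], of p] by simp
    qed
  qed
  moreover have "bij_betw \<phi> (carrier M') (carrier M)"
  proof (rule bij_betw_imageI)
    show "inj_on \<phi> (carrier M')"
    proof (rule inj_onI)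
      fix b b' assume b: "b \<in> carrier M'" "b' \<in> carrier M'" "\<phi> b = \<phi> b'"
      show "b = b'" using uniqB[OF \<phi>N[OF b(1)]] \<phi>N[OF b(2)] b(3) by simp
    qed
    show "\<phi> ` carrier M' = carrier M"
    proof (intro equalityI subsetI)
      fix a assume "a \<in> carrier M"
      then obtain b where N: "(a, b) \<in> N" using imA by blast
      show "a \<in> \<phi> ` carrier M'" using \<phi>[OF N] Nc(2)[OF N] by blast
    next
      fix a assume "a \<in> \<phi> ` carrier M'"
      then obtain b where "b \<in> carrier M'" "a = \<phi> b" by blast
      then show "a \<in> carrier M" using Nc(1)[OF \<phi>N] by simp
    qed
  qed
  ultimately show ?thesis unfolding smod_iso_def by blast
qed

section \<open>The extremal vector of a quotient of an induced supermodule\<close>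

lemma lookup_pm_scale [simp]: "Poly_Mapping.lookup (pm_scale c f) k = c * Poly_Mapping.lookup f k"
  by (simp add: pm_scale_def Poly_Mapping.map.rep_eq when_def)

lemma pm_scale_single [simp]: "pm_scale c (Poly_Mapping.single k a) = Poly_Mapping.single k (c * a)"
  by (rule poly_mapping_eqI) (simp add: lookup_single when_def)

lemma keys_pm_scale: "Poly_Mapping.keys (pm_scale c f) \<subseteq> Poly_Mapping.keys f"
  by (auto simp: in_keys_iff)

lemma free_vs_simps [simp]:
  "carrier (free_vs S) = {f. Poly_Mapping.keys f \<subseteq> S}" "\<zero>\<^bsub>free_vs S\<^esub> = 0"
  "f \<oplus>\<^bsub>free_vs S\<^esub> h = f + h" "c \<odot>\<^bsub>free_vs S\<^esub> f = pm_scale c f"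
  by (simp_all add: free_vs_def)

lemma free_vs_cspace: "cspace (free_vs S)"
  unfolding cspace_def
proof (rule moduleI)
  show "abelian_group (free_vs S)"
  proof (rule abelian_groupI)
    fix f assume "f \<in> carrier (free_vs S)"
    then show "\<exists>h\<in>carrier (free_vs S). h \<oplus>\<^bsub>free_vs S\<^esub> f = \<zero>\<^bsub>free_vs S\<^esub>"
      by (intro bexI[of _ "- f"]) auto
  qed (auto simp: algebra_simps dest: subsetD[OF keys_add])
qed (auto simp: cring_complex_ring lookup_add algebra_simps intro!: poly_mapping_eqI dest: subsetD[OF keys_pm_scale])

lemma free_vs_induct:
  assumes "f \<in> carrier (free_vs S)" "P 0" "\<And>f h. P f \<Longrightarrow> P h \<Longrightarrow> P (f + h)"
    "\<And>c k. k \<in> S \<Longrightarrow> P (pm_scale c (Poly_Mapping.single k 1))"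
  shows "P f"
proof -
  have "finite A \<Longrightarrow> A \<subseteq> S \<Longrightarrow> P (\<Sum>k\<in>A. Poly_Mapping.single k (Poly_Mapping.lookup f k))" for A
  proof (induction A rule: finite_induct)
    case (insert k A)
    then show ?case using assms(3)[OF assms(4)[of k "Poly_Mapping.lookup f k"]] by simp
  qed (use assms(2) in simp)
  then have "P (\<Sum>k\<in>Poly_Mapping.keys f. Poly_Mapping.single k (Poly_Mapping.lookup f k))"
    using assms(1) by simp
  moreover have "(\<Sum>k\<in>Poly_Mapping.keys f. Poly_Mapping.single k (Poly_Mapping.lookup f k)) = f"
    by (rule poly_mapping_eqI) (auto simp: lookup_sum lookup_single when_def in_keys_iff)
  ultimately show ?thesis by simp
qed

text \<open>Keys of a sum or a multiple may disappear by cancellation, so terms are first expanded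
  over a common finite superset of the keys.\<close>

lemma prepend_superset:
  assumes "finite A" "Poly_Mapping.keys f \<subseteq> A"
  shows "prepend x f = (\<Sum>(u, v)\<in>A. Poly_Mapping.single (x # u, v) (Poly_Mapping.lookup f (u, v)))"
  unfolding prepend_def by (rule sum.mono_neutral_left) (use assms in \<open>auto simp: in_keys_iff\<close>)

lemma prepend_add: "prepend x (f + h) = prepend x f + prepend x h"
proof -
  let ?A = "Poly_Mapping.keys f \<union> Poly_Mapping.keys h"
  have k: "Poly_Mapping.keys (f + h) \<subseteq> ?A" by (rule keys_add)
  show ?thesis
    unfolding prepend_superset[OF _ k, simplified] prepend_superset[of ?A f, simplified] prepend_superset[of ?A h, simplified]
    by (simp add: sum.distrib[symmetric] split_def lookup_add single_add)
qed

lemma pm_scale_sum: "pm_scale c (\<Sum>k\<in>A. f k) = (\<Sum>k\<in>A. pm_scale c (f k))"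
  by (rule poly_mapping_eqI) (simp add: lookup_sum sum_distrib_left)

lemma prepend_scale: "prepend x (pm_scale c f) = pm_scale c (prepend x f)"
  unfolding prepend_superset[OF finite_keys keys_pm_scale] by (simp add: prepend_def pm_scale_sum split_def)

lemma prepend_tens [simp]: "prepend x (tens u v) = tens (x # u) v"
  by (simp add: prepend_def)

lemma prepend_minus: "prepend x (f - h) = prepend x f - prepend x h"
  by (metis add_diff_cancel diff_add_cancel prepend_add)

lemma (in cspace) lin_subspace_Inter:
  assumes "\<And>N. N \<in> A \<Longrightarrow> lin_subspace N" "A \<noteq> {}"
  shows "lin_subspace (\<Inter> A)"
proof (rule lin_subspaceI)
  show "\<Inter> A \<subseteq> carrier M" using assms lin_subspaceD(1) by blast
qed (use assms lin_subspaceD(2-4) in blast)+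

context
  fixes n :: nat and V :: "'v smod"
  assumes V: "supermodule n (periplectic_zero n) V"
begin

interpretation V: supermodule n "periplectic_zero n" V by (rule V)

lemma periplectic_zero_eq: "periplectic_zero n = hom_part n (periplectic n) 0"
proof (intro equalityI subsetI)
  fix x assume "x \<in> periplectic_zero n"
  then obtain A where A: "A \<in> carrier_mat n n" "x = gl_embed n A" unfolding periplectic_zero_def by auto
  show "x \<in> hom_part n (periplectic n) 0"
    unfolding A(2) gl_embed_def by (rule hom_partI) (use A(1) in auto)
next
  fix x assume x: "x \<in> hom_part n (periplectic n) 0"
  note D = hom_part_periplecticD[OF x]
  define A where "A = mat n n (\<lambda>(i, j). x $$ (i, j))"
  have "x = gl_embed n A"
  proof (rule eq_matI)
    fix r s assume "r < dim_row (gl_embed n A)" "s < dim_col (gl_embed n A)"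
    then have rs: "r < n + n" "s < n + n" by (auto simp: gl_embed_def A_def)
    show "x $$ (r, s) = gl_embed n A $$ (r, s)"
      using rs(1)
    proof (cases rule: row_cases)
      case r: 1
      show ?thesis
        using rs(2) by (cases rule: row_cases) (use r D(5)[of r] in \<open>auto simp: gl_embed_def A_def\<close>)
    next
      case r: (2 r')
      show ?thesis
        using rs(2) by (cases rule: row_cases) (use r D(6)[of r'] D(1)[of r'] in \<open>auto simp: gl_embed_def A_def\<close>)
    qed
  qed (use hom_part_carrier[OF x] in \<open>auto simp: gl_embed_def A_def\<close>)
  then show "x \<in> periplectic_zero n" unfolding periplectic_zero_def A_def by auto
qed

lemma periplectic_nonpos_subset: "x \<in> periplectic_nonpos n \<Longrightarrow> x \<in> periplectic n"
proof -
  assume "x \<in> periplectic_nonpos n"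
  then obtain A C where "x = four_block_mat A (0\<^sub>m n n) C (- transpose_mat A)"
    "A \<in> carrier_mat n n" "C \<in> carrier_mat n n" "transpose_mat C = - C"
    unfolding periplectic_nonpos_def by blast
  moreover have "0\<^sub>m n n \<in> carrier_mat n n" "transpose_mat (0\<^sub>m n n) = 0\<^sub>m n n" by auto
  ultimately show "x \<in> periplectic n" unfolding periplectic_def by blast
qed

abbreviation syms where "syms \<equiv> symbols (periplectic n) (inflate n V)"

abbreviation rels where "rels \<equiv> ind_relators n (periplectic n) (periplectic_nonpos n) (inflate n V)"

abbreviation relspan where "relspan \<equiv> free_span syms rels"

abbreviation coset where "coset f \<equiv> relspan +>\<^bsub>free_vs syms\<^esub> f"

interpretation F: cspace "free_vs syms" by (rule free_vs_cspace)

lemma inflate_simps [simp]: "carrier (inflate n V) = carrier V" "part (inflate n V) = part V"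
  "v \<oplus>\<^bsub>inflate n V\<^esub> w = v \<oplus>\<^bsub>V\<^esub> w" "c \<odot>\<^bsub>inflate n V\<^esub> v = c \<odot>\<^bsub>V\<^esub> v"
  "act (inflate n V) x = act V (hom_comp n 0 x)"
  by (simp_all add: inflate_def)

lemma tens_carrier: "u \<in> lists (periplectic n) \<Longrightarrow> v \<in> carrier V \<Longrightarrow> tens u v \<in> carrier (free_vs syms)"
  by (auto simp: symbols_def)

lemma F_minus: "f \<in> carrier (free_vs syms) \<Longrightarrow> h \<in> carrier (free_vs syms) \<Longrightarrow> f - h \<in> carrier (free_vs syms)"
  using keys_diff[of f h] by auto

lemma F_scale: "f \<in> carrier (free_vs syms) \<Longrightarrow> pm_scale c f \<in> carrier (free_vs syms)"
  using keys_pm_scale[of c f] by auto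

lemma act_inflate_closed: "x \<in> periplectic_nonpos n \<Longrightarrow> v \<in> carrier V \<Longrightarrow> act V (hom_comp n 0 x) v \<in> carrier V"
  using hom_comp_hom_part[OF periplectic_nonpos_subset, of x 0] V.act_closed unfolding periplectic_zero_eq by blast

lemma rels_carrier: "rels \<subseteq> carrier (free_vs syms)"
proof
  fix f assume "f \<in> rels"
  then show "f \<in> carrier (free_vs syms)"
  proof (cases rule: ind_relators.cases)
    case (letter_add u w x y v)
    then show ?thesis using periplectic_add[of x n y] unfolding letter_add(1) by (intro F_minus tens_carrier) auto
  next
    case (letter_smult u w x v c)
    then show ?thesis using periplectic_smult[of x n c] unfolding letter_smult(1) by (intro F_minus F_scale tens_carrier) auto
  next
    case (vector_add u v v')
    then show ?thesis unfolding vector_add(1) by (intro F_minus tens_carrier) auto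
  next
    case (vector_smult u v c)
    then show ?thesis unfolding vector_smult(1) by (intro F_minus F_scale tens_carrier) auto
  next
    case (enveloping u w x p y q v)
    have "superbracket p q x y \<in> periplectic n" "x \<in> periplectic n" "y \<in> periplectic n"
      using superbracket_hom_part[OF enveloping(4,5)] hom_part_subset enveloping(4,5) by blast+
    then show ?thesis using enveloping unfolding enveloping(1) by (intro F_minus F_scale tens_carrier) auto
  next
    case (balanced u x v)
    then show ?thesis using periplectic_nonpos_subset[of x] act_inflate_closed[of x v]
      unfolding balanced(1) inflate_simps by (intro F_minus tens_carrier) auto
  qed
qed

lemma relspan_eq: "relspan = \<Inter> {N. F.lin_subspace N \<and> rels \<subseteq> N}"
  unfolding free_span_def hull_def F.submodule_iff_lin_subspace by simp

lemma relspan_subspace: "F.lin_subspace relspan"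
  unfolding relspan_eq
proof (rule F.lin_subspace_Inter)
  have "F.lin_subspace (carrier (free_vs syms))" using F.carrier_is_submodule F.submodule_iff_lin_subspace by blast
  then show "{N. F.lin_subspace N \<and> rels \<subseteq> N} \<noteq> {}" using rels_carrier by blast
qed blast

lemma rels_relspan: "f \<in> rels \<Longrightarrow> f \<in> relspan"
  unfolding relspan_eq by blast

lemma relspan_least: "F.lin_subspace N \<Longrightarrow> rels \<subseteq> N \<Longrightarrow> relspan \<subseteq> N"
  unfolding relspan_eq by blast

lemma prepend_carrier:
  assumes x: "x \<in> periplectic n" and f: "f \<in> carrier (free_vs syms)"
  shows "prepend x f \<in> carrier (free_vs syms)"
  using f
proof (rule free_vs_induct)
  show "prepend x 0 \<in> carrier (free_vs syms)" by (simp add: prepend_def)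
  show "prepend x (f + h) \<in> carrier (free_vs syms)"
    if "prepend x f \<in> carrier (free_vs syms)" "prepend x h \<in> carrier (free_vs syms)" for f h
    using F.a_closed[OF that] by (simp add: prepend_add)
  show "prepend x (pm_scale c (Poly_Mapping.single k 1)) \<in> carrier (free_vs syms)" if ks: "k \<in> syms" for c k
  proof -
    obtain u v where k: "k = (u, v)" "u \<in> lists (periplectic n)" "v \<in> carrier V"
      using ks by (auto simp: symbols_def)
    then show ?thesis
      unfolding prepend_scale k(1) prepend_tens using x by (intro F_scale tens_carrier) auto
  qed
qed

text \<open>Every family of relators has an arbitrary word u on the left, so one more letter stays
  inside the family.\<close>

lemma prepend_rels:
  assumes x: "x \<in> periplectic n" and f: "f \<in> rels"
  shows "prepend x f \<in> rels"
  using f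
proof (cases rule: ind_relators.cases)
  case (letter_add u w y z v)
  then show ?thesis
    using ind_relators.letter_add[of "x # u" "periplectic n" w y z v] x
    by (simp add: prepend_minus)
next
  case (letter_smult u w y v c)
  then show ?thesis
    using ind_relators.letter_smult[of "x # u" "periplectic n" w y v "inflate n V" c] x
    by (simp add: prepend_minus prepend_scale del: pm_scale_single)
next
  case (vector_add u v v')
  then show ?thesis
    using ind_relators.vector_add[of "x # u" "periplectic n" v "inflate n V" v'] x
    by (simp add: prepend_minus)
next
  case (vector_smult u v c)
  then show ?thesis
    using ind_relators.vector_smult[of "x # u" "periplectic n" v "inflate n V" c] x
    by (simp add: prepend_minus prepend_scale del: pm_scale_single)
next
  case (enveloping u w y p z q v)
  then show ?thesis
    using ind_relators.enveloping[of "x # u" "periplectic n" w y n p z q v] x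
    by (simp add: prepend_minus prepend_scale del: pm_scale_single)
next
  case (balanced u y v)
  then show ?thesis
    using ind_relators.balanced[of "x # u" "periplectic n" y "periplectic_nonpos n" v "inflate n V"] x
    by (simp add: prepend_minus)
qed

text \<open>The vectors sent into the span by prepending x form a subspace that contains the
  relators.\<close>

lemma prepend_relspan:
  assumes x: "x \<in> periplectic n" and f: "f \<in> relspan"
  shows "prepend x f \<in> relspan"
proof -
  let ?N = "{f \<in> carrier (free_vs syms). prepend x f \<in> relspan}"
  note D = F.lin_subspaceD[OF relspan_subspace]
  have "F.lin_subspace ?N"
  proof (rule F.lin_subspaceI)
    show "\<zero>\<^bsub>free_vs syms\<^esub> \<in> ?N" using D(2) by (simp add: prepend_def)
    show "f \<oplus>\<^bsub>free_vs syms\<^esub> h \<in> ?N" if "f \<in> ?N" "h \<in> ?N" for f h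
      using that F.a_closed[of f h] D(3)[of "prepend x f" "prepend x h"] by (simp add: prepend_add)
    show "c \<odot>\<^bsub>free_vs syms\<^esub> f \<in> ?N" if "f \<in> ?N" for c f
      using that F.scale_closed[of f c] D(4)[of "prepend x f" c] by (simp add: prepend_scale)
  qed auto
  moreover have "rels \<subseteq> ?N" using prepend_rels[OF x] rels_relspan rels_carrier by blast
  ultimately show ?thesis using relspan_least f by blast
qed

interpretation R: abelian_subgroup relspan "free_vs syms"
proof -
  have "additive_subgroup relspan (free_vs syms)"
    using relspan_subspace unfolding F.submodule_iff_lin_subspace[symmetric]
    by (intro additive_subgroupI) (rule submodule.axioms(1))
  then show "abelian_subgroup relspan (free_vs syms)"
    by (intro abelian_subgroupI3) (use F.abelian_group_axioms in auto)
qed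

lemma mem_coset: "h \<in> coset f \<longleftrightarrow> (\<exists>r\<in>relspan. h = r + f)"
  unfolding a_r_coset_def' by auto

lemma coset_eq:
  assumes "f \<in> carrier (free_vs syms)" "r \<in> relspan"
  shows "coset (r + f) = coset f"
proof -
  have "r + f \<in> coset f" using assms(2) mem_coset by blast
  then show ?thesis using R.a_repr_independence'[OF _ assms(1)] by simp
qed

lemma coset_self: "f \<in> coset f"
  using F.lin_subspaceD(2)[OF relspan_subspace] mem_coset by force

abbreviation induced where "induced \<equiv> Ind n (periplectic n) (periplectic_nonpos n) (inflate n V)"

lemma induced_simps:
  "carrier induced = {coset f | f. f \<in> carrier (free_vs syms)}"
  "\<zero>\<^bsub>induced\<^esub> = relspan"
  by (auto simp: Ind_def Let_def A_RCOSETS_def' )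

lemma induced_add:
  assumes "f \<in> carrier (free_vs syms)" "h \<in> carrier (free_vs syms)"
  shows "coset f \<oplus>\<^bsub>induced\<^esub> coset h = coset (f + h)"
  using R.a_rcos_sum[OF assms] by (simp add: Ind_def Let_def)

text \<open>The operation on a coset is a union over representatives, which collapses because all of
  them lead to the same coset.\<close>

lemma induced_scale:
  assumes f: "f \<in> carrier (free_vs syms)"
  shows "c \<odot>\<^bsub>induced\<^esub> coset f = coset (pm_scale c f)"
proof -
  have "coset (pm_scale c h) = coset (pm_scale c f)" if h: "h \<in> coset f" for h
  proof -
    obtain r where r: "r \<in> relspan" "h = r + f" using h mem_coset by blast
    have "pm_scale c h = pm_scale c r + pm_scale c f"
      unfolding r(2) by (rule poly_mapping_eqI) (simp add: lookup_add algebra_simps)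
    then show ?thesis
      using coset_eq[OF F_scale[OF f]] F.lin_subspaceD(4)[OF relspan_subspace r(1), of c] by simp
  qed
  then have "(\<Union>h\<in>coset f. coset (pm_scale c h)) = coset (pm_scale c f)"
    using coset_self by blast
  then show ?thesis by (simp add: Ind_def Let_def)
qed

lemma induced_act:
  assumes x: "x \<in> periplectic n" and f: "f \<in> carrier (free_vs syms)"
  shows "act induced x (coset f) = coset (prepend x f)"
proof -
  have "coset (prepend x h) = coset (prepend x f)" if h: "h \<in> coset f" for h
  proof -
    obtain r where r: "r \<in> relspan" "h = r + f" using h mem_coset by blast
    then show ?thesis
      using coset_eq[OF prepend_carrier[OF x f] prepend_relspan[OF x r(1)]] by (simp add: prepend_add)
  qed
  then have "(\<Union>h\<in>coset f. coset (prepend x h)) = coset (prepend x f)"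
    using coset_self by blast
  then show ?thesis by (simp add: Ind_def Let_def)
qed

text \<open>The map \<psi> sends v to the image of 1 \<otimes> v. The balanced relators make it
  compatible with g_0 and g_(-1), and it cannot vanish since the tensors 1 \<otimes> v generate the
  induced module and \<phi> is onto a nonzero L.\<close>

lemma quotient_map:
  fixes L :: "'x smod"
  assumes L: "psupermodule n L" and nt: "carrier L \<noteq> {\<zero>\<^bsub>L\<^esub>}"
    and hom: "\<phi> \<in> smod_hom (periplectic n) induced L" and surj: "\<phi> ` carrier induced = carrier L"
    and even: "part V 1 = {\<zero>\<^bsub>V\<^esub>}"
  obtains \<psi> where "\<And>v. v \<in> carrier V \<Longrightarrow> \<psi> v \<in> part L 0"
    "\<And>v w. v \<in> carrier V \<Longrightarrow> w \<in> carrier V \<Longrightarrow> \<psi> (v \<oplus>\<^bsub>V\<^esub> w) = \<psi> v \<oplus>\<^bsub>L\<^esub> \<psi> w"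
    "\<And>c v. v \<in> carrier V \<Longrightarrow> \<psi> (c \<odot>\<^bsub>V\<^esub> v) = c \<odot>\<^bsub>L\<^esub> \<psi> v"
    "\<And>x v. x \<in> periplectic_nonpos n \<Longrightarrow> v \<in> carrier V \<Longrightarrow> act L x (\<psi> v) = \<psi> (act V (hom_comp n 0 x) v)"
    "\<exists>v\<in>carrier V. \<psi> v \<noteq> \<zero>\<^bsub>L\<^esub>"
proof -
  interpret L: psupermodule n L by (rule L)
  have h: "\<And>k. k \<in> carrier induced \<Longrightarrow> \<phi> k \<in> carrier L"
    "\<And>k l. k \<in> carrier induced \<Longrightarrow> l \<in> carrier induced \<Longrightarrow> \<phi> (k \<oplus>\<^bsub>induced\<^esub> l) = \<phi> k \<oplus>\<^bsub>L\<^esub> \<phi> l"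
    "\<And>c k. k \<in> carrier induced \<Longrightarrow> \<phi> (c \<odot>\<^bsub>induced\<^esub> k) = c \<odot>\<^bsub>L\<^esub> \<phi> k"
    "\<And>p. \<phi> ` part induced p \<subseteq> part L p"
    "\<And>x k. x \<in> periplectic n \<Longrightarrow> k \<in> carrier induced \<Longrightarrow> \<phi> (act induced x k) = act L x (\<phi> k)"
    using hom unfolding smod_hom_def by auto
  define \<Phi> where "\<Phi> f = \<phi> (coset f)" for f
  have ci: "coset f \<in> carrier induced" if "f \<in> carrier (free_vs syms)" for f
    using that unfolding induced_simps by blast
  have P: "\<Phi> f \<in> carrier L" if "f \<in> carrier (free_vs syms)" for f
    unfolding \<Phi>_def using h(1) ci that by blast
  have Padd: "\<Phi> (f + k) = \<Phi> f \<oplus>\<^bsub>L\<^esub> \<Phi> k" if "f \<in> carrier (free_vs syms)" "k \<in> carrier (free_vs syms)" for f k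
    unfolding \<Phi>_def using h(2)[OF ci[OF that(1)] ci[OF that(2)]] induced_add[OF that] by simp
  have Pscale: "\<Phi> (pm_scale c f) = c \<odot>\<^bsub>L\<^esub> \<Phi> f" if "f \<in> carrier (free_vs syms)" for c f
    unfolding \<Phi>_def using h(3)[OF ci[OF that]] induced_scale[OF that] by simp
  have Pact: "\<Phi> (prepend x f) = act L x (\<Phi> f)" if "x \<in> periplectic n" "f \<in> carrier (free_vs syms)" for x f
    unfolding \<Phi>_def using h(5)[OF that(1) ci[OF that(2)]] induced_act[OF that] by simp
  have z: "(0 :: 'v symb \<Rightarrow>\<^sub>0 complex) \<in> carrier (free_vs syms)" by simp
  have P0: "\<Phi> 0 = \<zero>\<^bsub>L\<^esub>"
  proof -
    have "pm_scale 0 0 = (0 :: 'v symb \<Rightarrow>\<^sub>0 complex)" by (rule poly_mapping_eqI) simp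
    then show ?thesis using Pscale[OF z, of 0] P[OF z] by simp
  qed
  have Prel: "\<Phi> f = \<Phi> k" if "f - k \<in> rels" "k \<in> carrier (free_vs syms)" for f k
    using coset_eq[OF that(2) rels_relspan[OF that(1)]] unfolding \<Phi>_def by simp
  have tc: "tens u v \<in> carrier (free_vs syms)" if "u \<in> lists (periplectic n)" "v \<in> carrier V" for u v
    using tens_carrier[OF that] .
  define \<psi> where "\<psi> v = \<Phi> (tens [] v)" for v
  have n: "[] \<in> lists (periplectic n)" by simp
  note tn = tc[OF n]
  show thesis
  proof (rule that)
    fix v assume v: "v \<in> carrier V"
    show "\<psi> v \<in> part L 0"
    proof -
      obtain v0 v1 where "v0 \<in> part V 0" "v1 \<in> part V 1" "v = v0 \<oplus>\<^bsub>V\<^esub> v1" using V.part_decompose[OF v] .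
      then have v0: "v \<in> part V 0" using even V.part_closed by simp
      have "tens [] v \<in> hom_tensors n (periplectic n) (inflate n V) 0"
        unfolding hom_tensors_def using v0 by (auto intro!: exI[of _ "[]"])
      then have "tens [] v \<in> free_span syms (hom_tensors n (periplectic n) (inflate n V) 0)"
        unfolding free_span_def by (rule hull_inc)
      then have "coset (tens [] v) \<in> part induced 0" by (simp add: Ind_def Let_def)
      then show ?thesis unfolding \<psi>_def \<Phi>_def using h(4) by blast
    qed
    show "\<psi> (c \<odot>\<^bsub>V\<^esub> v) = c \<odot>\<^bsub>L\<^esub> \<psi> v" for c
    proof -
      have "tens [] (c \<odot>\<^bsub>V\<^esub> v) - pm_scale c (tens [] v) \<in> rels"
        using ind_relators.vector_smult[of "[]" "periplectic n" v "inflate n V" c] v by simp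
      then show ?thesis
        using Prel F_scale[OF tn[OF v]] Pscale[OF tn[OF v]] unfolding \<psi>_def by metis
    qed
    show "\<psi> (v \<oplus>\<^bsub>V\<^esub> w) = \<psi> v \<oplus>\<^bsub>L\<^esub> \<psi> w" if w: "w \<in> carrier V" for w
    proof -
      have "tens [] (v \<oplus>\<^bsub>V\<^esub> w) - (tens [] v + tens [] w) \<in> rels"
        using ind_relators.vector_add[of "[]" "periplectic n" v "inflate n V" w] v w by (simp add: diff_diff_eq)
      moreover have "tens [] v + tens [] w \<in> carrier (free_vs syms)"
        using F.a_closed[OF tn[OF v] tn[OF w]] by simp
      ultimately show ?thesis
        using Prel Padd[OF tn[OF v] tn[OF w]] unfolding \<psi>_def by metis
    qed
    show "act L x (\<psi> v) = \<psi> (act V (hom_comp n 0 x) v)" if x: "x \<in> periplectic_nonpos n" for x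
    proof -
      have "tens ([] @ [x]) v - tens [] (act V (hom_comp n 0 x) v) \<in> rels"
        using ind_relators.balanced[of "[]" "periplectic n" x "periplectic_nonpos n" v "inflate n V"] x v by simp
      then have "\<Phi> (tens [x] v) = \<Phi> (tens [] (act V (hom_comp n 0 x) v))"
        using Prel tn[OF act_inflate_closed[OF x v]] by simp
      then show ?thesis
        using Pact[OF periplectic_nonpos_subset[OF x] tn[OF v]] unfolding \<psi>_def by simp
    qed
  next
    show "\<exists>v\<in>carrier V. \<psi> v \<noteq> \<zero>\<^bsub>L\<^esub>"
    proof (rule ccontr)
      assume "\<not> ?thesis"
      then have van: "\<Phi> (tens [] v) = \<zero>\<^bsub>L\<^esub>" if "v \<in> carrier V" for v using that unfolding \<psi>_def by blast
      \<comment> \<open>Letters are peeled off from the left: a longer tensor is an action on a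
        shorter one.\<close>
      have tens: "\<Phi> (tens u v) = \<zero>\<^bsub>L\<^esub>" if "u \<in> lists (periplectic n)" "v \<in> carrier V" for u v
        using that
      proof (induction u)
        case (Cons x u)
        then have "\<Phi> (prepend x (tens u v)) = \<zero>\<^bsub>L\<^esub>" using Pact[of x "tens u v"] tc[of u v] L.act_zero by simp
        then show ?case by simp
      qed (use van in simp)
      have "\<Phi> f = \<zero>\<^bsub>L\<^esub>" if f: "f \<in> carrier (free_vs syms)" for f
      proof -
        have "f \<in> carrier (free_vs syms) \<and> \<Phi> f = \<zero>\<^bsub>L\<^esub>"
          using f
        proof (rule free_vs_induct)
          show "0 \<in> carrier (free_vs syms) \<and> \<Phi> 0 = \<zero>\<^bsub>L\<^esub>" using z P0 by blast
          show "f + k \<in> carrier (free_vs syms) \<and> \<Phi> (f + k) = \<zero>\<^bsub>L\<^esub>"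
            if "f \<in> carrier (free_vs syms) \<and> \<Phi> f = \<zero>\<^bsub>L\<^esub>" "k \<in> carrier (free_vs syms) \<and> \<Phi> k = \<zero>\<^bsub>L\<^esub>" for f k
            using that Padd[of f k] F.a_closed[of f k] by simp
          show "pm_scale c (Poly_Mapping.single k 1) \<in> carrier (free_vs syms) \<and> \<Phi> (pm_scale c (Poly_Mapping.single k 1)) = \<zero>\<^bsub>L\<^esub>"
            if ks: "k \<in> syms" for c k
          proof -
            obtain u v where k: "k = (u, v)" "u \<in> lists (periplectic n)" "v \<in> carrier V"
              using ks by (auto simp: symbols_def)
            show ?thesis
              unfolding k(1) using F_scale[OF tc[OF k(2,3)]] Pscale[OF tc[OF k(2,3)]] tens[OF k(2,3)] by (simp del: pm_scale_single)
          qed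
        qed
        then show ?thesis by blast
      qed
      then have "\<phi> ` carrier induced \<subseteq> {\<zero>\<^bsub>L\<^esub>}" unfolding induced_simps \<Phi>_def by auto
      then show False using surj nt L.zero_closed by auto
    qed
  qed
qed

end

text \<open>The extremal vector is the image of a highest weight vector of V. It is nonzero because
  the kernel of \<psi> is a graded submodule of the simple module V. Upper triangular elements of
  g_0 act as in V, and g_(-1) acts by zero because the inflated action only sees the even
  component.\<close>

lemma is_L_extremal:
  fixes V :: "'v smod" and L :: "'x smod"
  assumes V: "is_V n lam V" and L: "is_L n V L"
  shows "simple_psupermodule n L" "\<exists>v. extremal n L (\<lambda>i. - int i - 1) ((!) lam) 0 v"
proof -
  show sL: "simple_psupermodule n L" using L unfolding is_L_def simple_psupermodule_iff by blast
  interpret L: simple_psupermodule n L by (rule sL)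
  have V': "supermodule n (periplectic_zero n) V" "part V 1 = {\<zero>\<^bsub>V\<^esub>}"
    and simp: "\<And>N. graded_submodule (periplectic_zero n) V N \<Longrightarrow> N = {\<zero>\<^bsub>V\<^esub>} \<or> N = carrier V"
    using V unfolding is_V_def simple_supermodule_def by blast+
  interpret V: supermodule n "periplectic_zero n" V by (rule V'(1))
  obtain v where v: "highest_weight_vector n lam V v" using V unfolding is_V_def by blast
  then have vc: "v \<in> carrier V" "v \<noteq> \<zero>\<^bsub>V\<^esub>"
    and vA: "\<And>A. A \<in> carrier_mat n n \<Longrightarrow> upper_triangular A \<Longrightarrow>
      act V (gl_embed n A) v = (\<Sum>i<n. A $$ (i, i) * of_int (lam ! i)) \<odot>\<^bsub>V\<^esub> v"
    unfolding highest_weight_vector_def by auto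
  obtain \<phi> where phi: "\<phi> \<in> smod_hom (periplectic n) (Ind n (periplectic n) (periplectic_nonpos n) (inflate n V)) L"
    "\<phi> ` carrier (Ind n (periplectic n) (periplectic_nonpos n) (inflate n V)) = carrier L"
    using L unfolding is_L_def by blast
  obtain \<psi> where psi: "\<And>v. v \<in> carrier V \<Longrightarrow> \<psi> v \<in> part L 0"
    "\<And>v w. v \<in> carrier V \<Longrightarrow> w \<in> carrier V \<Longrightarrow> \<psi> (v \<oplus>\<^bsub>V\<^esub> w) = \<psi> v \<oplus>\<^bsub>L\<^esub> \<psi> w"
    "\<And>c v. v \<in> carrier V \<Longrightarrow> \<psi> (c \<odot>\<^bsub>V\<^esub> v) = c \<odot>\<^bsub>L\<^esub> \<psi> v"
    "\<And>x v. x \<in> periplectic_nonpos n \<Longrightarrow> v \<in> carrier V \<Longrightarrow> act L x (\<psi> v) = \<psi> (act V (hom_comp n 0 x) v)"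
    "\<exists>v\<in>carrier V. \<psi> v \<noteq> \<zero>\<^bsub>L\<^esub>"
    using quotient_map[OF V'(1) L.psupermodule_axioms L.nontrivial phi V'(2)] by blast
  have psi0: "\<psi> \<zero>\<^bsub>V\<^esub> = \<zero>\<^bsub>L\<^esub>"
    using psi(3)[OF V.zero_closed, of 0] L.part_closed[OF psi(1)[OF V.zero_closed]] by simp
  have nonpos0: "x \<in> periplectic_nonpos n" if "x \<in> periplectic_zero n" for x
    using that unfolding periplectic_zero_def periplectic_nonpos_def gl_embed_def by force
  have evenV: "w \<in> part V 0" if w: "w \<in> carrier V" for w
  proof -
    obtain v0 v1 where "v0 \<in> part V 0" "v1 \<in> part V 1" "w = v0 \<oplus>\<^bsub>V\<^esub> v1" using V.part_decompose[OF w] .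
    then show ?thesis using V'(2) V.part_closed by simp
  qed
  have nz: "\<psi> v \<noteq> \<zero>\<^bsub>L\<^esub>"
  proof
    assume v0: "\<psi> v = \<zero>\<^bsub>L\<^esub>"
    let ?K = "{w \<in> carrier V. \<psi> w = \<zero>\<^bsub>L\<^esub>}"
    have sub: "V.lin_subspace ?K"
      by (rule V.lin_subspaceI) (use psi psi0 in auto)
    have "graded_submodule (periplectic_zero n) V ?K"
      unfolding graded_submodule_def V.submodule_iff_lin_subspace
    proof (intro conjI ballI sub)
      fix x w assume x: "x \<in> periplectic_zero n" and w: "w \<in> ?K"
      have "hom_comp n 0 x = x" using x unfolding periplectic_zero_eq[OF V'(1)] by (rule hom_comp_self)
      then have "\<psi> (act V x w) = act L x (\<psi> w)" using psi(4)[OF nonpos0[OF x], of w] w by simp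
      then show "act V x w \<in> ?K"
        using w L.act_zero V.act_closed[OF x] hom_part_subset x unfolding periplectic_zero_eq[OF V'(1)] by auto
    next
      show "?K = (?K \<inter> part V 0) <+>\<^bsub>V\<^esub> (?K \<inter> part V 1)"
      proof (intro equalityI subsetI)
        fix w assume w: "w \<in> ?K"
        then have "w = w \<oplus>\<^bsub>V\<^esub> \<zero>\<^bsub>V\<^esub>" "w \<in> ?K \<inter> part V 0" "\<zero>\<^bsub>V\<^esub> \<in> ?K \<inter> part V 1"
          using evenV psi0 V'(2) by auto
        then show "w \<in> (?K \<inter> part V 0) <+>\<^bsub>V\<^esub> (?K \<inter> part V 1)" unfolding set_add_def' by blast
      qed (use V.lin_subspaceD(3)[OF sub] in \<open>auto simp: set_add_def'\<close>)
    qed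
    from simp[OF this] show False using vc v0 psi(5) by blast
  qed
  have c1: "c1 \<in> periplectic_nonpos n" if c: "weight_vector n 1 w c1" "\<And>i j. i < n \<Longrightarrow> j < n \<Longrightarrow> c1 $$ (i, n + j) = 0" for w c1
  proof -
    note D = hom_part_periplecticD[OF weight_vector_hom_part[OF c(1)]]
    obtain A B C where x: "c1 = four_block_mat A B C (- transpose_mat A)" "A \<in> carrier_mat n n" "B \<in> carrier_mat n n" "C \<in> carrier_mat n n" "transpose_mat C = - C"
      using weight_vector_periplectic[OF c(1)] unfolding periplectic_def by blast
    have "B = 0\<^sub>m n n"
    proof (rule eq_matI)
      fix i j assume ij: "i < dim_row (0\<^sub>m n n :: complex mat)" "j < dim_col (0\<^sub>m n n :: complex mat)"
      then have "c1 $$ (i, n + j) = B $$ (i, j)" unfolding x(1) using x(2-4) by auto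
      then show "B $$ (i, j) = 0\<^sub>m n n $$ (i, j)" using c(2)[of i j] ij by simp
    qed (use x in auto)
    then show ?thesis using x unfolding periplectic_nonpos_def by blast
  qed
  have act0: "act L z (\<psi> v) = (\<Sum>i<n. z $$ (i, i) * of_int (lam ! i)) \<odot>\<^bsub>L\<^esub> \<psi> v"
    if z: "z \<in> hom_part n (periplectic n) 0" "\<And>i j. i < n \<Longrightarrow> j < i \<Longrightarrow> z $$ (i, j) = 0" for z
  proof -
    have zz: "z \<in> periplectic_zero n" using z(1) unfolding periplectic_zero_eq[OF V'(1)] .
    then obtain A where A: "A \<in> carrier_mat n n" "z = gl_embed n A" unfolding periplectic_zero_def by blast
    have e: "z $$ (i, j) = A $$ (i, j)" if "i < n" "j < n" for i j
      using that A by (auto simp: gl_embed_def)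
    have "upper_triangular A" unfolding upper_triangular_def using z(2) e A(1) by auto
    from vA[OF A(1) this] have "act V z v = (\<Sum>i<n. z $$ (i, i) * of_int (lam ! i)) \<odot>\<^bsub>V\<^esub> v"
      unfolding A(2)[symmetric] by (simp add: e)
    then show ?thesis
      using psi(4)[OF nonpos0[OF zz] vc(1)] hom_comp_self[OF z(1)] psi(3)[OF vc(1)] by simp
  qed
  have "extremal n L (\<lambda>i. - int i - 1) ((!) lam) 0 (\<psi> v)"
    unfolding extremal_def
  proof (intro conjI allI impI)
    show "\<psi> v \<in> part L 0" using psi(1) vc by blast
    show "\<psi> v \<noteq> \<zero>\<^bsub>L\<^esub>" by (rule nz)
    fix p w z assume "weight_vector n p w z \<and> 0 < pairing n (\<lambda>i. - int i - 1) w"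
    then have z: "weight_vector n p w z" and pos: "0 < pairing n (\<lambda>i. - int i - 1) w" by auto
    have pc: "\<psi> v \<in> carrier L" using L.part_closed psi(1) vc by blast
    show "act L z (\<psi> v) = \<zero>\<^bsub>L\<^esub>"
    proof (cases "z = 0\<^sub>m (n + n) (n + n)")
      case True
      then show ?thesis using L.act_zero_mat[OF pc] by simp
    next
      case False
      have "w \<noteq> (\<lambda>_. 0)" using pos by auto
      with z False show ?thesis
      proof (cases rule: weight_vector_cases)
        case (E i j c)
        have ij: "i < j" using pos E by (simp add: pairing_roots)
        have "act L z (\<psi> v) = (\<Sum>k<n. z $$ (k, k) * of_int (lam ! k)) \<odot>\<^bsub>L\<^esub> \<psi> v"
        proof (rule act0)
          show "z \<in> hom_part n (periplectic n) 0" using weight_vector_hom_part[OF z] E by simp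
          show "z $$ (r, s) = 0" if "r < n" "s < r" for r s
            using that ij E by (auto simp: E_mat_def)
        qed
        also have "(\<Sum>k<n. z $$ (k, k) * of_int (lam ! k)) = 0"
          by (rule sum.neutral) (use E in \<open>auto simp: E_mat_def\<close>)
        finally show ?thesis using pc by simp
      next
        case (B i j c)
        then show ?thesis using pos by (simp add: pairing_roots)
      next
        case (C i j c)
        have z1: "weight_vector n 1 w z" using z C by simp
        have np: "z \<in> periplectic_nonpos n"
          by (rule c1[OF z1]) (use C in \<open>auto simp: C_mat_def\<close>)
        have "hom_comp n 0 z = 0\<^sub>m (n + n) (n + n)"
          by (rule hom_comp_other[OF weight_vector_hom_part[OF z1]]) simp
        moreover have "act V (0\<^sub>m (n + n) (n + n)) v = \<zero>\<^bsub>V\<^esub>"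
        proof -
          have g: "torus_mat n (\<lambda>_. 0) \<in> periplectic_zero n"
            unfolding periplectic_zero_eq[OF V'(1)] by (rule weight_vector_hom_part[OF weight_vector_torus_mat])
          have "0 \<cdot>\<^sub>m torus_mat n (\<lambda>_. 0) = 0\<^sub>m (n + n) (n + n)"
            by (auto simp: torus_mat_def intro!: eq_matI)
          with V.smult_act[OF g vc(1), of 0] V.act_closed[OF g vc(1)] show ?thesis by simp
        qed
        ultimately show ?thesis using psi(4)[OF np vc(1)] psi0 by simp
      qed
    qed
  next
    fix z assume z: "weight_vector n 0 (\<lambda>_. 0) z"
    show "act L z (\<psi> v) = torus_weight n z ((!) lam) \<odot>\<^bsub>L\<^esub> \<psi> v"
      unfolding torus_weight_def
      by (rule act0[OF weight_vector_hom_part[OF z]]) (rule weight_vector_zero_offdiag[OF z], auto)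
  qed
  then show "\<exists>v. extremal n L (\<lambda>i. - int i - 1) ((!) lam) 0 v" by blast
qed

section \<open>Parity switch and the dual weight\<close>

lemma parity_switch_simps [simp]:
  "carrier (parity_switch M) = carrier M" "\<zero>\<^bsub>parity_switch M\<^esub> = \<zero>\<^bsub>M\<^esub>"
  "v \<oplus>\<^bsub>parity_switch M\<^esub> w = v \<oplus>\<^bsub>M\<^esub> w" "c \<odot>\<^bsub>parity_switch M\<^esub> v = c \<odot>\<^bsub>M\<^esub> v"
  "part (parity_switch M) p = part M (p + 1)" "act (parity_switch M) = act M"
  by (simp_all add: parity_switch_def)

lemma parity_switch_psupermodule:
  assumes "psupermodule n M"
  shows "psupermodule n (parity_switch M)"
proof -
  interpret A: psupermodule n M by (rule assms)
  let ?P = "parity_switch M"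
  have mod: "Module.module complex_ring ?P"
  proof (rule moduleI)
    show "abelian_group ?P"
    proof (rule abelian_groupI)
      fix a assume "a \<in> carrier ?P"
      then show "\<exists>b\<in>carrier ?P. b \<oplus>\<^bsub>?P\<^esub> a = \<zero>\<^bsub>?P\<^esub>"
        by (intro bexI[of _ "\<ominus>\<^bsub>M\<^esub> a"]) (auto simp: A.l_neg)
    qed (auto simp: A.a_ac)
  qed (auto simp: cring_complex_ring A.scale_add_left A.scale_add_right A.scale_scale)
  interpret P: cspace ?P unfolding cspace_def by (rule mod)
  show ?thesis
    unfolding psupermodule_def
  proof (rule supermodule.intro[OF mod supermodule_axioms.intro])
    fix p
    show "submodule (part ?P p) complex_ring ?P"
      unfolding P.submodule_iff_lin_subspace
      using A.lin_subspaceD[OF A.part_subspace[of "p + 1"]] by (intro P.lin_subspaceI) auto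
    show "carrier ?P = part ?P 0 <+>\<^bsub>?P\<^esub> part ?P 1"
    proof (intro equalityI subsetI)
      fix v assume "v \<in> carrier ?P"
      then obtain a b where "a \<in> part M 1" "b \<in> part M (1 + 1)" "v = a \<oplus>\<^bsub>M\<^esub> b"
        using A.part_decompose'[of v 1] by auto
      then have "a \<in> part ?P 0" "b \<in> part ?P 1" "v = a \<oplus>\<^bsub>?P\<^esub> b" by simp_all
      then show "v \<in> part ?P 0 <+>\<^bsub>?P\<^esub> part ?P 1" unfolding set_add_def' by blast
    qed (auto simp: set_add_def' A.part_closed)
    show "part ?P 0 \<inter> part ?P 1 = {\<zero>\<^bsub>?P\<^esub>}"
      using A.part_inter by auto
  next
    fix x y v p q
    assume x: "x \<in> hom_part n (periplectic n) p" and y: "y \<in> hom_part n (periplectic n) q" and v: "v \<in> carrier ?P"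
    have c: "act M x (act M y v) \<in> carrier M" "act M y (act M x v) \<in> carrier M"
      using A.act_closed hom_part_subset[OF x] hom_part_subset[OF y] v by auto
    have "act ?P x (act ?P y v) \<in> carrier ?P" "koszul_sign p q \<odot>\<^bsub>?P\<^esub> act ?P y (act ?P x v) \<in> carrier ?P"
      using c by auto
    note m = P.minus_eq_scale[OF this]
    show "act ?P (superbracket p q x y) v = act ?P x (act ?P y v) \<ominus>\<^bsub>?P\<^esub> koszul_sign p q \<odot>\<^bsub>?P\<^esub> act ?P y (act ?P x v)"
      unfolding m using c v by (simp add: A.act_superbracket[OF x y] A.minus_eq_scale)
  next
    fix x v p q
    assume "x \<in> hom_part n (periplectic n) p" "v \<in> part ?P q"
    then show "act ?P x v \<in> part ?P (p + q)"
      using A.act_part[of x p v "q + 1"] by (simp add: add.assoc)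
  qed (auto simp: A.act_closed A.act_add A.act_smult A.add_act A.smult_act)
qed

text \<open>Graded submodules stay the same; only the labels of the two parity projections are
  exchanged.\<close>

lemma parity_switch_simple:
  assumes "simple_psupermodule n M"
  shows "simple_psupermodule n (parity_switch M)"
proof -
  interpret A: simple_psupermodule n M by (rule assms)
  interpret P: psupermodule n "parity_switch M"
    by (rule parity_switch_psupermodule[OF A.psupermodule_axioms])
  have proj: "proj (parity_switch M) q y = proj M (q + 1) y" for q y
    unfolding proj_def by simp
  have lin: "P.lin_subspace S \<longleftrightarrow> A.lin_subspace S" for S
    unfolding P.lin_subspace_def A.lin_subspace_def by simp
  show ?thesis
  proof
    show "carrier (parity_switch M) \<noteq> {\<zero>\<^bsub>parity_switch M\<^esub>}" using A.nontrivial by simp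
    fix N assume N: "graded_submodule (periplectic n) (parity_switch M) N"
    have "proj M q y \<in> N" if "y \<in> N" for q y
      using N that proj[of "q + 1" y] unfolding P.graded_submodule_iff by (metis bit_add_one_twice)
    then have "graded_submodule (periplectic n) M N"
      using N unfolding P.graded_submodule_iff A.graded_submodule_iff lin by simp
    then show "N = {\<zero>\<^bsub>parity_switch M\<^esub>} \<or> N = carrier (parity_switch M)"
      using A.simple by simp
  qed
qed

lemma parity_switch_extremal:
  "extremal n M x nu q v \<Longrightarrow> extremal n (parity_switch M) x nu (q + 1) v"
  unfolding extremal_def by (simp add: add.assoc)

lemma parity_switch_iterate:
  assumes "simple_psupermodule n M" "extremal n M x nu q v"
  shows "simple_psupermodule n ((parity_switch ^^ k) M)" "extremal n ((parity_switch ^^ k) M) x nu (q + of_nat k) v"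
proof -
  show "simple_psupermodule n ((parity_switch ^^ k) M)"
    by (induction k) (simp_all add: assms(1) parity_switch_simple)
  show "extremal n ((parity_switch ^^ k) M) x nu (q + of_nat k) v"
  proof (induction k)
    case (Suc k)
    then show ?case using parity_switch_extremal[OF Suc] by (simp add: add.assoc add.commute[of 1])
  qed (simp add: assms(2))
qed

text \<open>Weights are functions on all naturals, of which the first n values enter.\<close>

lemma extremal_weight_cong:
  assumes "extremal n M x nu q v" "\<And>i. i < n \<Longrightarrow> nu i = nu' i"
  shows "extremal n M x nu' q v"
proof -
  have "torus_weight n z nu = torus_weight n z nu'" for z
    unfolding torus_weight_def using assms(2) by (intro sum.cong) auto
  then show ?thesis using assms(1) unfolding extremal_def by simp
qed

text \<open>The even path ends with a sorted rearrangement of a weakly decreasing weight, which can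
  only be its reversal.\<close>

lemma (in simple_psupermodule) opposite_extremal:
  assumes v: "extremal n M (\<lambda>i. - int i - 1) nu 0 v" and d: "descending n nu"
  defines "mu \<equiv> fold (odd_stage n) [0..<n] nu"
  shows "\<exists>k u. extremal n M (\<lambda>i. int i + 1) (\<lambda>i. mu (n - 1 - i)) (of_nat k) u \<and>
    (\<Sum>i<n. mu i) = (\<Sum>i<n. nu i) + 2 * int k"
proof (cases "n = 0")
  case True
  \<comment> \<open>For n = 0 every pairing is zero, so extremality is the same for all
    functionals.\<close>
  have "extremal n M (\<lambda>i. int i + 1) nu 0 v"
    using v True unfolding extremal_def pairing_def by simp
  from extremal_weight_cong[OF this, of "\<lambda>i. mu (n - 1 - i)"]
  have "extremal n M (\<lambda>i. int i + 1) (\<lambda>i. mu (n - 1 - i)) (of_nat 0) v"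
    using True by simp
  then show ?thesis using True by (intro exI[of _ 0] exI[of _ v]) simp
next
  case False
  then have n: "0 < n" by simp
  obtain x k v' where x: "odd_chamber n n n x" "extremal n M x mu (of_nat k) v'"
    "(\<Sum>i<n. mu i) = (\<Sum>i<n. nu i) + 2 * int k"
    using odd_path[OF v n] unfolding mu_def by blast
  have dm: "descending n mu" unfolding mu_def by (rule weight_dagger_eq(2)[OF d])
  obtain nu' u where u: "extremal n M (\<lambda>i. int i + 1) nu' (of_nat k) u"
    "mset (map nu' [0..<n]) = mset (map mu [0..<n])" "\<forall>i j. i < j \<and> j < n \<longrightarrow> nu' i \<le> nu' j"
    using even_path[OF x(1,2) n] dm unfolding descending_def by blast
  have "sorted (map nu' [0..<n])" using u(3) by (auto simp: sorted_iff_nth_mono_less)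
  then have "sort (map mu [0..<n]) = map nu' [0..<n]" using properties_for_sort u(2) by metis
  moreover have "sorted (rev (map mu [0..<n]))"
    unfolding sorted_rev_iff_nth_mono using descendingD[OF dm] by auto
  then have "sort (map mu [0..<n]) = rev (map mu [0..<n])" by (intro properties_for_sort) auto
  ultimately have e: "map nu' [0..<n] = rev (map mu [0..<n])" by simp
  have "nu' i = mu (n - 1 - i)" if "i < n" for i
    using arg_cong[OF e, of "\<lambda>l. l ! i"] that by (simp add: rev_nth)
  then have "extremal n M (\<lambda>i. int i + 1) (\<lambda>i. mu (n - 1 - i)) (of_nat k) u"
    by (rule extremal_weight_cong[OF u(1)])
  then show ?thesis using x(3) by blast
qed

theorem proposition5p3p1:
  fixes n :: nat
    and lam :: "int list"
    and V :: "'v smod"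
    and V' :: "'w smod"
    and L :: "'x smod"
    and L' :: "'y smod"
  assumes "lam \<in> dominant_weights n"
    and "is_V n lam V" and "is_L n V L"
    and "is_V n (weight_sharp n lam) V'" and "is_L n V' L'"
  shows "\<exists>m::int. 2 * m = sum_list (weight_sharp n lam) + sum_list lam \<and>
           smod_iso (periplectic n) L' (parity_switch_power m (dual n L))"
proof -
  let ?x = "\<lambda>i. - int i - 1"
  interpret L: simple_psupermodule n L by (rule is_L_extremal(1)[OF assms(2,3)])
  obtain v where v: "extremal n L ?x ((!) lam) 0 v" using is_L_extremal(2)[OF assms(2,3)] by blast
  obtain v' where v': "extremal n L' ?x ((!) (weight_sharp n lam)) 0 v'" using is_L_extremal(2)[OF assms(4,5)] by blast
  have lam: "map ((!) lam) [0..<n] = lam"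
    using assms(1) map_nth[of lam] by (simp add: dominant_weights_def)
  have d: "descending n ((!) lam)" using assms(1) lam dominant_iff_descending by metis
  define mu where "mu = fold (odd_stage n) [0..<n] ((!) lam)"
  obtain k u where u: "extremal n L (\<lambda>i. int i + 1) (\<lambda>i. mu (n - 1 - i)) (of_nat k) u"
    and sum: "(\<Sum>i<n. mu i) = (\<Sum>i<n. lam ! i) + 2 * int k"
    using L.opposite_extremal[OF v d] unfolding mu_def by blast
  have sharp: "weight_sharp n lam = map (\<lambda>i. - mu (n - 1 - i)) [0..<n]"
    using weight_sharp_eq[OF d] unfolding lam mu_def .
  have reg: "regular n ?x" "regular n (\<lambda>i. int i + 1)" by (rule regularI; simp)+
  \<comment> \<open>The start and the end of the path are negatives of each other; hence the dual of
    the vector at the end is extremal for the functional at the start.\<close>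
  have neg: "(\<lambda>i. - ?x i) = (\<lambda>i. int i + 1)" "(\<lambda>i. - (int i + 1)) = ?x" by auto
  obtain B where B: "finite B" "B \<subseteq> carrier L" "carrier L = L.lin_span B"
    using L.finite_dimensional[of ?x, unfolded neg, OF reg v u] by blast
  have D: "simple_psupermodule n (dual n L)" by (rule L.dual_simple[OF B reg(1) v])
  obtain xi where xi: "extremal n (dual n L) ?x (\<lambda>i. - mu (n - 1 - i)) (of_nat k) xi"
    using L.dual_extremal[OF reg(2) u] unfolding neg by blast
  \<comment> \<open>Each of the k moves adds 2 to the sum of the weight, and the dual weight has the
    negated sum; so m is nonpositive with absolute value k.\<close>
  define m where "m = - int k"
  \<comment> \<open>After k switches the parity k of the dual vector becomes k + k = 0, that of the
    highest weight vector of L'.\<close>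
  have P: "simple_psupermodule n (parity_switch_power m (dual n L))"
    "extremal n (parity_switch_power m (dual n L)) ?x (\<lambda>i. - mu (n - 1 - i)) 0 xi"
    using parity_switch_iterate[OF D xi, of k] by (simp_all add: parity_switch_power_def m_def bit_add_self)
  have "extremal n L' ?x (\<lambda>i. - mu (n - 1 - i)) 0 v'"
    by (rule extremal_weight_cong[OF v']) (simp add: sharp)
  then have "smod_iso (periplectic n) L' (parity_switch_power m (dual n L))"
    using simple_unique[OF P(1) is_L_extremal(1)[OF assms(4,5)] reg(1) P(2)] by blast
  moreover have "2 * m = sum_list (weight_sharp n lam) + sum_list lam"
  proof -
    have "sum_list (weight_sharp n lam) = (\<Sum>i<n. - mu (n - 1 - i))"
      unfolding sharp interv_sum_list_conv_sum_set_nat by (simp add: atLeast0LessThan)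
    also have "\<dots> = - (\<Sum>i<n. mu i)"
      using sum.nat_diff_reindex[of mu n] by (simp add: sum_negf)
    finally have "sum_list (weight_sharp n lam) = - (\<Sum>i<n. mu i)" .
    moreover have "sum_list lam = (\<Sum>i<n. lam ! i)"
      using assms(1) by (simp add: dominant_weights_def sum_list_sum_nth atLeast0LessThan)
    ultimately show ?thesis using sum by (simp add: m_def)
  qed
  ultimately show ?thesis by blast
qed

end
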